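(* Let $f$ be a real-valued smooth function of finite type defined on a neighborhood of the origin in $\mathbb{R}^2$ with $f(0,0)=0$, $\nabla f(0,0)=0$. Then the height $h(f)$ is a rational number. Moreover, choose $\kappa_1,\kappa_2\ge0$ such that the principal face $\pi(f)$ of the Newton polyhedron of $f$ lies on the line $\kappa_1t_1+\kappa_2t_2=1$, and assume without loss of generality (interchanging coordinates if necessary) that $\kappa_2\ge\kappa_1$. Then: (1) The given coordinates $(x_1,x_2)$ are not adapted to $f$ if and only if all of the following conditions are satisfied: (a) $\pi(f)$ is a compact edge (so that $\kappa_1,\kappa_2>0$ are uniquely determined); (b) $\kappa_2/\kappa_1\in\mathbb{N}$; (c) any root of $f_p$ of maximal order $m(f_p)$ on the unit circle $S^1$ (i.e. any point of $S^1$ at which $f_p$ vanishes to order $m(f_p)$) lies away from the coordinate axes, and $m(f_p)>d(f)$. In particular, the given coordinates are adapted to $f$ if and only if they are adapted to the principal part $f_p$ of $f$. Moreover, one always has $h(f)\le h(f_p)$. (2) One can always find a smooth change of coordinates $x=\varphi(y)$ at $0$ of the form $y_1:=x_1$, $y_2:=x_2-\psi(x_1)$ such that the coordinates $(y_1,y_2)$ are adapted to $\tilde f:=f\circ\varphi$ (i.e. $d(\tilde f)=h(f)$) and the following holds: if the principal face $\pi(\tilde f)$ is compact and lies on the supporting line $\tilde\kappa_1t_1+\tilde\kappa_2t_2=1$ of $\mathcal{N}(\tilde f)$ with $\tilde\kappa_1\le\tilde\kappa_2$, then $\psi$ is a polynomial of degree strictly less than $\tilde\kappa_2/\tilde\kappa_1$.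 This applies in particular if the height $h(f)$ of $f$ is a non-integer rational number. (3) There always exists a change of coordinates $x=\varphi(y)$ at the origin of the form $y_1:=x_1$, $y_2:=x_2-\eta(x_1)$, with a polynomial function $\eta$, such that, with $\tilde f:=f\circ\varphi$, one has $h(f)=h(\tilde f)=h(\tilde f_p)$.
   Context: Here $\mathbb{N}=\{0,1,2,\dots\}$ and $\mathbb{R}_+=[0,\infty)$. For a smooth real-valued $f$ near the origin with Taylor series $\sum_{j,k}c_{jk}x_1^jx_2^k$ at the origin, the Taylor support is $\mathcal{T}(f)=\{(j,k)\in\mathbb{N}^2:c_{jk}\neq0\}$; $f$ is of finite type (at the origin) if $\mathcal{T}(f)\neq\emptyset$. The Newton polyhedron $\mathcal{N}(f)$ is the convex hull of the union of all quadrants $(j,k)+\mathbb{R}_+^2$, $(j,k)\in\mathcal{T}(f)$, in the plane with coordinates $(t_1,t_2)$. A face is an edge (possibly unbounded) or a vertex. The distance $d(f)$ is the number $d$ such that $(d,d)$ is the point where the bisectrix $t_1=t_2$ intersects the boundary of $\mathcal{N}(f)$. The principal face $\pi(f)$ is the face of minimal dimension containing $(d,d)$. The principal part of $f$ is $f_p(x_1,x_2)=\sum_{(j,k)\in\pi(f)}c_{jk}x_1^jx_2^k$: a polynomial if $\pi(f)$ is compact, otherwise a formal power series. A local smooth coordinate system $y$ at the origin is given by $x=\varphi(y)$ with $\varphi$ a smooth local diffeomorphism near $0$ with $\varphi(0)=0$; in it $f$ is expressed as $f\circ\varphi$, and $d_y:=d(f\circ\varphi)$. The height is $h(f):=\sup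 d_y$, the supremum over all local smooth coordinate systems $y$ at the origin. The coordinate system $y$ is adapted to $f$ if $d_y=h(f)$; the given coordinates are adapted if $d(f)=h(f)$. Changes of coordinates are local and preserve $0$, so $\psi(0)=\eta(0)=0$. Since $d(f\circ\varphi)$ depends only on the Taylor series of $f$ and $\varphi$ at $0$, the notions of distance, height and adaptedness also make sense for a formal power series such as $f_p$. When $\pi(f)$ is compact, $f_p$ is mixed homogeneous (i.e. $f_p(r^{\kappa_1}x_1,r^{\kappa_2}x_2)=r f_p(x_1,x_2)$ for all $r>0$), and $m(f_p)$ denotes the maximal order of vanishing of $f_p$ along the unit circle $S^1$ centered at the origin. *)

theory Defs
  imports "HOL-Analysis.Analysis" "HOL-Computational_Algebra.Computational_Algebra"
begin

section \<open>Smooth germs and local coordinates\<close>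

text \<open>The sets \<open>U\<close> are meant to be open. Functions are total; all notions below depend only on
  the germ of the function at the origin.\<close>

primrec C_upto :: "nat \<Rightarrow> 'a::real_normed_vector set \<Rightarrow> ('a \<Rightarrow> 'b::real_normed_vector) \<Rightarrow> bool" where
  "C_upto 0 U g \<longleftrightarrow> continuous_on U g"
| "C_upto (Suc n) U g \<longleftrightarrow> (\<forall>x\<in>U. g differentiable (at x)) \<and>
     (\<forall>v. C_upto n U (\<lambda>x. frechet_derivative g (at x) v))"

definition smooth_on :: "'a::real_normed_vector set \<Rightarrow> ('a \<Rightarrow> 'b::real_normed_vector) \<Rightarrow> bool" where
  "smooth_on U g \<longleftrightarrow> (\<forall>n. C_upto n U g)"

definition smooth_near_0 :: "('a::real_normed_vector \<Rightarrow> 'b::real_normed_vector) \<Rightarrow> bool" where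
  "smooth_near_0 g \<longleftrightarrow> (\<exists>U. open U \<and> 0 \<in> U \<and> smooth_on U g)"

text \<open>The map \<open>\<phi>\<close> sends the new coordinates \<open>y\<close> to the given ones: \<open>x = \<phi>(y)\<close>.\<close>

definition local_coords :: "(real \<times> real \<Rightarrow> real \<times> real) \<Rightarrow> bool" where
  "local_coords \<phi> \<longleftrightarrow> \<phi> 0 = 0 \<and>
     (\<exists>V W \<rho>. open V \<and> 0 \<in> V \<and> open W \<and> 0 \<in> W \<and> homeomorphism V W \<phi> \<rho> \<and>
        smooth_on V \<phi> \<and> smooth_on W \<rho>)"

text \<open>The change of coordinates \<open>y\<^sub>1 = x\<^sub>1\<close>, \<open>y\<^sub>2 = x\<^sub>2 - \<psi>(x\<^sub>1)\<close>, solved for \<open>x\<close>.\<close>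

definition shear :: "(real \<Rightarrow> real) \<Rightarrow> real \<times> real \<Rightarrow> real \<times> real" where
  "shear \<psi> = (\<lambda>(y1, y2). (y1, y2 + \<psi> y1))"


section \<open>Taylor series and formal power series in two variables\<close>

text \<open>A formal power series \<open>\<Sum> c\<^sub>j\<^sub>k x\<^sub>1\<^sup>j x\<^sub>2\<^sup>k\<close> is an element \<open>F\<close> of \<^typ>\<open>real fps fps\<close> with
  \<open>c\<^sub>j\<^sub>k = F $ j $ k\<close>.\<close>

definition partial1 :: "(real \<times> real \<Rightarrow> real) \<Rightarrow> real \<times> real \<Rightarrow> real" where
  "partial1 g = (\<lambda>p. frechet_derivative g (at p) (1, 0))"

definition partial2 :: "(real \<times> real \<Rightarrow> real) \<Rightarrow> real \<times> real \<Rightarrow> real" where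
  "partial2 g = (\<lambda>p. frechet_derivative g (at p) (0, 1))"

definition taylor_coeff :: "(real \<times> real \<Rightarrow> real) \<Rightarrow> real \<times> real \<Rightarrow> nat \<Rightarrow> nat \<Rightarrow> real" where
  "taylor_coeff g p j k = (partial1 ^^ j) ((partial2 ^^ k) g) p / (fact j * fact k)"

definition taylor :: "(real \<times> real \<Rightarrow> real) \<Rightarrow> real fps fps" where
  "taylor g = Abs_fps (\<lambda>j. Abs_fps (\<lambda>k. taylor_coeff g 0 j k))"

text \<open>\<open>F(A, B)\<close>, for \<open>A\<close> and \<open>B\<close> without constant term: then \<open>A\<^sup>a B\<^sup>b\<close> contains only monomials of
  total degree at least \<open>a + b\<close>, so the truncated sum is the whole sum.\<close>

definition fps2_compose :: "real fps fps \<Rightarrow> real fps fps \<Rightarrow> real fps fps \<Rightarrow> real fps fps" where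
  "fps2_compose F A B = Abs_fps (\<lambda>j. Abs_fps (\<lambda>k.
     \<Sum>a\<le>j + k. \<Sum>b\<le>j + k. F $ a $ b * (A ^ a * B ^ b) $ j $ k))"


section \<open>Newton polyhedra\<close>

definition taylor_support :: "real fps fps \<Rightarrow> (nat \<times> nat) set" where
  "taylor_support F = {(j, k). F $ j $ k \<noteq> 0}"

definition finite_type :: "(real \<times> real \<Rightarrow> real) \<Rightarrow> bool" where
  "finite_type g \<longleftrightarrow> taylor_support (taylor g) \<noteq> {}"

definition newton_polyhedron :: "real fps fps \<Rightarrow> (real \<times> real) set" where
  "newton_polyhedron F =
     convex hull (\<Union>(j, k)\<in>taylor_support F. {(t1, t2). real j \<le> t1 \<and> real k \<le> t2})"

definition newton_distance :: "real fps fps \<Rightarrow> real" where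
  "newton_distance F = (THE d. (d, d) \<in> frontier (newton_polyhedron F))"

text \<open>Unlike the library's \<open>face_of\<close>, faces here are only vertices and edges.\<close>

definition newton_face :: "(real \<times> real) set \<Rightarrow> real fps fps \<Rightarrow> bool" where
  "newton_face E F \<longleftrightarrow> E face_of newton_polyhedron F \<and> (aff_dim E = 0 \<or> aff_dim E = 1)"

definition principal_face :: "real fps fps \<Rightarrow> (real \<times> real) set" where
  "principal_face F = (let p = (newton_distance F, newton_distance F) in
     THE E. newton_face E F \<and> p \<in> E \<and>
       (\<forall>E'. newton_face E' F \<and> p \<in> E' \<longrightarrow> aff_dim E \<le> aff_dim E'))"

definition principal_part :: "real fps fps \<Rightarrow> real fps fps" where
  "principal_part F = Abs_fps (\<lambda>j. Abs_fps (\<lambda>k.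
     if (real j, real k) \<in> principal_face F then F $ j $ k else 0))"

definition weight_line :: "real \<Rightarrow> real \<Rightarrow> (real \<times> real) set" where
  "weight_line \<kappa>1 \<kappa>2 = {(t1, t2). \<kappa>1 * t1 + \<kappa>2 * t2 = 1}"

definition supporting_line :: "real \<Rightarrow> real \<Rightarrow> real fps fps \<Rightarrow> bool" where
  "supporting_line \<kappa>1 \<kappa>2 F \<longleftrightarrow>
     newton_polyhedron F \<subseteq> {(t1, t2). \<kappa>1 * t1 + \<kappa>2 * t2 \<ge> 1} \<and>
     newton_polyhedron F \<inter> weight_line \<kappa>1 \<kappa>2 \<noteq> {}"


section \<open>Height and adapted coordinates\<close>

text \<open>For \<open>f\<close> of finite type the suprema below are over bounded sets: the order of vanishing
  of \<open>f\<close> at the origin is invariant under coordinate changes and bounds the distance.\<close>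

definition height :: "(real \<times> real \<Rightarrow> real) \<Rightarrow> real" where
  "height f = Sup {newton_distance (taylor (f \<circ> \<phi>)) | \<phi>. local_coords \<phi>}"

definition adapted_coords :: "(real \<times> real \<Rightarrow> real) \<Rightarrow> (real \<times> real \<Rightarrow> real \<times> real) \<Rightarrow> bool" where
  "adapted_coords f \<phi> \<longleftrightarrow> newton_distance (taylor (f \<circ> \<phi>)) = height f"

text \<open>The same notions for a formal power series, where \<open>F \<circ> \<phi>\<close> is the formal composition with the
  Taylor series of \<open>\<phi>\<close>.\<close>

definition formal_height :: "real fps fps \<Rightarrow> real" where
  "formal_height F =
     Sup {newton_distance (fps2_compose F (taylor (fst \<circ> \<phi>)) (taylor (snd \<circ> \<phi>))) | \<phi>. local_coords \<phi>}"

definition formal_adapted :: "real fps fps \<Rightarrow> bool" where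
  "formal_adapted F \<longleftrightarrow> newton_distance F = formal_height F"


section \<open>Order of vanishing along the unit circle\<close>

text \<open>Evaluation of a series with finite support, i.e. of a polynomial (a sum over an infinite
  set is \<open>0\<close>).\<close>

definition fps2_eval :: "real fps fps \<Rightarrow> real \<times> real \<Rightarrow> real" where
  "fps2_eval F = (\<lambda>(x1, x2). \<Sum>(j, k)\<in>taylor_support F. F $ j $ k * x1 ^ j * x2 ^ k)"

definition vanishing_order :: "(real \<times> real \<Rightarrow> real) \<Rightarrow> real \<times> real \<Rightarrow> nat" where
  "vanishing_order g p = (LEAST n. \<exists>j k. j + k = n \<and> taylor_coeff g p j k \<noteq> 0)"

text \<open>For a nonzero polynomial the maximum is over a finite set, bounded by the degree.\<close>

definition circle_order :: "real fps fps \<Rightarrow> nat" where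
  "circle_order F = Max (vanishing_order (fps2_eval F) ` sphere 0 1)"

end

theory Submission
  imports Defs
begin

text \<open>
  \<^bold>\<open>Distances as weighted orders.\<close> The Newton polyhedron is closed, convex and upward closed, so
  \<open>(t, t)\<close> lies outside its interior iff a supporting line separates the two. Hence \<open>d(F)\<close> is the
  largest value of \<open>ord\<^sub>w(F) / (u + v)\<close> over the weights \<open>w = (u, v) \<ge> 0\<close>, where \<open>ord\<^sub>w(F)\<close> is the
  least weighted degree \<open>u j + v k\<close> of a monomial of \<open>F\<close> (\<open>supporting_weights\<close>,
  \<open>weight_ge_le_distance\<close>), and the height is the supremum of these quotients over all weights and
  all coordinate systems.

  \<^bold>\<open>Shears suffice.\<close> A substitution that does not lower the weights of the two coordinates does
  not lower the order of any series. For \<open>u \<le> v\<close> the order of \<open>F\<close> in the coordinates \<open>y\<close> is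
  therefore determined by the curve \<open>y\<^sub>2 = 0\<close>, which is a graph \<open>x\<^sub>2 = \<psi>(x\<^sub>1)\<close> or a graph
  \<open>x\<^sub>1 = \<psi>(x\<^sub>2)\<close> with \<open>\<psi>'(0) = 0\<close>; a shear along this graph does just as well (\<open>reduce_to_shear\<close>).

  \<^bold>\<open>Dominant roots.\<close> Let \<open>\<psi> = \<beta> x\<^sub>1\<^sup>s + \<dots>\<close> and let \<open>P\<close> be the part of \<open>F\<close> of lowest weight for
  \<open>(1, s)\<close>. The shear turns \<open>P\<close> into \<open>P(x\<^sub>1, x\<^sub>2 + \<beta> x\<^sub>1\<^sup>s)\<close>, whose lowest power of \<open>x\<^sub>2\<close> is the
  multiplicity \<open>n\<close> of the root \<open>\<beta>\<close> of \<open>P(1, z)\<close>. This single monomial bounds every weighted order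
  of the sheared series by \<open>max(d, n) (u + v)\<close> (\<open>shear_weight_bound\<close>). Counting exponents on a
  line shows that \<open>n > d\<close> is possible only on the line of the principal edge (\<open>line_root_bound\<close>),
  and for one root at most (\<open>dominant_root_unique\<close>). Such a root is the only obstruction to
  adaptedness: without one the height is \<open>d\<close>, with one \<open>d < h \<le> n\<close>. It is a property of the
  principal part, whence \<open>F\<close> and \<open>F\<^sub>p\<close> are adapted simultaneously, and \<open>h(F\<^sub>p) = n\<close>
  (\<open>dominant_root_height\<close>). On the unit circle the multiplicities of the roots are the orders of
  vanishing off the axes, while on the axes the order is below \<open>d\<close> (\<open>circle_order_criterion\<close>).

  \<^bold>\<open>Adapted coordinates.\<close> Shearing a dominant root away strictly raises the distance, and the next
  dominant root lies on a line of strictly larger slope ratio \<open>s\<close> (\<open>steep_shear_step\<close>). If the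
  process stops, the terms removed form a polynomial of small degree. If not, they form a power
  series, and the monomials that survive all shears have \<open>x\<^sub>2\<close>-exponent at least the smallest
  multiplicity \<open>n\<close> met on the way; so the distance becomes \<open>n\<close>, which bounds the height from above
  (\<open>infinite_chain\<close>). Borel's lemma (\<open>borel_tower\<close>) realises the power series by a smooth
  function.

  \<^bold>\<open>Calculus.\<close> The Taylor series of a composition is the formal composition of the Taylor series,
  because both obey the chain rule and a series is determined by its constant term and its partial
  derivatives (\<open>taylor_compose\<close>).
\<close>

unbundle no vec_syntax

section \<open>Formal power series in two variables\<close>

text \<open>A lower bound for the order of \<open>F\<close> with respect to the weights \<open>(u, v)\<close>; as a predicate it needs
  no value for the zero series.\<close>

definition weight_ge :: "real \<Rightarrow> real \<Rightarrow> real \<Rightarrow> real fps fps \<Rightarrow> bool" where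
  "weight_ge u v c F \<longleftrightarrow> (\<forall>j k. F $ j $ k \<noteq> 0 \<longrightarrow> c \<le> u * real j + v * real k)"

lemma weight_geI: "(\<And>j k. F $ j $ k \<noteq> 0 \<Longrightarrow> c \<le> u * real j + v * real k) \<Longrightarrow> weight_ge u v c F"
  by (simp add: weight_ge_def)

lemma weight_geD: "weight_ge u v c F \<Longrightarrow> F $ j $ k \<noteq> 0 \<Longrightarrow> c \<le> u * real j + v * real k"
  by (simp add: weight_ge_def)

lemma fps2_eqI: "(\<And>j k. F $ j $ k = G $ j $ k) \<Longrightarrow> F = (G :: 'a::zero fps fps)"
  by (simp add: fps_eq_iff)

lemma fps2_mult_nth:
  "((A :: real fps fps) * B) $ j $ k = (\<Sum>i=0..j. \<Sum>l=0..k. A $ i $ l * B $ (j - i) $ (k - l))"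
  by (simp add: fps_mult_nth fps_sum_nth)

lemma weight_ge_mult:
  assumes "weight_ge u v c A" "weight_ge u v c' B"
  shows "weight_ge u v (c + c') (A * B)"
proof (rule weight_geI)
  fix j k assume "(A * B) $ j $ k \<noteq> 0"
  then obtain i where i: "i \<in> {0..j}" "(\<Sum>l=0..k. A $ i $ l * B $ (j - i) $ (k - l)) \<noteq> 0"
    unfolding fps2_mult_nth by (meson sum.neutral)
  then obtain l where l: "l \<in> {0..k}" "A $ i $ l * B $ (j - i) $ (k - l) \<noteq> 0"
    by (meson sum.neutral)
  have "c \<le> u * real i + v * real l" "c' \<le> u * real (j - i) + v * real (k - l)"
    using l assms unfolding weight_ge_def by (metis mult_eq_0_iff)+
  then show "c + c' \<le> u * real j + v * real k"
    using i(1) l(1) by (auto simp: of_nat_diff algebra_simps)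
qed

lemma weight_ge_one: "weight_ge u v 0 1"
  by (auto simp: weight_ge_def fps_one_nth)

lemma weight_ge_power: "weight_ge u v c A \<Longrightarrow> weight_ge u v (real n * c) (A ^ n)"
proof (induction n)
  case (Suc n)
  then have "weight_ge u v (c + real n * c) (A * A ^ n)" by (intro weight_ge_mult) auto
  then show ?case by (simp add: algebra_simps)
qed (simp add: weight_ge_one)

lemma weight_ge_nonneg: "0 \<le> u \<Longrightarrow> 0 \<le> v \<Longrightarrow> weight_ge u v 0 A"
  by (simp add: weight_ge_def)

lemma weight_ge_add: "weight_ge u v c A \<Longrightarrow> weight_ge u v c B \<Longrightarrow> weight_ge u v c (A + B)"
  unfolding weight_ge_def by (metis add_0 fps_add_nth)

subsection \<open>Agreement up to a total degree\<close>

definition agree :: "nat \<Rightarrow> real fps fps \<Rightarrow> real fps fps \<Rightarrow> bool" where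
  "agree N A B \<longleftrightarrow> (\<forall>j k. j + k \<le> N \<longrightarrow> A $ j $ k = B $ j $ k)"

text \<open>Agreement is a lower bound for the order of a difference, so it inherits its rules from weighted
  orders.\<close>

lemma agree_iff: "agree N A B \<longleftrightarrow> weight_ge 1 1 (real N + 1) (A - B)"
proof -
  have "(real N + 1 \<le> 1 * real j + 1 * real k) = (\<not> j + k \<le> N)" for j k by linarith
  then show ?thesis unfolding agree_def weight_ge_def by (auto simp del: mult_1)
qed

lemma agree_refl: "agree N A A" by (simp add: agree_def)
lemma agree_sym: "agree N A B \<Longrightarrow> agree N B A" by (simp add: agree_def)
lemma agree_trans: "agree N A B \<Longrightarrow> agree N B C \<Longrightarrow> agree N A C" by (simp add: agree_def)
lemma agree_add: "agree N A B \<Longrightarrow> agree N C D \<Longrightarrow> agree N (A + C) (B + D)" by (simp add: agree_def)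

lemma agree_mult:
  assumes "agree N A B" "agree N C D"
  shows "agree N (A * C) (B * D)"
proof -
  have "weight_ge 1 1 (real N + 1 + 0) ((A - B) * C)" "weight_ge 1 1 (0 + (real N + 1)) (B * (C -
      D))"
    using assms unfolding agree_iff by (intro weight_ge_mult weight_ge_nonneg; simp)+
  then have "weight_ge 1 1 (real N + 1) ((A - B) * C + B * (C - D))" by (intro weight_ge_add) auto
  then show ?thesis by (simp add: agree_iff algebra_simps)
qed

lemma agree_all: "(\<And>N. agree N A B) \<Longrightarrow> A = B"
  by (intro fps2_eqI) (auto simp: agree_def)

subsection \<open>Partial derivatives\<close>

text \<open>Differentiation of the inner series; the outer one is differentiated by the library's
  derivative.\<close>

definition D2 :: "real fps fps \<Rightarrow> real fps fps" where
  "D2 A = Abs_fps (\<lambda>j. fps_deriv (A $ j))"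

abbreviation D1 :: "real fps fps \<Rightarrow> real fps fps" where
  "D1 \<equiv> fps_deriv"

lemma fps_of_nat_mult_nth: "((of_nat n :: real fps) * f) $ k = of_nat n * f $ k"
  by (simp flip: fps_of_nat)

lemma D1_nth: "D1 A $ j $ k = real (Suc j) * A $ Suc j $ k"
  using fps_of_nat_mult_nth[of "Suc j" "A $ Suc j" k] by (simp del: of_nat_Suc)

lemma D2_nth: "D2 A $ j $ k = real (Suc k) * A $ j $ Suc k"
  by (simp add: D2_def)

text \<open>The induction step behind all identities between compositions below: they are stable under
  differentiation.\<close>

lemma agree_SucI:
  assumes "A $ 0 $ 0 = B $ 0 $ 0" "agree N (D1 A) (D1 B)" "agree N (D2 A) (D2 B)"
  shows "agree (Suc N) A B"
  unfolding agree_def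
proof (intro allI impI)
  fix j k assume jk: "j + k \<le> Suc N"
  show "A $ j $ k = B $ j $ k"
  proof (cases j)
    case 0
    show ?thesis
    proof (cases k)
      case (Suc k')
      then have "D2 A $ j $ k' = D2 B $ j $ k'" using assms(3) jk by (auto simp: agree_def)
      then show ?thesis using Suc by (simp add: D2_nth del: of_nat_Suc)
    qed (use 0 assms in auto)
  next
    case (Suc j')
    then have "D1 A $ j' $ k = D1 B $ j' $ k" using assms(2) jk by (auto simp: agree_def)
    then show ?thesis using Suc by (simp only: D1_nth) simp
  qed
qed

lemma agree_D1: "agree (Suc N) A B \<Longrightarrow> agree N (D1 A) (D1 B)"
  unfolding agree_def D1_nth by auto

lemma agree_D2: "agree (Suc N) A B \<Longrightarrow> agree N (D2 A) (D2 B)"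
  unfolding agree_def D2_nth by auto

definition const2 :: "real \<Rightarrow> real fps fps" where
  "const2 c = fps_const (fps_const c)"

lemma const2_mult_nth: "(const2 c * A) $ j $ k = c * A $ j $ k"
  by (simp add: const2_def)

text \<open>What \<open>D1\<close> and \<open>D2\<close> have in common; the last clause makes a derivation usable on truncations, at
  the price of one degree.\<close>

definition derivation :: "(real fps fps \<Rightarrow> real fps fps) \<Rightarrow> bool" where
  "derivation d \<longleftrightarrow> (\<forall>A B. d (A + B) = d A + d B) \<and> (\<forall>A B. d (A * B) = A * d B + d A * B) \<and>
     (\<forall>c. d (const2 c) = 0) \<and> (\<forall>N A B. agree (Suc N) A B \<longrightarrow> agree N (d A) (d B))"

lemma D2_mult: "D2 (A * B) = A * D2 B + D2 A * B"
proof (rule fps_ext)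
  fix j
  show "D2 (A * B) $ j = (A * D2 B + D2 A * B) $ j"
    by (simp add: D2_def fps_mult_nth sum.distrib fps_deriv_sum)
qed

lemma derivation_D1: "derivation D1"
  by (auto simp: derivation_def agree_D1 const2_def)

lemma derivation_D2: "derivation D2"
  unfolding derivation_def using agree_D2 D2_mult
  by (auto simp: D2_def const2_def fps_eq_iff)

lemma derivation_sum: "derivation d \<Longrightarrow> d (sum A I) = (\<Sum>i\<in>I. d (A i))"
proof -
  assume d: "derivation d"
  have "d (const2 0) = 0" using d by (simp add: derivation_def)
  then have "d 0 = 0" by (simp add: const2_def)
  then show ?thesis using d by (induction I rule: infinite_finite_induct) (auto simp:
      derivation_def)
qed

lemma derivation_power:
  assumes d: "derivation d"
  shows "d (A ^ n) = const2 (real n) * A ^ (n - 1) * d A"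
proof (induction n)
  case 0
  have "d (const2 1) = 0" using d by (simp add: derivation_def)
  then show ?case by (simp add: const2_def)
next
  case (Suc n)
  have c: "const2 (real (Suc n)) = const2 (real n) + 1"
    by (auto simp: const2_def fps_eq_iff)
  have "d (A ^ Suc n) = A * d (A ^ n) + d A * A ^ n" using d by (simp add: derivation_def)
  also have "\<dots> = const2 (real n) * (A * A ^ (n - 1)) * d A + d A * A ^ n"
    by (simp add: Suc algebra_simps)
  also have "const2 (real n) * (A * A ^ (n - 1)) = const2 (real n) * A ^ n"
    by (cases n) (auto simp: const2_def)
  finally show ?case by (simp only: c diff_Suc_1) (simp add: algebra_simps)
qed

subsection \<open>Composition\<close>

text \<open>A truncated composition is a finite sum in the ring, to which derivations apply.\<close>

definition comp_poly :: "nat \<Rightarrow> nat \<Rightarrow> real fps fps \<Rightarrow> real fps fps \<Rightarrow> real fps fps \<Rightarrow> real fps fps"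
    where
  "comp_poly M N F A B = (\<Sum>a\<le>M. \<Sum>b\<le>N. const2 (F $ a $ b) * (A ^ a * B ^ b))"

lemma monomial_weight_ge:
  assumes "weight_ge u v p A" "weight_ge u v q B"
  shows "weight_ge u v (real a * p + real b * q) (A ^ a * B ^ b)"
  using assms by (intro weight_ge_mult weight_ge_power)

lemma monomial_low:
  fixes A B :: "real fps fps"
  assumes "A $ 0 $ 0 = 0" "B $ 0 $ 0 = 0" "j + k < a + b"
  shows "(A ^ a * B ^ b) $ j $ k = 0"
proof (rule ccontr)
  have w: "weight_ge 1 1 1 C" if "C $ 0 $ 0 = 0" for C
  proof (rule weight_geI)
    fix j k assume "C $ j $ k \<noteq> 0"
    then have "j + k \<ge> 1" using that by (metis add_is_0 less_one not_le)
    then show "1 \<le> 1 * real j + 1 * real k" by linarith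
  qed
  assume "(A ^ a * B ^ b) $ j $ k \<noteq> 0"
  with monomial_weight_ge[OF w[OF assms(1)] w[OF assms(2)], of a b] have "real a + real b
      \<le> real j + real k"
    by (auto simp: weight_ge_def)
  then show False using assms(3) by linarith
qed

lemma comp_agree:
  assumes "A $ 0 $ 0 = 0" "B $ 0 $ 0 = 0" "n \<le> M" "n \<le> N"
  shows "agree n (fps2_compose F A B) (comp_poly M N F A B)"
  unfolding agree_def
proof (intro allI impI)
  fix j k assume jk: "j + k \<le> n"
  have "comp_poly M N F A B $ j $ k = (\<Sum>a\<le>M. \<Sum>b\<le>N. F $ a $ b * (A ^ a * B ^ b) $ j $ k)"
    by (simp add: comp_poly_def fps_sum_nth const2_mult_nth)
  also have "\<dots> = (\<Sum>a\<le>M. \<Sum>b\<le>j+k. F $ a $ b * (A ^ a * B ^ b) $ j $ k)"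
    by (intro sum.cong sum.mono_neutral_right refl)
        (use jk assms monomial_low[OF assms(1,2)] in auto)
  also have "\<dots> = (\<Sum>a\<le>j+k. \<Sum>b\<le>j+k. F $ a $ b * (A ^ a * B ^ b) $ j $ k)"
    by (intro sum.mono_neutral_right sum.neutral ballI)
        (use jk assms monomial_low[OF assms(1,2)] in auto)
  finally show "fps2_compose F A B $ j $ k = comp_poly M N F A B $ j $ k"
    by (simp add: fps2_compose_def)
qed

lemma comp_add: "fps2_compose (F + G) A B = fps2_compose F A B + fps2_compose G A B"
  by (intro fps2_eqI) (simp add: fps2_compose_def sum.distrib algebra_simps)

lemma comp_0_0: "fps2_compose F A B $ 0 $ 0 = F $ 0 $ 0"
  by (simp add: fps2_compose_def)

text \<open>Up to a given order the composition is a polynomial in \<open>A\<close> and \<open>B\<close>, for which the chain rule is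
  Leibniz' rule on monomials. The truncation keeps one more degree because the derivation loses
  one.\<close>

lemma comp_chain:
  assumes d: "derivation d" and A: "A $ 0 $ 0 = 0" and B: "B $ 0 $ 0 = 0"
  shows "d (fps2_compose F A B) = fps2_compose (D1 F) A B * d A + fps2_compose (D2 F) A B * d B"
proof (rule agree_all)
  fix N
  let ?S = "\<Sum>a\<le>Suc N. \<Sum>b\<le>Suc N. const2 (F $ a $ b * real a) * (A ^ (a - 1) * B ^ b)"
  let ?T = "\<Sum>a\<le>Suc N. \<Sum>b\<le>Suc N. const2 (F $ a $ b * real b) * (A ^ a * B ^ (b - 1))"
  have dmon: "d (const2 c * (A ^ a * B ^ b)) = const2 (c * real a) * (A ^ (a - 1) * B ^ b) * d A
       + const2 (c * real b) * (A ^ a * B ^ (b - 1)) * d B" for c a b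
  proof -
    have m: "\<And>x y. const2 (x * y) = const2 x * const2 y" by (simp add: const2_def)
    have "d (const2 c * (A ^ a * B ^ b)) = const2 c * d (A ^ a * B ^ b)"
      using d by (simp add: derivation_def)
    also have "d (A ^ a * B ^ b) = A ^ a * d (B ^ b) + d (A ^ a) * B ^ b"
      using d by (simp add: derivation_def)
    finally show ?thesis by (simp add: derivation_power[OF d] m algebra_simps)
  qed
  have "agree N (d (fps2_compose F A B)) (d (comp_poly (Suc N) (Suc N) F A B))"
    using d comp_agree[OF A B, of "Suc N" "Suc N" "Suc N" F] by (auto simp: derivation_def)
  also have "d (comp_poly (Suc N) (Suc N) F A B) = ?S * d A + ?T * d B"
    unfolding comp_poly_def by (simp add: derivation_sum[OF d] dmon sum.distrib sum_distrib_right
        del: sum.atMost_Suc)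
  also have "?S = comp_poly N (Suc N) (D1 F) A B"
    unfolding comp_poly_def
    by (subst sum.atMost_Suc_shift) (simp add: D1_nth const2_def mult_ac del: sum.atMost_Suc
        of_nat_Suc fps_deriv_nth)
  also have "?T = comp_poly (Suc N) N (D2 F) A B"
    unfolding comp_poly_def
  proof (rule sum.cong[OF refl])
    fix a
    show "(\<Sum>b\<le>Suc N. const2 (F $ a $ b * real b) * (A ^ a * B ^ (b - 1))) =
        (\<Sum>b\<le>N. const2 (D2 F $ a $ b) * (A ^ a * B ^ b))"
      by (subst sum.atMost_Suc_shift)
        (simp add: D2_nth const2_def mult_ac del: sum.atMost_Suc of_nat_Suc)
  qed
  finally have 1: "agree N (d (fps2_compose F A B))
     (comp_poly N (Suc N) (D1 F) A B * d A + comp_poly (Suc N) N (D2 F) A B * d B)" .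
  show "agree N (d (fps2_compose F A B))
      (fps2_compose (D1 F) A B * d A + fps2_compose (D2 F) A B * d B)"
    by (rule agree_trans[OF 1]) (intro agree_add agree_mult agree_refl agree_sym[OF comp_agree[OF A
        B]]; simp)
qed

lemma mult_0_0: "((A :: real fps fps) * B) $ 0 $ 0 = A $ 0 $ 0 * B $ 0 $ 0"
  by (simp add: fps2_mult_nth)

text \<open>Both sides have the same derivatives up to lower order, so the induction on the order of
  agreement avoids all rearrangements of double sums.\<close>

lemma comp_mult:
  assumes A: "A $ 0 $ 0 = 0" and B: "B $ 0 $ 0 = 0"
  shows "fps2_compose (F * G) A B = fps2_compose F A B * fps2_compose G A B"
proof (rule agree_all)
  fix N
  show "agree N (fps2_compose (F * G) A B) (fps2_compose F A B * fps2_compose G A B)"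
  proof (induction N arbitrary: F G)
    case 0
    show ?case by (simp add: agree_def comp_0_0 mult_0_0)
  next
    case (Suc N)
    have step: "agree N (d (fps2_compose (F * G) A B)) (d (fps2_compose F A B * fps2_compose G A
        B))"
      if d: "derivation d" for d
    proof -
      let ?c = "\<lambda>F. fps2_compose F A B"
      have "d (?c (F * G)) = (?c (F * D1 G) + ?c (D1 F * G)) * d A + (?c (F * D2 G) + ?c (D2 F * G))
          * d B"
        by (simp add: comp_chain[OF d A B] D2_mult comp_add algebra_simps)
      moreover have "agree N \<dots> ((?c F * ?c (D1 G) + ?c (D1 F) * ?c G) * d A
            + (?c F * ?c (D2 G) + ?c (D2 F) * ?c G) * d B)"
        by (intro agree_add agree_mult agree_refl Suc)
      moreover have "\<dots> = d (?c F * ?c G)"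
      proof -
        have "d (?c F * ?c G) = ?c F * d (?c G) + d (?c F) * ?c G" using d
            by (simp add: derivation_def)
        then show ?thesis by (simp add: comp_chain[OF d A B] algebra_simps)
      qed
      ultimately show ?thesis by simp
    qed
    show ?case
      by (rule agree_SucI[OF _ step[OF derivation_D1] step[OF derivation_D2]])
         (simp add: comp_0_0 mult_0_0)
  qed
qed

text \<open>Again both sides obey the same chain rule; expanding the inner derivative uses that composition
  is multiplicative.\<close>

lemma comp_assoc:
  assumes A: "A $ 0 $ 0 = 0" and B: "B $ 0 $ 0 = 0" and C: "C $ 0 $ 0 = 0" and D: "D $ 0 $ 0 = 0"
  shows "fps2_compose (fps2_compose F A B) C D
      = fps2_compose F (fps2_compose A C D) (fps2_compose B C D)"
proof (rule agree_all)
  fix N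
  let ?A = "fps2_compose A C D" and ?B = "fps2_compose B C D"
  let ?o = "\<lambda>F. fps2_compose F C D"
  have A': "?A $ 0 $ 0 = 0" and B': "?B $ 0 $ 0 = 0" using A B by (simp_all add: comp_0_0)
  show "agree N (?o (fps2_compose F A B)) (fps2_compose F ?A ?B)"
  proof (induction N arbitrary: F)
    case 0
    show ?case by (simp add: agree_def comp_0_0)
  next
    case (Suc N)
    have step: "agree N (d (?o (fps2_compose F A B))) (d (fps2_compose F ?A ?B))"
        if d: "derivation d" for d
    proof -
      have "d (?o (fps2_compose F A B)) =
        (?o (fps2_compose (D1 F) A B) * ?o (D1 A) + ?o (fps2_compose (D2 F) A B) * ?o (D1 B)) * d C
            +
        (?o (fps2_compose (D1 F) A B) * ?o (D2 A) + ?o (fps2_compose (D2 F) A B) * ?o (D2 B)) * d D"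
        by (simp add: comp_chain[OF d C D] comp_chain[OF derivation_D1 A B] comp_chain[OF
            derivation_D2 A B]
             comp_add comp_mult[OF C D])
      moreover have "agree N \<dots> (
        (fps2_compose (D1 F) ?A ?B * ?o (D1 A) + fps2_compose (D2 F) ?A ?B * ?o (D1 B)) * d C +
        (fps2_compose (D1 F) ?A ?B * ?o (D2 A) + fps2_compose (D2 F) ?A ?B * ?o (D2 B)) * d D)"
        by (intro agree_add agree_mult agree_refl Suc)
      moreover have "\<dots> = d (fps2_compose F ?A ?B)"
        by (simp add: comp_chain[OF d A' B'] comp_chain[OF d C D] algebra_simps)
      ultimately show ?thesis by simp
    qed
    show ?case
      by (rule agree_SucI[OF _ step[OF derivation_D1] step[OF derivation_D2]]) (simp add: comp_0_0)
  qed
qed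

text \<open>The monomial \<open>A\<^sup>a B\<^sup>b\<close> has order at least \<open>u a + v b\<close>. So only the orders of the two coordinate
  functions matter.\<close>

lemma comp_weight_ge:
  assumes "weight_ge u v u A" "weight_ge u v v B" "weight_ge u v c F"
  shows "weight_ge u v c (fps2_compose F A B)"
proof (rule weight_geI)
  fix j k assume "fps2_compose F A B $ j $ k \<noteq> 0"
  then obtain a where "a \<in> {..j+k}" "(\<Sum>b\<le>j + k. F $ a $ b * (A ^ a * B ^ b) $ j $ k) \<noteq> 0"
    unfolding fps2_compose_def by (simp del: fps_mult_nth) (meson atMost_iff sum.neutral)
  then obtain b where ab: "F $ a $ b * (A ^ a * B ^ b) $ j $ k \<noteq> 0"
    by (meson sum.neutral)
  have "c \<le> u * real a + v * real b" using ab assms(3) by (auto simp: weight_ge_def)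
  also have "\<dots> \<le> u * real j + v * real k"
    using weight_geD[OF monomial_weight_ge[OF assms(1,2)], of a b j k] ab
        by (auto simp: mult.commute)
  finally show "c \<le> u * real j + v * real k" .
qed

subsection \<open>Generators, transposition and one-variable series\<close>

lemma sum_sum_delta:
  "(\<Sum>a\<le>M. \<Sum>b\<le>N. if a = i \<and> b = k then f a b else 0) =
    (if i \<le> M \<and> k \<le> (N :: nat) then f i k else (0 :: 'a::comm_monoid_add))" for i M :: nat
proof -
  have "(\<Sum>b\<le>N. if a = i \<and> b = k then f a b else 0) = (if a = i then if k
      \<le> N then f i k else 0 else 0)" for a
    by (cases "a = i") simp_all
  then show ?thesis by simp
qed

definition X1 :: "real fps fps" where "X1 = fps_X"
definition X2 :: "real fps fps" where "X2 = fps_const fps_X"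

lemma X1_nth: "X1 $ j $ k = (if j = 1 \<and> k = 0 then 1 else 0)"
  by (simp add: X1_def fps_X_def)

lemma X2_nth: "X2 $ j $ k = (if j = 0 \<and> k = 1 then 1 else 0)"
  by (simp add: X2_def fps_X_def)

lemma X1_power_mult_nth: "(X1 ^ a * A) $ j $ k = (if a \<le> j then A $ (j - a) $ k else 0)"
  by (simp add: X1_def fps_X_power_mult_nth)

lemma X2_power_mult_nth: "(X2 ^ b * A) $ j $ k = (if b \<le> k then A $ j $ (k - b) else 0)"
  by (simp add: X2_def fps_const_power fps_X_power_mult_nth)

text \<open>A series in \<open>x\<^sub>1\<close> as a series in two variables.\<close>

definition emb :: "real fps \<Rightarrow> real fps fps" where
  "emb g = Abs_fps (\<lambda>j. fps_const (g $ j))"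

lemma emb_nth: "emb g $ j $ k = (if k = 0 then g $ j else 0)"
  by (simp add: emb_def)

lemma emb_mult: "emb (g * h) = emb g * emb h"
  by (rule fps_ext) (simp add: emb_def fps_mult_nth fps_eq_iff fps_sum_nth)

lemma emb_1: "emb 1 = 1"
  by (intro fps2_eqI) (auto simp: emb_nth fps_one_nth)

lemma emb_add: "emb (g + h) = emb g + emb h"
  by (intro fps2_eqI) (auto simp: emb_nth)

lemma emb_power: "emb (g ^ n) = emb g ^ n"
  by (induction n) (simp_all add: emb_1 emb_mult)

lemma emb_X: "emb fps_X = X1"
  by (intro fps2_eqI) (auto simp: emb_nth X1_nth fps_X_def)

text \<open>The series \<open>F(x\<^sub>2, x\<^sub>1)\<close>.\<close>

definition swap_vars :: "real fps fps \<Rightarrow> real fps fps" where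
  "swap_vars A = Abs_fps (\<lambda>j. Abs_fps (\<lambda>k. A $ k $ j))"

lemma swap_vars_nth: "swap_vars A $ j $ k = A $ k $ j"
  by (simp add: swap_vars_def)

lemma swap_vars_swap_vars: "swap_vars (swap_vars A) = A"
  by (intro fps2_eqI) (simp add: swap_vars_nth)

lemma swap_vars_mult: "swap_vars (A * B) = swap_vars A * swap_vars B"
proof (intro fps2_eqI)
  fix j k
  show "swap_vars (A * B) $ j $ k = (swap_vars A * swap_vars B) $ j $ k"
    unfolding swap_vars_nth fps2_mult_nth by (subst sum.swap) simp
qed

lemma swap_vars_power: "swap_vars (A ^ n) = swap_vars A ^ n"
proof (induction n)
  case 0
  show ?case by (intro fps2_eqI) (auto simp: swap_vars_nth fps_one_nth)
qed (simp add: swap_vars_mult)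

lemma swap_vars_weight_ge: "weight_ge u v c (swap_vars F) \<longleftrightarrow> weight_ge v u c F"
  by (auto simp: weight_ge_def swap_vars_nth add.commute)

lemma comp_swap_vars_arg: "fps2_compose (swap_vars F) B A = fps2_compose F A B"
  unfolding fps2_compose_def swap_vars_nth
  by (intro fps2_eqI, simp, subst sum.swap) (simp add: mult.commute)

lemma comp_swap_vars: "fps2_compose F (swap_vars A) (swap_vars B) = swap_vars (fps2_compose F A B)"
proof (intro fps2_eqI)
  fix j k
  have "(swap_vars A ^ a * swap_vars B ^ b) $ j $ k = (A ^ a * B ^ b) $ k $ j" for a b
    by (metis swap_vars_mult swap_vars_power swap_vars_nth)
  then show "fps2_compose F (swap_vars A) (swap_vars B) $ j $ k
      = swap_vars (fps2_compose F A B) $ j $ k"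
    by (simp add: fps2_compose_def swap_vars_nth add.commute)
qed

lemma comp_X1: "A $ 0 $ 0 = 0 \<Longrightarrow> B $ 0 $ 0 = 0 \<Longrightarrow> fps2_compose X1 A B = A"
proof (rule agree_all)
  fix N assume A: "A $ 0 $ 0 = 0" "B $ 0 $ 0 = 0"
  have "comp_poly (Suc N) (Suc N) X1 A B = (\<Sum>a\<le>Suc N. \<Sum>b\<le>Suc N. if a = 1 \<and> b = 0 then A else 0)"
    unfolding comp_poly_def by (intro sum.cong refl) (simp add: X1_nth const2_def)
  also have "\<dots> = A" by (simp only: sum_sum_delta) simp
  finally show "agree N (fps2_compose X1 A B) A" using comp_agree[OF A, of N "Suc N" "Suc N" X1]
      by simp
qed

lemma swap_vars_X2: "swap_vars X2 = X1"
  by (intro fps2_eqI) (auto simp: swap_vars_nth X1_nth X2_nth)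

lemma comp_X2: "A $ 0 $ 0 = 0 \<Longrightarrow> B $ 0 $ 0 = 0 \<Longrightarrow> fps2_compose X2 A B = B"
  by (metis comp_swap_vars_arg comp_X1 swap_vars_X2)

lemma comp_id: "fps2_compose F X1 X2 = F"
proof (intro fps2_eqI)
  fix j k
  have m: "(X1 ^ a * X2 ^ b) $ j $ k = (if a = j \<and> b = k then 1 else 0)" for a b
    using X2_power_mult_nth[of b 1 "j - a" k] by (auto simp: X1_power_mult_nth fps_one_nth)
  have "fps2_compose F X1 X2 $ j $ k = (\<Sum>a\<le>j+k. \<Sum>b\<le>j+k. F $ a $ b * (X1 ^ a * X2 ^ b) $ j $ k)"
    by (simp only: fps2_compose_def fps_nth_Abs_fps)
  also have "\<dots> = (\<Sum>a\<le>j+k. \<Sum>b\<le>j+k. if a = j \<and> b = k then F $ a $ b else 0)"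
    by (intro sum.cong refl) (simp add: m)
  also have "\<dots> = F $ j $ k" by (simp only: sum_sum_delta) simp
  finally show "fps2_compose F X1 X2 $ j $ k = F $ j $ k" .
qed

text \<open>Only the monomials without \<open>x\<^sub>2\<close> survive on the axis; this makes the one-variable inverse of a
  series available below.\<close>

lemma comp_emb_0:
  assumes "k $ 0 = 0"
  shows "fps2_compose P (emb k) 0 = emb (Abs_fps (\<lambda>j. P $ j $ 0) oo k)"
proof (intro fps2_eqI)
  fix j l
  have "fps2_compose P (emb k) 0 $ j $ l = (\<Sum>a\<le>j+l. \<Sum>b\<le>j+l. P $ a $ b * (emb k ^ a * 0 ^ b) $ j $
      l)"
    by (simp only: fps2_compose_def fps_nth_Abs_fps)
  also have "\<dots> = (\<Sum>a\<le>j+l. \<Sum>b\<le>j+l. if b = 0 then P $ a $ 0 * emb (k ^ a) $ j $ l else 0)"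
    by (intro sum.cong refl) (auto simp: emb_power power_0_left)
  also have "\<dots> = (\<Sum>a\<le>j+l. P $ a $ 0 * emb (k ^ a) $ j $ l)" by simp
  also have "\<dots> = emb (Abs_fps (\<lambda>j. P $ j $ 0) oo k) $ j $ l"
  proof (cases "l = 0")
    case True then show ?thesis by (simp add: emb_nth fps_compose_nth atMost_atLeast0)
  qed (simp add: emb_nth)
  finally show "fps2_compose P (emb k) 0 $ j $ l = emb (Abs_fps (\<lambda>j. P $ j $ 0) oo k) $ j $ l" .
qed

lemma comp_emb_X1: "B $ 0 $ 0 = 0 \<Longrightarrow> fps2_compose (emb g) X1 B = emb g"
proof (intro fps2_eqI)
  fix j l assume "B $ 0 $ 0 = 0"
  have "fps2_compose (emb g) X1 B $ j $ l = (\<Sum>a\<le>j+l. \<Sum>b\<le>j+l. emb g $ a $ b * (X1 ^ a * B ^ b) $ j $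
      l)"
    by (simp only: fps2_compose_def fps_nth_Abs_fps)
  also have "\<dots> = (\<Sum>a\<le>j+l. \<Sum>b\<le>j+l. if a = j \<and> b = 0 then (if l = 0 then g $ a else 0) else 0)"
    by (intro sum.cong refl) (auto simp: emb_nth X1_power_mult_nth fps_one_nth)
  also have "\<dots> = emb g $ j $ l" by (simp only: sum_sum_delta emb_nth) simp
  finally show "fps2_compose (emb g) X1 B $ j $ l = emb g $ j $ l" .
qed

subsection \<open>Shears\<close>

text \<open>The series \<open>F(x\<^sub>1, x\<^sub>2 + g(x\<^sub>1))\<close>.\<close>

definition fshear :: "real fps fps \<Rightarrow> real fps \<Rightarrow> real fps fps" where
  "fshear F g = fps2_compose F X1 (X2 + emb g)"

lemma shear_0_0: "g $ 0 = 0 \<Longrightarrow> (X2 + emb g) $ 0 $ 0 = 0"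
  by (simp add: X2_nth emb_nth)

lemma X1_0_0: "X1 $ 0 $ 0 = 0"
  by (simp add: X1_nth)

lemma fshear_fshear:
  assumes "g $ 0 = 0" "h $ 0 = 0"
  shows "fshear (fshear F g) h = fshear F (g + h)"
  unfolding fshear_def
  using assms by (subst comp_assoc)
    (simp_all only: X1_0_0 shear_0_0 comp_X1 comp_add comp_X2 comp_emb_X1 emb_add add_ac)

lemma fshear_0: "fshear F 0 = F"
proof -
  have "emb 0 = 0" by (intro fps2_eqI) (simp add: emb_nth)
  then show ?thesis by (simp add: fshear_def comp_id)
qed

lemma fshear_inverse: "g $ 0 = 0 \<Longrightarrow> fshear (fshear F g) (- g) = F"
  by (simp add: fshear_fshear fshear_0)

lemma fshear_eq_0: "g $ 0 = 0 \<Longrightarrow> fshear F g = 0 \<Longrightarrow> F = 0"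
  by (metis fshear_inverse fshear_def comp_add add_cancel_right_left add_0)

lemma weight_ge_fshear:
  assumes "0 \<le> u" "\<And>i. g $ i \<noteq> 0 \<Longrightarrow> v \<le> u * real i" "weight_ge u v c F"
  shows "weight_ge u v c (fshear F g)"
  unfolding fshear_def
proof (rule comp_weight_ge)
  show "weight_ge u v u X1" by (auto simp: weight_ge_def X1_nth)
  have "weight_ge u v v X2" "weight_ge u v v (emb g)" using assms
      by (auto simp: weight_ge_def X2_nth emb_nth)
  then show "weight_ge u v v (X2 + emb g)" by (rule weight_ge_add)
qed (fact assms)

lemma fshear_nth:
  "fshear F g $ j $ k =
    (\<Sum>a\<le>j + k. \<Sum>b\<le>j + k. if a \<le> j \<and> k \<le> b then F $ a $ b * real (b choose k) * (g ^ (b - k)) $ (j -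
        a) else 0)"
proof -
  have "(X1 ^ a * (X2 + emb g) ^ b) $ j $ k = (if a \<le> j \<and> k
      \<le> b then real (b choose k) * (g ^ (b - k)) $ (j - a) else 0)" for a b
  proof -
    have "(X2 + emb g) ^ b $ j' $ k = (\<Sum>i\<le>b. if i
        = k then real (b choose k) * (g ^ (b - k)) $ j' else 0)" for j'
    proof -
      have "(X2 + emb g) ^ b $ j' $ k = (\<Sum>i\<le>b. (of_nat (b choose i) * (X2 ^ i * emb (g ^ (b - i))))
          $ j' $ k)"
        by (simp add: binomial_ring fps_sum_nth emb_power mult_ac)
      also have "\<dots> = (\<Sum>i\<le>b. real (b choose i) * (X2 ^ i * emb (g ^ (b - i))) $ j' $ k)"
        by (simp flip: fps_of_nat)
      also have "\<dots> = (\<Sum>i\<le>b. if i = k then real (b choose k) * (g ^ (b - k)) $ j' else 0)"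
        by (intro sum.cong refl) (auto simp: X2_power_mult_nth emb_nth)
      finally show ?thesis .
    qed
    then show ?thesis by (auto simp: X1_power_mult_nth)
  qed
  then show ?thesis
    unfolding fshear_def fps2_compose_def fps_nth_Abs_fps by (intro sum.cong refl) simp
qed

section \<open>The Newton polyhedron\<close>

abbreviation np :: "real fps fps \<Rightarrow> (real \<times> real) set" where "np \<equiv> newton_polyhedron"

definition rpt :: "nat \<times> nat \<Rightarrow> real \<times> real" where "rpt = (\<lambda>(j, k). (real j, real k))"

definition quadrant :: "(real \<times> real) set" where "quadrant = {(a, b). 0 \<le> a \<and> 0 \<le> b}"

lemma quadrant_iff [simp]: "(a, b) \<in> quadrant \<longleftrightarrow> 0 \<le> a \<and> 0 \<le> b"
  by (simp add: quadrant_def)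

lemma support_iff: "(j, k) \<in> taylor_support F \<longleftrightarrow> F $ j $ k \<noteq> 0"
  by (simp add: taylor_support_def)

lemma support_empty_iff: "taylor_support F = {} \<longleftrightarrow> F = 0"
  by (auto simp: taylor_support_def fps_eq_iff)

lemma convex_np: "convex (np F)"
  by (simp add: newton_polyhedron_def convex_convex_hull)

lemma support_in_np: "F $ j $ k \<noteq> 0 \<Longrightarrow> (real j, real k) \<in> np F"
  unfolding newton_polyhedron_def by (rule hull_inc) (auto simp: support_iff)

lemma np_up:
  assumes "p \<in> np F" "q \<in> quadrant"
  shows "p + q \<in> np F"
proof -
  let ?U = "\<Union>(j, k)\<in>taylor_support F. {(t1, t2). real j \<le> t1 \<and> real k \<le> t2}"
  have "(+) q ` ?U \<subseteq> ?U"
  proof (rule image_subsetI)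
    fix x assume "x \<in> ?U"
    then obtain j k where "(j, k) \<in> taylor_support F" "real j \<le> fst x" "real k \<le> snd x" by auto
    then show "q + x \<in> ?U" using assms(2) by (intro UN_I[of "(j, k)"]) (cases x; cases q; auto)+
  qed
  then have "(+) q ` (convex hull ?U) \<subseteq> convex hull ?U"
    unfolding convex_hull_translation[symmetric] by (rule hull_mono)
  then have "q + p \<in> np F" using assms(1) unfolding newton_polyhedron_def by blast
  then show ?thesis by (simp add: add.commute)
qed

lemma convex_halfplane: "convex {(a :: real, b :: real). c \<le> u * a + v * b}"
proof -
  have "{(a :: real, b :: real). c \<le> u * a + v * b} = {x. inner (u, v) x \<ge> c}"
      by (auto simp: inner_prod_def)
  then show ?thesis by (simp add: convex_halfspace_ge)
qed

lemma np_weight_ge: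
  assumes "weight_ge u v c F" "0 \<le> u" "0 \<le> v" "(a, b) \<in> np F"
  shows "c \<le> u * a + v * b"
proof -
  have "np F \<subseteq> {(a, b). c \<le> u * a + v * b}"
    unfolding newton_polyhedron_def
  proof (rule hull_minimal, clarify)
    show "convex {(a, b). c \<le> u * a + v * b}" by (rule convex_halfplane)
  next
    fix j k a b assume "(j, k) \<in> taylor_support F" and ab: "real j \<le> a" "real k \<le> b"
    then have "c \<le> u * real j + v * real k" using assms(1) by (auto simp: weight_ge_def support_iff)
    also have "\<dots> \<le> u * a + v * b" using ab assms by (intro add_mono mult_left_mono) auto
    finally show "c \<le> u * a + v * b" .
  qed
  then show ?thesis using assms(4) by auto
qed

text \<open>Dickson's lemma for pairs: besides one point of \<open>S\<close>, only the lowest points of finitely many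
  rows and columns are needed.\<close>

lemma dominating_finite:
  fixes S :: "(nat \<times> nat) set"
  shows "\<exists>S0 \<subseteq> S. finite S0 \<and> (\<forall>p\<in>S. \<exists>q\<in>S0. fst q \<le> fst p \<and> snd q \<le> snd p)"
proof (cases "S = {}")
  case False
  then obtain j0 k0 where p0: "(j0, k0) \<in> S" by auto
  define A where "A = (\<lambda>j. (j, LEAST k. (j, k) \<in> S)) ` {j. j \<le> j0 \<and> (\<exists>k. (j, k) \<in> S)}"
  define B where "B = (\<lambda>k. (LEAST j. (j, k) \<in> S, k)) ` {k. k \<le> k0 \<and> (\<exists>j. (j, k) \<in> S)}"
  have "A \<subseteq> S" unfolding A_def by (clarify, rule LeastI)
  moreover have "B \<subseteq> S" unfolding B_def by (clarify, rule LeastI)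
  moreover have "finite A" "finite B" unfolding A_def B_def by simp_all
  moreover have dom: "\<exists>q\<in>insert (j0, k0) (A \<union> B). fst q \<le> fst p \<and> snd q \<le> snd p" if p: "p \<in> S" for p
  proof -
    obtain j k where [simp]: "p = (j, k)" and jk: "(j, k) \<in> S" using p by (cases p) auto
    consider "j0 \<le> j \<and> k0 \<le> k" | "j \<le> j0" | "k \<le> k0" by linarith
    then show ?thesis
    proof cases
      case 2
      then have "(j, LEAST k. (j, k) \<in> S) \<in> A" using jk by (auto simp: A_def)
      moreover have "(LEAST k. (j, k) \<in> S) \<le> k" using jk by (rule Least_le)
      ultimately show ?thesis by (intro bexI[of _ "(j, LEAST k. (j, k) \<in> S)"]) simp_all
    next
      case 3
      then have "(LEAST j. (j, k) \<in> S, k) \<in> B" using jk by (auto simp: B_def)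
      moreover have "(LEAST j. (j, k) \<in> S) \<le> j" using jk by (rule Least_le)
      ultimately show ?thesis by (intro bexI[of _ "(LEAST j. (j, k) \<in> S, k)"]) simp_all
    next
      case 1
      then show ?thesis by (intro bexI[of _ "(j0, k0)"]) simp_all
    qed
  qed
  ultimately have "insert (j0, k0) (A \<union> B) \<subseteq> S" "finite (insert (j0, k0) (A \<union> B))"
    using p0 by simp_all
  with dom show ?thesis by (intro exI[of _ "insert (j0, k0) (A \<union> B)"] conjI ballI) assumption+
qed simp

text \<open>By Dickson's lemma finitely many quadrants suffice, so the polyhedron is a polytope plus a
  quadrant. Closedness and the structure of the faces come from the polytope.\<close>

lemma np_decomposition:
  obtains S0 where "finite S0" "S0 \<subseteq> rpt ` taylor_support F"
    "np F = (\<Union>x\<in>convex hull S0. \<Union>y\<in>quadrant. {x + y})"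
proof -
  obtain S0 where S0: "S0 \<subseteq> taylor_support F" "finite S0"
    "\<And>p. p \<in> taylor_support F \<Longrightarrow> \<exists>q\<in>S0. fst q \<le> fst p \<and> snd q \<le> snd p"
    using dominating_finite[of "taylor_support F"] by metis
  let ?T = "\<Union>x\<in>convex hull (rpt ` S0). \<Union>y\<in>quadrant. {x + y}"
  have cq: "convex quadrant" by (auto simp: convex_def quadrant_def)
  have "np F \<subseteq> ?T"
    unfolding newton_polyhedron_def
  proof (rule hull_minimal, clarify)
    fix j k a b assume "(j, k) \<in> taylor_support F" and ab: "real j \<le> a" "real k \<le> b"
    then obtain j' k' where jk: "(j', k') \<in> S0" "j' \<le> j" "k' \<le> k" using S0(3) by fastforce
    then have "(real j', real k') \<in> convex hull (rpt ` S0)"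
        by (intro hull_inc) (force simp: rpt_def)
    moreover have "(a - real j', b - real k') \<in> quadrant" using ab jk by simp
    moreover have "(a, b) = (real j', real k') + (a - real j', b - real k')" by simp
    ultimately show "(a, b) \<in> ?T" by (metis UN_I singletonI)
  qed (rule convex_sums[OF convex_convex_hull cq])
  moreover have "?T \<subseteq> np F"
  proof -
    have "rpt ` S0 \<subseteq> np F" using S0(1) support_in_np by (fastforce simp: rpt_def support_iff)
    then have "convex hull (rpt ` S0) \<subseteq> np F" by (intro hull_minimal convex_np)
    show ?thesis
    proof
      fix p assume "p \<in> ?T"
      then obtain x y where "x \<in> convex hull (rpt ` S0)" "y \<in> quadrant" "p = x + y"
          by (meson UN_E singletonD)
      then show "p \<in> np F" using np_up[of x F y] \<open>convex hull (rpt ` S0) \<subseteq> np F\<close> by blast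
    qed
  qed
  ultimately have "np F = ?T" by (rule subset_antisym)
  then show ?thesis using S0(1,2) by (intro that[of "rpt ` S0"]) (simp_all add: image_mono)
qed

lemma closed_quadrant: "closed quadrant"
proof -
  have "quadrant = {x. 0 \<le> fst x} \<inter> {x. 0 \<le> snd x}" by (auto simp: quadrant_def)
  moreover have "closed {x :: real \<times> real. 0 \<le> fst x}" "closed {x :: real \<times> real. 0 \<le> snd x}"
    by (intro closed_Collect_le continuous_intros)+
  ultimately show ?thesis by (metis closed_Int)
qed

lemma closed_np: "closed (np F)"
proof -
  obtain S0 where "finite S0" and e: "np F = (\<Union>x\<in>convex hull S0. \<Union>y\<in>quadrant. {x + y})"
    by (rule np_decomposition)
  then have "compact (convex hull S0)" by (simp add: finite_imp_compact_convex_hull)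
  then show ?thesis unfolding e by (intro compact_closed_sums closed_quadrant)
qed

lemma np_ge_0: "(a, b) \<in> np F \<Longrightarrow> 0 \<le> a \<and> 0 \<le> b"
  using np_weight_ge[of 1 0 0 F a b] np_weight_ge[of 0 1 0 F a b] by (auto simp: weight_ge_def)

lemma np_strict_up_interior:
  assumes "(a, b) \<in> np F" "a < a'" "b < b'"
  shows "(a', b') \<in> interior (np F)"
proof -
  have "{a<..} \<times> {b<..} \<subseteq> np F"
  proof clarify
    fix x y assume "a < x" "b < y"
    then show "(x, y) \<in> np F" using np_up[OF assms(1), of "(x - a, y - b)"] by auto
  qed
  then have "{a<..} \<times> {b<..} \<subseteq> interior (np F)" by (intro interior_maximal open_Times) auto
  then show ?thesis using assms by auto
qed

subsection \<open>The distance\<close>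

text \<open>The polyhedron meets the bisectrix in a closed half line, beyond whose end point everything is
  interior; so the definite description is meaningful.\<close>

lemma newton_distance_props:
  assumes "F \<noteq> 0"
  shows "(t, t) \<in> np F \<longleftrightarrow> newton_distance F \<le> t"
    and "(newton_distance F, newton_distance F) \<in> frontier (np F)"
proof -
  let ?D = "{t. (t, t) \<in> np F}"
  obtain j k where jk: "F $ j $ k \<noteq> 0" using assms by (auto simp: fps_nonzero_nth)
  have "(real j, real k) + (real (max j k) - real j, real (max j k) - real k) \<in> np F"
    by (rule np_up[OF support_in_np[OF jk]]) simp
  then have "real (max j k) \<in> ?D" by (simp del: of_nat_max)
  then have ne: "?D \<noteq> {}" by blast
  have bdd: "bdd_below ?D" by (rule bdd_belowI[of _ 0]) (use np_ge_0[of _ _ F] in simp)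
  have cl: "closed ?D"
  proof -
    have "?D = (\<lambda>t. (t, t)) -` np F" by auto
    then show ?thesis by (simp only:) (intro closed_vimage closed_np continuous_intros)
  qed
  define d where "d = Inf ?D"
  have d: "(d, d) \<in> np F" using closed_contains_Inf[OF ne bdd cl] by (simp add: d_def)
  have iff: "(t, t) \<in> np F \<longleftrightarrow> d \<le> t" for t
  proof
    assume "d \<le> t"
    then show "(t, t) \<in> np F" using np_up[OF d, of "(t - d, t - d)"] by simp
  next
    assume "(t, t) \<in> np F"
    then show "d \<le> t" unfolding d_def by (intro cInf_lower bdd) simp
  qed
  have fr: "(t, t) \<in> frontier (np F) \<longleftrightarrow> t = d" for t
  proof
    assume t: "(t, t) \<in> frontier (np F)"
    then have "(t, t) \<in> np F" using frontier_subset_closed[OF closed_np] by blast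
    then have "d \<le> t" by (simp add: iff)
    moreover have "\<not> d < t" using t np_strict_up_interior[OF d, of t t] unfolding frontier_def
        by blast
    ultimately show "t = d" by simp
  next
    assume [simp]: "t = d"
    have "(d, d) \<notin> interior (np F)"
    proof
      assume "(d, d) \<in> interior (np F)"
      then obtain e where e: "e > 0" "ball (d, d) e \<subseteq> np F" by (meson mem_interior)
      have "dist (d, d) (d - e / 2, d - e / 2) < e"
      proof -
        have "dist (d, d) (d - e / 2, d - e / 2) = sqrt (e\<^sup>2 / 2)"
          using e by (simp add: dist_prod_def dist_real_def power2_eq_square field_simps)
        also have "\<dots> < sqrt (e\<^sup>2)" using e by (intro real_sqrt_less_mono) auto
        finally show ?thesis using e by simp
      qed
      then have "(d - e / 2, d - e / 2) \<in> np F" using e(2) by (simp add: subset_iff)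
      then show False using e(1) by (simp add: iff)
    qed
    then show "(t, t) \<in> frontier (np F)" using d closure_subset[of "np F"] unfolding frontier_def
        by auto
  qed
  have "newton_distance F = d" unfolding newton_distance_def
      by (rule the_equality) (simp_all add: fr)
  then show "(t, t) \<in> np F \<longleftrightarrow> newton_distance F \<le> t"
    and "(newton_distance F, newton_distance F) \<in> frontier (np F)"
    by (simp_all add: iff fr)
qed

lemma diagonal_in_np: "F \<noteq> 0 \<Longrightarrow> (newton_distance F, newton_distance F) \<in> np F"
  by (simp add: newton_distance_props(1))

lemma distance_ge_0: "F \<noteq> 0 \<Longrightarrow> 0 \<le> newton_distance F"
  using diagonal_in_np np_ge_0 by blast

text \<open>The point \<open>(d, d)\<close> satisfies every inequality with nonnegative weights that holds on the
  support.\<close>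

lemma weight_ge_le_distance:
  assumes "F \<noteq> 0" "0 \<le> u" "0 \<le> v" "weight_ge u v c F"
  shows "c \<le> (u + v) * newton_distance F"
  using np_weight_ge[OF assms(4,2,3) diagonal_in_np[OF assms(1)]] by (simp add: algebra_simps)

lemma distance_geI:
  assumes "F \<noteq> 0" "0 \<le> u" "0 \<le> v" "0 < u + v" "weight_ge u v (t * (u + v)) F"
  shows "t \<le> newton_distance F"
  using weight_ge_le_distance[OF assms(1,2,3,5)] assms(4) by (simp add: mult.commute)

lemma distance_leI:
  assumes "F $ j $ k \<noteq> 0" "real j \<le> t" "real k \<le> t"
  shows "newton_distance F \<le> t"
proof -
  have "F \<noteq> 0" using assms(1) by auto
  moreover have "(t, t) \<in> np F" using np_up[OF support_in_np[OF assms(1)], of "(t - j, t - k)"]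
      assms by auto
  ultimately show ?thesis by (simp add: newton_distance_props)
qed

text \<open>A supporting line at \<open>(d, d)\<close>; its weights are nonnegative because the polyhedron is upward
  closed.\<close>

lemma supporting_weights:
  assumes "F \<noteq> 0"
  obtains u v where "0 \<le> u" "0 \<le> v" "u + v = 1" "weight_ge u v (newton_distance F) F"
proof -
  define d where "d = newton_distance F"
  have fr: "(d, d) \<in> frontier (np F)" using newton_distance_props(2)[OF assms] by (simp add: d_def)
  have dn: "(d, d) \<in> np F" using diagonal_in_np[OF assms] by (simp add: d_def)
  have "(d + 1, d + 1) \<in> interior (np F)" by (rule np_strict_up_interior[OF dn]) simp_all
  then have int: "interior (np F) \<noteq> {}" by blast
  have "(d, d) \<notin> rel_interior (np F)" using fr
      by (simp add: rel_interior_nonempty_interior[OF int] frontier_def)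
  with supporting_hyperplane_rel_boundary[OF convex_np dn]
  obtain w where w: "w \<noteq> 0" "\<And>y. y \<in> np F \<Longrightarrow> inner w (d, d) \<le> inner w y" by metis
  obtain a b where ab: "w = (a, b)" by (cases w)
  have "(d + 1, d) \<in> np F" "(d, d + 1) \<in> np F"
      using np_up[OF dn, of "(1, 0)"] np_up[OF dn, of "(0, 1)"] by simp_all
  from w(2)[OF this(1)] w(2)[OF this(2)] have pos: "0 \<le> a" "0 \<le> b"
    by (simp_all add: ab inner_prod_def algebra_simps)
  have "a \<noteq> 0 \<or> b \<noteq> 0" using w(1) ab by (simp add: zero_prod_def)
  with pos have s: "0 < a + b" by linarith
  show ?thesis
  proof (rule that[of "a / (a + b)" "b / (a + b)"])
    show "weight_ge (a / (a + b)) (b / (a + b)) (newton_distance F) F"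
    proof (rule weight_geI)
      fix j k assume "F $ j $ k \<noteq> 0"
      then have "inner w (d, d) \<le> inner w (real j, real k)" by (intro w support_in_np)
      then have "d * (a + b) \<le> a * real j + b * real k"
          by (simp add: ab inner_prod_def algebra_simps)
      then have "d \<le> (a * real j + b * real k) / (a + b)" using s by (simp add: pos_le_divide_eq)
      then show "newton_distance F \<le> a / (a + b) * real j + b / (a + b) * real k"
        by (simp add: d_def add_divide_distrib)
    qed
  qed (use pos s in \<open>simp_all flip: add_divide_distrib\<close>)
qed

subsection \<open>The principal face\<close>

text \<open>Both summands of a point on a supporting line lie on their own supporting lines, and the
  corresponding face of the polytope is spanned by points of the support.\<close>

lemma supporting_face_hull:
  assumes w: "0 \<le> u" "0 \<le> v" "weight_ge u v c F" and p: "p \<in> np F" "u * fst p + v * snd p = c"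
  obtains x y where "p = x + y" "y \<in> quadrant" "u * fst y + v * snd y = 0"
    "x \<in> convex hull (rpt ` {(j, k). F $ j $ k \<noteq> 0 \<and> u * real j + v * real k = c})"
proof -
  obtain S0 where S0: "finite S0" "S0 \<subseteq> rpt ` taylor_support F"
    and e: "np F = (\<Union>x\<in>convex hull S0. \<Union>y\<in>quadrant. {x + y})" by (rule np_decomposition)
  obtain x y where xy: "x \<in> convex hull S0" "y \<in> quadrant" "p = x + y"
    using p(1) unfolding e by (meson UN_E singletonD)
  have hull: "convex hull S0 \<subseteq> np F"
  proof
    fix z assume "z \<in> convex hull S0"
    moreover have "z = z + 0" "(0 :: real \<times> real) \<in> quadrant"
        by (simp_all add: quadrant_def zero_prod_def)
    ultimately show "z \<in> np F" unfolding e by (metis UN_I singletonI)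
  qed
  have ge: "c \<le> u * fst z + v * snd z" if "z \<in> np F" for z
    using np_weight_ge[OF w(3,1,2), of "fst z" "snd z"] that by simp
  have "0 \<le> u * fst y + v * snd y" using xy(2) w by (auto simp: quadrant_def)
  moreover have "c \<le> u * fst x + v * snd x" using hull xy(1) ge by blast
  moreover have "u * fst x + v * snd x + (u * fst y + v * snd y) = c" using p(2) xy(3)
      by (simp add: algebra_simps)
  ultimately have x: "u * fst x + v * snd x = c" and y: "u * fst y + v * snd y = 0" by linarith+
  let ?T = "convex hull S0 \<inter> {z. inner (u, v) z = c}"
  have "?T face_of convex hull S0"
  proof (rule face_of_Int_supporting_hyperplane_ge[OF convex_convex_hull])
    fix z assume "z \<in> convex hull S0"
    then show "c \<le> inner (u, v) z" using ge[of z] hull by (auto simp: inner_prod_def)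
  qed
  then obtain S1 where S1: "S1 \<subseteq> S0" "?T = convex hull S1"
    using face_of_convex_hull_subset[OF finite_imp_compact[OF S0(1)]] by metis
  have "S1 \<subseteq> ?T" unfolding S1(2) by (rule hull_subset)
  have "S1 \<subseteq> rpt ` {(j, k). F $ j $ k \<noteq> 0 \<and> u * real j + v * real k = c}"
  proof
    fix z assume z: "z \<in> S1"
    then obtain j k where "z = (real j, real k)" "F $ j $ k \<noteq> 0"
      using S1(1) S0(2) by (auto simp: rpt_def taylor_support_def)
    moreover have "inner (u, v) z = c" using z \<open>S1 \<subseteq> ?T\<close> by blast
    ultimately show "z \<in> rpt ` {(j, k). F $ j $ k \<noteq> 0 \<and> u * real j + v * real k = c}"
      by (auto simp: rpt_def inner_prod_def intro!: image_eqI[of _ _ "(j, k)"])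
  qed
  moreover have "x \<in> convex hull S1" using x xy(1) unfolding S1(2)[symmetric]
      by (simp add: inner_prod_def)
  ultimately have "x \<in> convex hull (rpt ` {(j, k). F $ j $ k \<noteq> 0 \<and> u * real j + v * real k = c})"
    using hull_mono by blast
  then show ?thesis using that xy y by blast
qed

lemma exists_support_below:
  assumes "x \<in> convex hull (rpt ` S)" "inner w x < (c :: real)"
  shows "\<exists>s\<in>S. inner w (rpt s) < c"
proof (rule ccontr)
  assume "\<not> ?thesis"
  then have "rpt ` S \<subseteq> {x. inner w x \<ge> c}" by (auto simp: not_less)
  then have "convex hull (rpt ` S) \<subseteq> {x. inner w x \<ge> c}" by (intro hull_minimal convex_halfspace_ge)
  then show False using assms by auto
qed

text \<open>The bisectrix crosses the face on the line with weights \<open>(u, v)\<close>. The two witnesses are points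
  of the polyhedron rather than of the support, because an unbounded face may carry support on one
  side only.\<close>

definition diag_edge :: "real fps fps \<Rightarrow> real \<Rightarrow> real \<Rightarrow> bool" where
  "diag_edge F u v \<longleftrightarrow> 0 \<le> u \<and> 0 \<le> v \<and> u + v = 1 \<and> weight_ge u v (newton_distance F) F \<and>
     (\<exists>A\<in>np F. u * fst A + v * snd A = newton_distance F \<and> fst A < snd A) \<and>
     (\<exists>B\<in>np F. u * fst B + v * snd B = newton_distance F \<and> snd B < fst B)"

lemma face_of_supporting_line:
  assumes "0 \<le> u" "0 \<le> v" "weight_ge u v d F"
  shows "(np F \<inter> {p. inner (u, v) p = d}) face_of np F"
proof (rule face_of_Int_supporting_hyperplane_ge[OF convex_np])
  fix p assume "p \<in> np F"
  then show "d \<le> inner (u, v) p" using np_weight_ge[OF assms(3,1,2), of "fst p" "snd p"]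
      by (simp add: inner_prod_def)
qed

lemma on_diagonal:
  assumes "u + v = (1 :: real)" "u * fst p + v * snd p = d" "fst p = snd p"
  shows "p = (d, d)"
proof -
  have "fst p = d" using assms by (metis distrib_right mult_1)
  then show ?thesis using assms by (simp add: prod_eq_iff)
qed

text \<open>A face through \<open>(d, d)\<close> contains the points \<open>A\<close> and \<open>B\<close> on its two sides; if it is
  one-dimensional, it lies on the line through them.\<close>

lemma principal_face_edge:
  assumes F: "F \<noteq> 0" and E: "diag_edge F u v"
  shows "principal_face F = np F \<inter> {p. u * fst p + v * snd p = newton_distance F}"
    and "principal_face F edge_of np F"
proof -
  have uv: "0 \<le> u" "0 \<le> v" "u + v = 1" "weight_ge u v (newton_distance F) F" using E
      by (simp_all add: diag_edge_def)
  define d where "d = newton_distance F"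
  define L where "L = np F \<inter> {p. u * fst p + v * snd p = d}"
  have L_eq: "L = np F \<inter> {p. inner (u, v) p = d}" by (auto simp: L_def inner_prod_def)
  have face_L: "L face_of np F"
    unfolding L_eq using uv by (intro face_of_supporting_line) (simp_all add: d_def)
  have "u * d + v * d = d" by (metis uv(3) distrib_right mult_1)
  then have dL: "(d, d) \<in> L" using diagonal_in_np[OF F] by (simp add: L_def d_def)
  have diag: "p = (d, d)" if "u * fst p + v * snd p = d" "fst p = snd p" for p
    by (rule on_diagonal[OF uv(3) that])
  have convL: "convex L" using face_L by (rule face_of_imp_convex)
  have "\<exists>A\<in>L. fst A < snd A" "\<exists>B\<in>L. snd B < fst B" using E unfolding diag_edge_def L_def d_def
      by blast+
  then obtain A B where A: "A \<in> L" "fst A < snd A" and B: "B \<in> L" "snd B < fst B" by blast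
  then have AB: "A \<noteq> B" by force
  have hyp: "L \<subseteq> {p. inner (u, v) p = d}" by (auto simp: L_eq)
  have uv0: "(u, v) \<noteq> 0" using uv(3) by (auto simp: zero_prod_def)
  have hdim: "aff_dim {p. inner (u, v) p = d} = 1" using aff_dim_hyperplane[OF uv0, of d] by simp
  have ge1: "1 \<le> aff_dim E" if "A \<in> E" "B \<in> E" for E :: "(real \<times> real) set"
    using aff_dim_subset[of "{A, B}" E] that aff_dim_2[of A B] AB by auto
  have aL: "aff_dim L = 1"
    using ge1[OF A(1) B(1)] aff_dim_subset[OF hyp] hdim by linarith
  have in_affine: "x \<in> affine hull {A, B}" if "A \<in> E" "B \<in> E" "x \<in> E" "aff_dim E = 1" for x
      and E :: "(real \<times> real) set"
  proof -
    have "collinear E" using that(4) by (simp add: collinear_aff_dim)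
    then have "collinear {A, B, x}" by (rule collinear_subset) (simp add: that)
    then show ?thesis using collinear_3_affine_hull[OF AB] by simp
  qed
  \<comment> \<open>the parameter at which the segment from \<open>A\<close> to \<open>B\<close> crosses the bisectrix\<close>
  define t where "t = (snd A - fst A) / ((snd A - fst A) + (fst B - snd B))"
  have t: "0 < t" "t < 1" using A B by (auto simp: t_def field_simps)
  let ?P = "(1 - t) *\<^sub>R A + t *\<^sub>R B"
  have PL: "?P \<in> L" using convexD_alt[OF convL A(1) B(1), of t] t by simp
  have "fst ?P = snd ?P"
  proof -
    have "fst ?P - snd ?P = - (1 - t) * (snd A - fst A) + t * (fst B - snd B)"
        by (simp add: algebra_simps)
    also have "\<dots> = t * ((snd A - fst A) + (fst B - snd B)) - (snd A - fst A)"
        by (simp add: algebra_simps)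
    also have "\<dots> = 0" using A B by (simp add: t_def)
    finally show ?thesis by simp
  qed
  moreover have "u * fst ?P + v * snd ?P = d" using PL unfolding L_def
      by (simp only: Int_iff mem_Collect_eq)
  ultimately have P: "(d, d) = ?P" by (intro diag[symmetric])
  have seg: "(d, d) \<in> open_segment A B" unfolding in_segment P using AB t by blast
  have contains: "A \<in> E \<and> B \<in> E" if "E face_of np F" "(d, d) \<in> E" for E
    using that seg A B unfolding face_of_def by (auto simp: L_def)
  have uniq: "E = L" if E: "newton_face E F" "(d, d) \<in> E" for E
  proof -
    have f: "E face_of np F" and AE: "A \<in> E" and BE: "B \<in> E"
      using E contains unfolding newton_face_def by blast+
    then have dE: "aff_dim E = 1" using ge1[of E] E by (auto simp: newton_face_def)
    have "affine hull {A, B} \<subseteq> {p. inner (u, v) p = d}" using A(1) B(1) hyp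
        by (intro hull_minimal affine_hyperplane) auto
    then have "E \<subseteq> L" using in_affine[OF AE BE _ dE] face_of_imp_subset[OF f] by (auto simp: L_eq)
    moreover have "L \<subseteq> E"
    proof
      fix x assume x: "x \<in> L"
      have "affine hull {A, B} \<subseteq> affine hull E" using AE BE by (intro hull_mono) auto
      then have "x \<in> affine hull E" using in_affine[OF A(1) B(1) x aL] by blast
      then show "x \<in> E" using face_of_imp_eq_affine_Int[OF convex_np f] x by (auto simp: L_def)
    qed
    ultimately show ?thesis by blast
  qed
  have nL: "newton_face L F" using face_L aL by (simp add: newton_face_def)
  have pf: "principal_face F = L"
    unfolding principal_face_def Let_def d_def[symmetric]
  proof (rule the_equality)
    show "newton_face L F \<and> (d, d) \<in> L \<and> (\<forall>E'. newton_face E' F \<and> (d, d) \<in> E' \<longrightarrow> aff_dim L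
        \<le> aff_dim E')"
      using nL dL uniq by blast
    fix E assume "newton_face E F \<and> (d, d) \<in> E \<and> (\<forall>E'. newton_face E' F \<and> (d, d) \<in> E' \<longrightarrow> aff_dim E
        \<le> aff_dim E')"
    then show "E = L" by (intro uniq) simp_all
  qed
  show "principal_face F = np F \<inter> {p. u * fst p + v * snd p = newton_distance F}"
    using pf by (simp only: L_def d_def)
  show "principal_face F edge_of np F" using pf face_L aL by (simp add: edge_of_def)
qed

text \<open>On any supporting line the face stays on one side of the bisectrix. So \<open>(d, d)\<close> is an end point
  of that face, hence an extreme point of the polyhedron, hence a point of the support.\<close>

lemma principal_face_vertex:
  assumes F: "F \<noteq> 0" and no_edge: "\<And>u v. \<not> diag_edge F u v"
  obtains D where "newton_distance F = real D" "F $ D $ D \<noteq> 0" "principal_face F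
      = {(real D, real D)}"
proof -
  obtain u v where uv: "0 \<le> u" "0 \<le> v" "u + v = 1" "weight_ge u v (newton_distance F) F"
    using supporting_weights[OF F] by blast
  define d where "d = newton_distance F"
  define L where "L = np F \<inter> {p. u * fst p + v * snd p = d}"
  have L_eq: "L = np F \<inter> {p. inner (u, v) p = d}" by (auto simp: L_def inner_prod_def)
  have face_L: "L face_of np F"
    unfolding L_eq using uv by (intro face_of_supporting_line) (simp_all add: d_def)
  have "u * d + v * d = d" by (metis uv(3) distrib_right mult_1)
  then have dL: "(d, d) \<in> L" using diagonal_in_np[OF F] by (simp add: L_def d_def)
  have diag: "p = (d, d)" if "u * fst p + v * snd p = d" "fst p = snd p" for p
    by (rule on_diagonal[OF uv(3) that])
  have convL: "convex L" using face_L by (rule face_of_imp_convex)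
  have no: "\<not> ((\<exists>A\<in>L. fst A < snd A) \<and> (\<exists>B\<in>L. snd B < fst B))"
    using no_edge[of u v] uv unfolding diag_edge_def L_def d_def by blast
  have L0: "L \<inter> {p. inner (1, -1) p = 0} = {(d, d)}"
  proof (intro subset_antisym subsetI)
    fix p assume "p \<in> L \<inter> {p. inner (1, -1) p = 0}"
    then have "u * fst p + v * snd p = d" unfolding L_def by blast
    moreover have "fst p = snd p" using \<open>p \<in> _\<close> by (simp add: inner_prod_def)
    ultimately have "u * fst p + v * snd p = d" "fst p = snd p" by blast+
    then show "p \<in> {(d, d)}" using diag[of p] by simp
  next
    fix p assume "p \<in> {(d, d)}"
    then show "p \<in> L \<inter> {p. inner (1, -1) p = 0}" using dL by (simp add: inner_prod_def)
  qed
  have "{(d, d)} face_of L"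
  proof (cases "\<exists>A\<in>L. fst A < snd A")
    case True
    then have le: "fst p \<le> snd p" if "p \<in> L" for p using no that by (meson not_le)
    have "(L \<inter> {p. inner (1, -1) p = 0}) face_of L"
      by (rule face_of_Int_supporting_hyperplane_le[OF convL])
          (use le in \<open>simp add: inner_prod_def\<close>)
    then show ?thesis by (simp only: L0)
  next
    case False
    then have le: "snd p \<le> fst p" if "p \<in> L" for p using that by (meson not_le)
    have "(L \<inter> {p. inner (1, -1) p = 0}) face_of L"
      by (rule face_of_Int_supporting_hyperplane_ge[OF convL])
          (use le in \<open>simp add: inner_prod_def\<close>)
    then show ?thesis by (simp only: L0)
  qed
  then have fd: "{(d, d)} face_of np F" using face_L by (rule face_of_trans)
  then have ext: "(d, d) extreme_point_of np F" by (simp add: face_of_singleton)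
  have pf: "principal_face F = {(d, d)}"
    unfolding principal_face_def Let_def d_def[symmetric]
  proof (rule the_equality)
    have pos: "0 \<le> aff_dim E" if "(d, d) \<in> E" for E :: "(real \<times> real) set"
      using that aff_dim_subset[of "{(d, d)}" E] by simp
    show "newton_face {(d, d)} F \<and> (d, d) \<in> {(d, d)} \<and>
        (\<forall>E'. newton_face E' F \<and> (d, d) \<in> E' \<longrightarrow> aff_dim {(d, d)} \<le> aff_dim E')"
      using fd pos by (simp add: newton_face_def)
    fix E assume E: "newton_face E F \<and> (d, d) \<in> E \<and>
        (\<forall>E'. newton_face E' F \<and> (d, d) \<in> E' \<longrightarrow> aff_dim E \<le> aff_dim E')"
    have "newton_face {(d, d)} F" using fd by (simp add: newton_face_def)
    then have "aff_dim E \<le> aff_dim {(d, d)}" using E by blast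
    then have "aff_dim E = 0" using pos[of E] E by simp
    then obtain a where "E = {a}" by (auto simp: aff_dim_eq_0)
    then show "E = {(d, d)}" using E by auto
  qed
  obtain S0 where S0: "finite S0" "S0 \<subseteq> rpt ` taylor_support F"
    and e: "np F = (\<Union>x\<in>convex hull S0. \<Union>y\<in>quadrant. {x + y})" by (rule np_decomposition)
  have in_np: "x + y \<in> np F" if "x \<in> convex hull S0" "y \<in> quadrant" for x y
    unfolding e using that by (metis UN_I singletonI)
  obtain x y where xy: "x \<in> convex hull S0" "y \<in> quadrant" "(d, d) = x + y"
    using diagonal_in_np[OF F] unfolding d_def e by (meson UN_E singletonD)
  have q0: "(0 :: real \<times> real) \<in> quadrant" by (simp add: zero_prod_def)
  have "y = 0"
  proof (rule ccontr)
    assume "y \<noteq> 0"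
    have q: "y + y \<in> quadrant" using xy(2) by (cases y) simp
    have "(d, d) = (1 - 1/2) *\<^sub>R (x + 0) + (1/2) *\<^sub>R (x + (y + y))"
      unfolding xy(3) by (cases x; cases y) (simp add: field_simps)
    moreover have "y + y \<noteq> 0" using \<open>y \<noteq> 0\<close> by (metis scaleR_2 scaleR_eq_0_iff zero_neq_numeral)
    then have "x + 0 \<noteq> x + (y + y)" by simp
    ultimately have "(d, d) \<in> open_segment (x + 0) (x + (y + y))"
      unfolding in_segment by (intro conjI exI[of _ "1/2"]) simp_all
    then show False using ext in_np[OF xy(1) q0] in_np[OF xy(1) q] unfolding extreme_point_of_def
        by blast
  qed
  then have dh: "(d, d) \<in> convex hull S0" using xy by simp
  have "convex hull S0 \<subseteq> np F" using in_np[OF _ q0] by (simp add: subset_iff)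
  then have "(d, d) extreme_point_of (convex hull S0)" using ext dh unfolding extreme_point_of_def
      by blast
  then have "(d, d) \<in> S0" by (rule extreme_point_of_convex_hull)
  then obtain j k where jk: "F $ j $ k \<noteq> 0" "d = real j" "d = real k"
    using S0(2) by (auto simp: rpt_def taylor_support_def)
  then have "j = k" by simp
  then show ?thesis using that[of j] jk pf by (simp add: d_def)
qed

abbreviation "nd \<equiv> newton_distance"

text \<open>The summand of \<open>A\<close> in the polytope is at most as far to the right as \<open>A\<close>, so some point of the
  support on the line is, too; likewise for \<open>B\<close> and the height.\<close>

lemma diag_edge_support:
  assumes "diag_edge F u v"
  shows "0 < v \<Longrightarrow> \<exists>j k. F $ j $ k \<noteq> 0 \<and> u * real j + v * real k = nd F \<and> real j < nd F"
    and "0 < u \<Longrightarrow> \<exists>j k. F $ j $ k \<noteq> 0 \<and> u * real j + v * real k = nd F \<and> real k < nd F"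
proof -
  note E = assms[unfolded diag_edge_def]
  then have uv: "0 \<le> u" "0 \<le> v" "weight_ge u v (nd F) F" "u + v = 1" by blast+
  let ?S = "{(j, k). F $ j $ k \<noteq> 0 \<and> u * real j + v * real k = nd F}"
  {
    assume v: "0 < v"
    obtain A where A: "A \<in> np F" "u * fst A + v * snd A = nd F" "fst A < snd A" using E by blast
    have "u * fst A + v * snd A = (u + v) * fst A + v * (snd A - fst A)"
        by (simp add: algebra_simps)
    then have "fst A < nd F" using A v uv by simp
    moreover obtain x y where "A = x + y" "y \<in> quadrant" "x \<in> convex hull (rpt ` ?S)"
      using supporting_face_hull[OF uv(1-3) A(1,2)] by blast
    ultimately have "x \<in> convex hull (rpt ` ?S)" "inner (1, 0) x < nd F"
      by (auto simp: inner_prod_def quadrant_def)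
    from exists_support_below[OF this]
    show "\<exists>j k. F $ j $ k \<noteq> 0 \<and> u * real j + v * real k = nd F \<and> real j < nd F"
      by (auto simp: rpt_def inner_prod_def)
  }
  {
    assume u: "0 < u"
    obtain B where B: "B \<in> np F" "u * fst B + v * snd B = nd F" "snd B < fst B" using E by blast
    have "u * fst B + v * snd B = (u + v) * snd B + u * (fst B - snd B)"
        by (simp add: algebra_simps)
    then have "snd B < nd F" using B u uv by simp
    moreover obtain x y where "B = x + y" "y \<in> quadrant" "x \<in> convex hull (rpt ` ?S)"
      using supporting_face_hull[OF uv(1-3) B(1,2)] by blast
    ultimately have "x \<in> convex hull (rpt ` ?S)" "inner (0, 1) x < nd F"
      by (auto simp: inner_prod_def quadrant_def)
    from exists_support_below[OF this]
    show "\<exists>j k. F $ j $ k \<noteq> 0 \<and> u * real j + v * real k = nd F \<and> real k < nd F"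
      by (auto simp: rpt_def inner_prod_def)
  }
qed

lemma swap_vars_eq_0: "swap_vars F = 0 \<longleftrightarrow> F = 0"
  by (metis swap_vars_swap_vars swap_vars_nth fps2_eqI fps_zero_nth)

lemma np_swap_vars: "(a, b) \<in> np (swap_vars F) \<longleftrightarrow> (b, a) \<in> np F"
proof -
  have *: "(b, a) \<in> np F" if "(a, b) \<in> np (swap_vars F)" for F a b
  proof -
    have "np (swap_vars F) \<subseteq> {p. (snd p, fst p) \<in> np F}"
      unfolding newton_polyhedron_def[of "swap_vars F"]
    proof (rule hull_minimal)
      show "(\<Union>(j, k)\<in>taylor_support (swap_vars F). {(t1, t2). real j \<le> t1 \<and> real k
          \<le> t2}) \<subseteq> {p. (snd p, fst p) \<in> np F}"
      proof
        fix p assume "p \<in> (\<Union>(j, k)\<in>taylor_support (swap_vars F). {(t1, t2). real j \<le> t1 \<and> real k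
            \<le> t2})"
        then obtain j k where jk: "F $ k $ j \<noteq> 0" "real j \<le> fst p" "real k \<le> snd p"
          by (auto simp: taylor_support_def swap_vars_nth)
        have "(real k, real j) + (snd p - real k, fst p - real j) \<in> np F"
          by (rule np_up[OF support_in_np[OF jk(1)]]) (use jk in simp)
        then show "p \<in> {p. (snd p, fst p) \<in> np F}" by simp
      qed
      show "convex {p. (snd p, fst p) \<in> np F}"
        unfolding convex_def
      proof clarify
        fix a b a' b' s t :: real
        assume h: "(snd (a, b), fst (a, b)) \<in> np F" "(snd (a', b'), fst (a', b')) \<in> np F" "0 \<le> s" "0
            \<le> t" "s + t = 1"
        then have "s *\<^sub>R (b, a) + t *\<^sub>R (b', a') \<in> np F"           using convexD[OF convex_np[of F],
            of "(b, a)" "(b', a')" s t] by simp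
        then show "(snd (s *\<^sub>R (a, b) + t *\<^sub>R (a', b')), fst (s *\<^sub>R (a, b) + t *\<^sub>R (a', b'))) \<in> np
            F" by simp
      qed
    qed
    then show ?thesis using that by auto
  qed
  show ?thesis using *[of a b F] *[of b a "swap_vars F"] by (auto simp: swap_vars_swap_vars)
qed

lemma distance_swap_vars: "nd (swap_vars F) = nd F"
proof (cases "F = 0")
  case False
  have *: "nd F \<le> nd (swap_vars F)" if F: "F \<noteq> 0" for F
  proof -
    obtain u v where uv: "0 \<le> u" "0 \<le> v" "u + v = 1" "weight_ge u v (nd F) F"
        using supporting_weights[OF F] by blast
    then show ?thesis using F by (intro distance_geI[of _ v u]) (simp_all add: swap_vars_eq_0
        swap_vars_weight_ge add.commute)
  qed
  show ?thesis using *[OF False] *[of "swap_vars F"] False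
      by (simp add: swap_vars_swap_vars swap_vars_eq_0)
next
  case True
  then have "swap_vars F = F" by (intro fps2_eqI) (simp add: swap_vars_nth)
  then show ?thesis by simp
qed

lemma diag_edge_swap_vars: "diag_edge F u v \<Longrightarrow> diag_edge (swap_vars F) v u"
  unfolding diag_edge_def distance_swap_vars swap_vars_weight_ge
  by (auto simp: np_swap_vars add.commute intro: bexI[of _ "(_, _)"])

subsection \<open>The principal part\<close>

abbreviation "pp \<equiv> principal_part"

lemma pp_nth: "pp F $ j $ k = (if (real j, real k) \<in> principal_face F then F $ j $ k else 0)"
  by (simp add: principal_part_def)

lemma pp_edge_nth:
  assumes "F \<noteq> 0" "diag_edge F u v"
  shows "pp F $ j $ k = (if u * real j + v * real k = nd F then F $ j $ k else 0)"
  using support_in_np[of F j k] by (auto simp: pp_nth principal_face_edge(1)[OF assms])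

lemma pp_weight_ge: "weight_ge u v c F \<Longrightarrow> weight_ge u v c (pp F)"
  by (auto simp: weight_ge_def pp_nth)

text \<open>The principal face is spanned by its support up to the quadrant, so \<open>(d, d)\<close> stays in the
  polyhedron of the principal part.\<close>

lemma distance_pp:
  assumes F: "F \<noteq> 0"
  shows "pp F \<noteq> 0" "nd (pp F) = nd F"
proof -
  have "pp F \<noteq> 0 \<and> nd (pp F) \<le> nd F"
  proof (cases "\<exists>u v. diag_edge F u v")
    case False
    then obtain D where D: "nd F = real D" "F $ D $ D \<noteq> 0" "principal_face F = {(real D, real D)}"
      using principal_face_vertex[OF F] by metis
    then have "pp F $ D $ D \<noteq> 0" by (simp add: pp_nth)
    then show ?thesis using D by (auto intro: distance_leI)
  next
    case True
    then obtain u v where E: "diag_edge F u v" by blast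
    then have uv: "0 \<le> u" "0 \<le> v" "u + v = 1" "weight_ge u v (nd F) F"
        by (simp_all add: diag_edge_def)
    have "u * nd F + v * nd F = nd F" by (metis uv(3) distrib_right mult_1)
    then have l: "u * fst (nd F, nd F) + v * snd (nd F, nd F) = nd F" by simp
    obtain x y where xy: "(nd F, nd F) = x + y" "y \<in> quadrant"
      "x \<in> convex hull (rpt ` {(j, k). F $ j $ k \<noteq> 0 \<and> u * real j + v * real k = nd F})"
      by (rule supporting_face_hull[OF uv(1,2,4) diagonal_in_np[OF F] l])
    have "rpt ` {(j, k). F $ j $ k \<noteq> 0 \<and> u * real j + v * real k = nd F} \<subseteq> np (pp F)"
      using support_in_np[of "pp F"] by (auto simp: rpt_def pp_edge_nth[OF F E])
    then have "convex hull (rpt ` {(j, k). F $ j $ k \<noteq> 0 \<and> u * real j + v * real k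
        = nd F}) \<subseteq> np (pp F)"
      using convex_np by (rule hull_minimal)
    then have "x \<in> np (pp F)" using xy(3) by blast
    then have dn: "(nd F, nd F) \<in> np (pp F)" unfolding xy(1) using xy(2) by (rule np_up)
    have "taylor_support (pp F) \<noteq> {}" using dn by (auto simp: newton_polyhedron_def)
    then have "pp F \<noteq> 0" by (simp add: support_empty_iff)
    then show ?thesis using dn by (simp add: newton_distance_props)
  qed
  then show ne: "pp F \<noteq> 0" and le: "nd (pp F) = nd F"
  proof -
    assume a: "pp F \<noteq> 0 \<and> nd (pp F) \<le> nd F"
    show "pp F \<noteq> 0" using a by blast
    obtain u v where uv: "0 \<le> u" "0 \<le> v" "u + v = 1" "weight_ge u v (nd F) F"
        using supporting_weights[OF F] by blast
    have "nd F \<le> nd (pp F)"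
      using a uv pp_weight_ge[OF uv(4)] by (intro distance_geI[of _ u v]) simp_all
    then show "nd (pp F) = nd F" using a by simp
  qed
qed

lemma pp_swap_vars: "pp (swap_vars F) = swap_vars (pp F)"
proof (cases "F = 0")
  case True
  then show ?thesis by (intro fps2_eqI) (simp add: pp_nth swap_vars_nth)
next
  case F: False
  then have F': "swap_vars F \<noteq> 0" by (simp add: swap_vars_eq_0)
  show ?thesis
  proof (cases "\<exists>u v. diag_edge F u v")
    case True
    then obtain u v where E: "diag_edge F u v" by blast
    show ?thesis
      by (intro fps2_eqI)
        (simp add: swap_vars_nth pp_edge_nth[OF F E] pp_edge_nth[OF F' diag_edge_swap_vars[OF E]]
            distance_swap_vars add.commute)
  next
    case no: False
    then have no': "\<nexists>u v. diag_edge (swap_vars F) u v" using diag_edge_swap_vars[of "swap_vars F"]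
        by (auto simp: swap_vars_swap_vars)
    obtain D where D: "nd F = real D" "principal_face F = {(real D, real D)}"
      using principal_face_vertex[OF F] no by metis
    obtain D' where D': "nd (swap_vars F) = real D'" "principal_face (swap_vars F)
        = {(real D', real D')}"
      using principal_face_vertex[OF F'] no' by metis
    have "D' = D" using D D' by (simp add: distance_swap_vars)
    then show ?thesis using D D' by (intro fps2_eqI) (auto simp: pp_nth swap_vars_nth)
  qed
qed

subsection \<open>Weights of the principal face\<close>

text \<open>A vanishing weight means that the face contains a ray parallel to an axis.\<close>

lemma principal_edge_compact:
  assumes F: "F \<noteq> 0" and E: "diag_edge F u v"
  shows "compact (principal_face F) \<longleftrightarrow> 0 < u \<and> 0 < v"
proof -
  have uv: "0 \<le> u" "0 \<le> v" "u + v = 1" using E by (simp_all add: diag_edge_def)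
  let ?d = "nd F"
  have dl: "u * ?d + v * ?d = ?d" by (metis uv(3) distrib_right mult_1)
  have pf: "principal_face F = np F \<inter> {p. u * fst p + v * snd p = ?d}"
    by (rule principal_face_edge(1)[OF F E])
  have unb: "\<not> compact (principal_face F)" if w: "w \<in> quadrant" "w \<noteq> 0" "u * fst w + v * snd w = 0"
      for w
  proof
    assume "compact (principal_face F)"
    then obtain M where M: "\<And>p. p \<in> principal_face F \<Longrightarrow> norm p \<le> M"
        using compact_imp_bounded bounded_iff by metis
    have inF: "(?d, ?d) + t *\<^sub>R w \<in> principal_face F" if "0 \<le> t" for t
    proof -
      have "t *\<^sub>R w \<in> quadrant" using w(1) that by (cases w) simp
      then have "(?d, ?d) + t *\<^sub>R w \<in> np F" by (rule np_up[OF diagonal_in_np[OF F]])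
      moreover have "u * fst ((?d, ?d) + t *\<^sub>R w) + v * snd ((?d, ?d) + t *\<^sub>R w)
          = u * ?d + v * ?d + t * (u * fst w + v * snd w)"
        by (simp add: algebra_simps)
      ultimately show ?thesis unfolding pf using w(3) dl by simp
    qed
    define t where "t = (M + norm (?d, ?d) + 1) / norm w"
    have "norm ((?d, ?d) + 0 *\<^sub>R w) \<le> M" by (rule M[OF inF]) simp
    then have "0 \<le> M" by (rule order_trans[OF norm_ge_zero])
    then have t: "0 \<le> t" by (simp add: t_def)
    have "norm (t *\<^sub>R w) \<le> norm ((?d, ?d) + t *\<^sub>R w) + norm (?d, ?d)"
      using norm_triangle_ineq4[of "(?d, ?d) + t *\<^sub>R w" "(?d, ?d)"]
          by (simp only: add_diff_cancel_left')
    also have "\<dots> \<le> M + norm (?d, ?d)" using M[OF inF[OF t]] by simp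
    finally show False using w(2) t by (simp add: t_def)
  qed
  show ?thesis
  proof (cases "0 < u \<and> 0 < v")
    case True
    have "principal_face F \<subseteq> cbox (0, 0) (?d / u, ?d / v)"
    proof
      fix p assume "p \<in> principal_face F"
      then have p: "u * fst p + v * snd p = ?d" "0 \<le> fst p" "0 \<le> snd p"
        using np_ge_0[of "fst p" "snd p" F] by (auto simp: pf)
      moreover have "0 \<le> u * fst p" "0 \<le> v * snd p" using p uv by simp_all
      ultimately have "fst p * u \<le> ?d" "snd p * v \<le> ?d" by (simp_all add: mult.commute)
      then show "p \<in> cbox (0, 0) (?d / u, ?d / v)" using True p
          by (cases p) (simp add: cbox_Pair_iff pos_le_divide_eq)
    qed
    then have "bounded (principal_face F)" by (rule bounded_subset[OF bounded_cbox])
    moreover have "closed (principal_face F)"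
    proof -
      have "principal_face F = np F \<inter> {p. inner (u, v) p = ?d}" by (auto simp: pf inner_prod_def)
      then show ?thesis using closed_np closed_hyperplane by (metis closed_Int)
    qed
    ultimately show ?thesis using True by (simp add: compact_eq_bounded_closed)
  next
    case False
    then consider "u = 0" | "v = 0" using uv by linarith
    then have "\<not> compact (principal_face F)"
    proof cases
      case 1
      then show ?thesis by (intro unb[of "(1, 0)"]) (simp_all add: zero_prod_def)
    next
      case 2
      then show ?thesis by (intro unb[of "(0, 1)"]) (simp_all add: zero_prod_def)
    qed
    then show ?thesis using False by blast
  qed
qed

text \<open>The line through \<open>(d, d)\<close> and a second point of the face is unique.\<close>

lemma edge_weight_line:
  assumes F: "F \<noteq> 0" and E: "diag_edge F u v" and w: "principal_face F \<subseteq> weight_line \<kappa>1 \<kappa>2"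
  shows "nd F * \<kappa>1 = u" "nd F * \<kappa>2 = v"
proof -
  let ?d = "nd F"
  have uv: "0 \<le> u" "0 \<le> v" "u + v = 1" using E by (simp_all add: diag_edge_def)
  have pf: "principal_face F = np F \<inter> {p. u * fst p + v * snd p = ?d}"
    by (rule principal_face_edge(1)[OF F E])
  obtain A where A: "A \<in> np F" "u * fst A + v * snd A = ?d" "fst A < snd A"
    using E unfolding diag_edge_def by blast
  have "u * ?d + v * ?d = ?d" by (metis uv(3) distrib_right mult_1)
  then have "(?d, ?d) \<in> principal_face F" using diagonal_in_np[OF F] by (simp add: pf)
  then have 1: "\<kappa>1 * ?d + \<kappa>2 * ?d = 1" using w by (auto simp: weight_line_def)
  have "A \<in> weight_line \<kappa>1 \<kappa>2" using A w pf by blast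
  then have 2: "\<kappa>1 * fst A + \<kappa>2 * snd A = 1" by (cases A) (simp add: weight_line_def)
  have v: "v = 1 - u" using uv by simp
  have k2: "?d * \<kappa>2 = 1 - ?d * \<kappa>1" using 1 by (simp add: algebra_simps)
  have "?d = ?d * (\<kappa>1 * fst A + \<kappa>2 * snd A)" using 2 by simp
  also have "\<dots> = (?d * \<kappa>1) * fst A + (?d * \<kappa>2) * snd A" by (simp add: algebra_simps)
  finally have "?d = (?d * \<kappa>1) * fst A + (1 - ?d * \<kappa>1) * snd A" unfolding k2 .
  moreover have "?d = u * fst A + (1 - u) * snd A" using A(2) v by simp
  ultimately have "(?d * \<kappa>1) * fst A + (1 - ?d * \<kappa>1) * snd A = u * fst A + (1 - u) * snd A"
      by (rule subst)
  then have "(e - u) * (fst A - snd A) = 0" if "e = ?d * \<kappa>1" for e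
    unfolding that[symmetric] by (simp add: algebra_simps)
  then have "(?d * \<kappa>1 - u) * (fst A - snd A) = 0" by blast
  then show "?d * \<kappa>1 = u" using A(3) by simp
  then show "?d * \<kappa>2 = v" using k2 v by simp
qed

lemma edge_in_weight_line:
  assumes F: "F \<noteq> 0" and E: "diag_edge F u v" and d: "0 < nd F"
  shows "principal_face F \<subseteq> weight_line (u / nd F) (v / nd F)"
proof
  fix p assume "p \<in> principal_face F"
  then have "u * fst p + v * snd p = nd F" unfolding principal_face_edge(1)[OF F E] by blast
  then have "(u * fst p + v * snd p) / nd F = 1" using d by simp
  then show "p \<in> weight_line (u / nd F) (v / nd F)"
    by (cases p) (simp add: weight_line_def add_divide_distrib)
qed

section \<open>Root multiplicities and shears\<close>

lemma order_linear_power_other: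
  assumes "a \<noteq> (b :: real)"
  shows "order b ([:-a, 1:] ^ n) = 0"
  by (rule order_0I) (use assms in \<open>simp add: poly_power\<close>)

lemma order_add_le_degree:
  assumes "p \<noteq> (0 :: real poly)" "a \<noteq> b"
  shows "order a p + order b p \<le> degree p"
proof -
  obtain q where q: "p = [:-a, 1:] ^ order a p * q" using order_decomp[OF assms(1)] by blast
  have q0: "q \<noteq> 0" using q assms(1) by auto
  have "order b p = order b ([:-a, 1:] ^ order a p) + order b q"
    using q assms(1) by (metis order_mult)
  then have "order b p \<le> degree q" using order_linear_power_other[OF assms(2)] order_degree[OF q0]
      by simp
  moreover have "degree p = order a p + degree q"
  proof -
    have "degree p = degree ([:-a, 1:] ^ order a p) + degree q"
      using q assms(1) by (metis degree_mult_eq mult_eq_0_iff)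
    then show ?thesis by (simp add: degree_linear_power)
  qed
  ultimately show ?thesis by simp
qed

text \<open>Moving a root to the origin turns its multiplicity into the lowest exponent.\<close>

lemma order_as_lowest_coeff:
  assumes "p \<noteq> (0 :: real poly)"
  shows "coeff (pcompose p [:a, 1:]) (order a p) \<noteq> 0"
    and "k < order a p \<Longrightarrow> coeff (pcompose p [:a, 1:]) k = 0"
proof -
  obtain q where q: "p = [:-a, 1:] ^ order a p * q" "\<not> [:-a, 1:] dvd q" using order_decomp[OF assms]
      by blast
  have pw: "pcompose (r ^ m) s = pcompose r s ^ m" for r s :: "real poly" and m
    by (induction m) (simp_all add: pcompose_1 pcompose_mult)
  have "pcompose p [:a, 1:] = pcompose ([:-a, 1:] ^ order a p) [:a, 1:] * pcompose q [:a, 1:]"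
    using q(1) by (metis pcompose_mult)
  also have "pcompose ([:-a, 1:] ^ order a p) [:a, 1:] = monom 1 (order a p)"
    by (simp add: pw pcompose_pCons monom_altdef)
  finally have e: "pcompose p [:a, 1:] = monom 1 (order a p) * pcompose q [:a, 1:]" .
  have "poly q a \<noteq> 0" using q(2) by (simp add: poly_eq_0_iff_dvd)
  then show "coeff (pcompose p [:a, 1:]) (order a p) \<noteq> 0" by (simp add: e coeff_monom_mult)
  show "k < order a p \<Longrightarrow> coeff (pcompose p [:a, 1:]) k = 0" by (simp add: e coeff_monom_mult)
qed

text \<open>The factors belonging to the roots \<open>0\<close> and \<open>a\<close> are coprime, so their degrees add up.\<close>

lemma nonzero_root_order_bound:
  assumes "p \<noteq> (0 :: real poly)" "a \<noteq> 0"
  obtains k where "coeff p k \<noteq> 0" "order a p + k \<le> degree p"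
  using order_as_lowest_coeff(1)[OF assms(1), of 0] order_add_le_degree[OF assms] that by simp

subsection \<open>The polynomial on a line of integral slope\<close>

text \<open>The polynomial \<open>P(1, z)\<close>, where \<open>P\<close> is the part of \<open>F\<close> on the line \<open>j + s k = L\<close>.\<close>

definition linepoly :: "real fps fps \<Rightarrow> nat \<Rightarrow> nat \<Rightarrow> real poly" where
  "linepoly F s L = (\<Sum>k\<le>L. monom (if s * k \<le> L then F $ (L - s * k) $ k else 0) k)"

lemma coeff_linepoly:
  assumes "1 \<le> s"
  shows "coeff (linepoly F s L) k = (if s * k \<le> L then F $ (L - s * k) $ k else 0)"
proof -
  have "k \<le> s * k" using assms by simp
  then have "k \<le> L" if "s * k \<le> L" using that by (rule le_trans)
  then show ?thesis unfolding linepoly_def coeff_sum by (auto simp: coeff_monom)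
qed

lemma fps_power_low:
  assumes "\<And>i. i < s \<Longrightarrow> g $ i = (0 :: real)"
  shows "i < s * m \<Longrightarrow> (g ^ m) $ i = 0" "(g ^ m) $ (s * m) = (g $ s) ^ m"
proof -
  have g: "g = fps_X ^ s * fps_shift s g"
    using assms by (intro fps_ext) (simp add: fps_X_power_mult_nth)
  have gm: "g ^ m = fps_X ^ (s * m) * fps_shift s g ^ m"
    by (subst g) (simp only: power_mult_distrib power_mult)
  show "i < s * m \<Longrightarrow> (g ^ m) $ i = 0" "(g ^ m) $ (s * m) = (g $ s) ^ m"
    by (simp_all add: gm fps_X_power_mult_nth fps_power_zeroth)
qed

lemma coeff_pcompose_linepoly:
  "coeff (pcompose (linepoly F s L) [:a, 1:]) k =
    (\<Sum>b\<le>L. if k \<le> b then (if s * b \<le> L then F $ (L - s * b) $ b else 0) * (real (b choose k) * a ^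
        (b - k)) else 0)"
proof -
  let ?c = "\<lambda>b. if s * b \<le> L then F $ (L - s * b) $ b else 0"
  have "pcompose (monom c b) q = smult c (q ^ b)" for c :: real and b q
    by (induction b) (simp_all add: monom_Suc pcompose_pCons monom_0)
  then have "coeff (pcompose (linepoly F s L) [:a, 1:]) k = (\<Sum>b\<le>L. ?c b * coeff ([:a, 1:] ^ b) k)"
    unfolding linepoly_def pcompose_sum coeff_sum by simp
  also have "\<dots> = (\<Sum>b\<le>L. if k \<le> b then ?c b * (real (b choose k) * a ^ (b - k)) else 0)"
  proof (intro sum.cong refl)
    fix b
    show "?c b * coeff ([:a, 1:] ^ b) k = (if k
        \<le> b then ?c b * (real (b choose k) * a ^ (b - k)) else 0)"
    proof (cases "k \<le> b")
      case True
      then show ?thesis using coeff_linear_poly_power[OF True, of a 1] by simp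
    next
      case False
      then have "coeff ([:a, 1:] ^ b) k = 0" by (intro coeff_eq_0) (simp add: degree_linear_power)
      then show ?thesis using False by simp
    qed
  qed
  finally show ?thesis .
qed

text \<open>The terms of \<open>g\<close> beyond \<open>x\<^sub>1\<^sup>s\<close> only contribute above the line, so on the line the shear is the
  translation \<open>z \<mapsto> z + g\<^sub>s\<close>.\<close>

lemma fshear_line:
  assumes s: "1 \<le> s" and low: "\<And>i. i < s \<Longrightarrow> g $ i = 0"
    and F: "\<And>j k. F $ j $ k \<noteq> 0 \<Longrightarrow> L \<le> j + s * k" and jk: "j + s * k = L"
  shows "fshear F g $ j $ k = coeff (pcompose (linepoly F s L) [:g $ s, 1:]) k"
proof -
  let ?c = "\<lambda>b. if s * b \<le> L then F $ (L - s * b) $ b else 0"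
  have "coeff (pcompose (linepoly F s L) [:g $ s, 1:]) k =
      (\<Sum>b\<le>L. if k \<le> b then ?c b * (real (b choose k) * (g $ s) ^ (b - k)) else 0)"
    by (rule coeff_pcompose_linepoly)
  also have "\<dots> = (\<Sum>b\<le>j+k. if k \<le> b then ?c b * (real (b choose k) * (g $ s) ^ (b - k)) else 0)"
  proof (rule sum.mono_neutral_right)
    have "k \<le> s * k" using s by simp
    then show "{..j + k} \<subseteq> {..L}" using jk by auto
    show "\<forall>b\<in>{..L} - {..j + k}. (if k \<le> b then ?c b * (real (b choose k) * (g $ s) ^ (b - k)) else
        0) = 0"
    proof
      fix b assume "b \<in> {..L} - {..j + k}"
      then have b: "j + k < b" by simp
      have "j < b - k" using b by simp
      also have "\<dots> \<le> s * (b - k)" using s by simp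
      finally have "L < s * b" using jk b by (simp add: diff_mult_distrib2)
      then show "(if k \<le> b then ?c b * (real (b choose k) * (g $ s) ^ (b - k)) else 0) = 0" by simp
    qed
  qed simp
  also have "\<dots> = (\<Sum>b\<le>j + k. \<Sum>a\<le>j + k. if a \<le> j \<and> k
      \<le> b then F $ a $ b * real (b choose k) * (g ^ (b - k)) $ (j - a) else 0)"
  proof (intro sum.cong refl)
    fix b
    have t: "(if a \<le> j \<and> k \<le> b then F $ a $ b * real (b choose k) * (g ^ (b - k)) $ (j - a) else 0)
       = (if a = L - s * b then if k \<le> b then ?c b * (real (b choose k) * (g $ s) ^ (b - k)) else 0
           else 0)" for a
    proof (cases "a \<le> j \<and> k \<le> b \<and> F $ a $ b \<noteq> 0 \<and> (g ^ (b - k)) $ (j - a) \<noteq> 0")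
      case True
      then have "L \<le> a + s * b" using F by blast
      moreover have "s * (b - k) \<le> j - a"
          using True fps_power_low(1)[of s g, OF low, of "j - a" "b - k"] by force
      moreover have "s * b = s * (b - k) + s * k" using True by (simp flip: distrib_left)
      ultimately have e: "a = L - s * b" "s * b \<le> L" "j - a = s * (b - k)" using True jk
          by linarith+
      then show ?thesis using True fps_power_low(2)[of s g, OF low, of "b - k"] by simp
    next
      case False
      have "?c b * (real (b choose k) * (g $ s) ^ (b - k)) = 0" if "a = L - s * b" "k \<le> b"
      proof (rule ccontr)
        assume nz: "?c b * (real (b choose k) * (g $ s) ^ (b - k)) \<noteq> 0"
        then have sb: "s * b \<le> L" "F $ a $ b \<noteq> 0" "(g $ s) ^ (b - k) \<noteq> 0" using that
            by (auto split: if_splits)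
        have "s * b = s * (b - k) + s * k" using that by (simp flip: distrib_left)
        then have "a \<le> j" "j - a = s * (b - k)" using sb(1) that(1) jk by linarith+
        then show False using False sb that fps_power_low(2)[of s g, OF low, of "b - k"] by simp
      qed
      then show ?thesis using False by auto
    qed
    show "(if k \<le> b then ?c b * (real (b choose k) * (g $ s) ^ (b - k)) else 0) =
       (\<Sum>a\<le>j + k. if a \<le> j \<and> k \<le> b then F $ a $ b * real (b choose k) * (g ^ (b - k)) $ (j - a) else
           0)"
    proof -
      have "L - s * b \<le> j + k" if "k \<le> b"
      proof -
        have "s * k \<le> s * b" using that by simp
        then show ?thesis using jk by linarith
      qed
      then show ?thesis unfolding t by (simp only: sum.delta finite_atMost) auto
    qed
  qed
  also have "\<dots> = fshear F g $ j $ k" unfolding fshear_nth by (rule sum.swap)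
  finally show ?thesis by simp
qed

text \<open>The monomial at \<open>(L - s n, n)\<close> is the one that controls the weighted orders of the sheared
  series.\<close>

lemma fshear_line_nonzero:
  assumes s: "1 \<le> s" and low: "\<And>i. i < s \<Longrightarrow> g $ i = 0" and F: "weight_ge 1 (real s) (real L) F"
    and p: "linepoly F s L \<noteq> 0"
  defines "n \<equiv> order (g $ s) (linepoly F s L)"
  shows "s * n \<le> L" "fshear F g $ (L - s * n) $ n \<noteq> 0"
    "\<And>j k. j + s * k = L \<Longrightarrow> fshear F g $ j $ k \<noteq> 0 \<Longrightarrow> n \<le> k"
    "weight_ge 1 (real s) (real L) (fshear F g)"
proof -
  have F': "L \<le> j + s * k" if "F $ j $ k \<noteq> 0" for j k
  proof -
    have "real L \<le> real (j + s * k)" using weight_geD[OF F that] by simp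
    then show ?thesis by (simp only: of_nat_le_iff)
  qed
  let ?q = "pcompose (linepoly F s L) [:g $ s, 1:]"
  have l: "fshear F g $ j $ k = coeff ?q k" if "j + s * k = L" for j k
    by (rule fshear_line[OF s low F' that])
  have nz: "coeff ?q n \<noteq> 0" unfolding n_def by (rule order_as_lowest_coeff(1)[OF p])
  have "n \<le> degree (linepoly F s L)" unfolding n_def by (rule order_degree[OF p])
  moreover have dg: "s * degree (linepoly F s L) \<le> L"
  proof (rule ccontr)
    assume "\<not> s * degree (linepoly F s L) \<le> L"
    then have "coeff (linepoly F s L) (degree (linepoly F s L)) = 0" using coeff_linepoly[OF s]
        by simp
    then show False using p by simp
  qed
  ultimately show sn: "s * n \<le> L" by (meson le_trans mult_le_mono2)
  show "fshear F g $ (L - s * n) $ n \<noteq> 0" using l[of "L - s * n" n] sn nz by simp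
  show "n \<le> k" if "j + s * k = L" "fshear F g $ j $ k \<noteq> 0" for j k
    using l[OF that(1)] that(2) order_as_lowest_coeff(2)[OF p, of k "g $ s"] unfolding n_def
        by force
  show "weight_ge 1 (real s) (real L) (fshear F g)"
  proof (rule weight_ge_fshear[OF _ _ F])
    fix i assume "g $ i \<noteq> 0"
    then have "s \<le> i" using low not_less by blast
    then show "real s \<le> 1 * real i" by simp
  qed simp
qed

subsection \<open>Roots of large multiplicity\<close>

text \<open>A root \<open>x\<^sub>2 = \<beta> x\<^sub>1\<^sup>s\<close> of multiplicity \<open>n > d\<close>. The condition on \<open>L\<close> says that the line passes
  through \<open>(d, d)\<close>.\<close>

definition dominant_root :: "real fps fps \<Rightarrow> nat \<Rightarrow> nat \<Rightarrow> real \<Rightarrow> nat \<Rightarrow> bool" where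
  "dominant_root F s L \<beta> n \<longleftrightarrow> 1 \<le> s \<and> \<beta> \<noteq> 0 \<and> real L = nd F * (1 + real s)
      \<and> weight_ge 1 (real s) (real L) F \<and>
     linepoly F s L \<noteq> 0 \<and> order \<beta> (linepoly F s L) = n \<and> nd F < real n"

lemma linepoly_top:
  assumes s: "1 \<le> s" and p: "linepoly F s L \<noteq> 0"
  defines "k \<equiv> degree (linepoly F s L)"
  shows "s * k \<le> L" "F $ (L - s * k) $ k \<noteq> 0"
proof -
  have "coeff (linepoly F s L) k \<noteq> 0" using p by (simp add: k_def)
  then show "s * k \<le> L" "F $ (L - s * k) $ k \<noteq> 0"
      by (auto simp: coeff_linepoly[OF s] split: if_splits)
qed

text \<open>The degree on the line is at most \<open>L / s \<le> 2 d\<close>; a root of multiplicity above \<open>d\<close> needs more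
  room than there is on one side of the bisectrix.\<close>

lemma dominant_root_points:
  assumes F: "F \<noteq> 0" and dominant_root: "dominant_root F s L \<beta> n"
  obtains j k j' k' where "F $ j $ k \<noteq> 0" "j + s * k = L" "nd F < real k"
    "F $ j' $ k' \<noteq> 0" "j' + s * k' = L" "real k' < nd F"
proof -
  have s: "1 \<le> s" and b: "\<beta> \<noteq> 0" and L: "real L = nd F * (1 + real s)" and p: "linepoly F s L \<noteq> 0"
    and n: "order \<beta> (linepoly F s L) = n" "nd F < real n" using dominant_root
        by (auto simp: dominant_root_def)
  let ?k = "degree (linepoly F s L)"
  obtain k' where k': "coeff (linepoly F s L) k' \<noteq> 0" "n + k' \<le> ?k"
    using nonzero_root_order_bound[OF p b] n by auto
  then have k'': "s * k' \<le> L" "F $ (L - s * k') $ k' \<noteq> 0"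
      by (auto simp: coeff_linepoly[OF s] split: if_splits)
  note top = linepoly_top[OF s p]
  have "real s * real ?k \<le> nd F * (1 + real s)" using top(1) L by (metis of_nat_le_iff of_nat_mult)
  also have "\<dots> \<le> nd F * (real s + real s)" using s distance_ge_0[OF F]
      by (intro mult_left_mono) auto
  also have "\<dots> = real s * (2 * nd F)" by simp
  finally have "real ?k \<le> 2 * nd F" using s by simp
  then have "real k' < nd F" using k'(2) n(2) by linarith
  moreover have "nd F < real ?k" using k'(2) n(2) by linarith
  ultimately show ?thesis using that[of "L - s * ?k" ?k "L - s * k'" k'] top k'' by simp
qed

text \<open>Points of the support on both sides of the bisectrix leave only one supporting line at \<open>(d, d)\<close>.\<close>

lemma dominant_root_unique_weights:
  assumes F: "F \<noteq> 0" and dominant_root: "dominant_root F s L \<beta> n"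
      and w: "weight_ge u v (nd F * (u + v)) F"
  shows "v = real s * u"
proof -
  obtain j k j' k' where jk: "F $ j $ k \<noteq> 0" "j + s * k = L" "nd F < real k"
    "F $ j' $ k' \<noteq> 0" "j' + s * k' = L" "real k' < nd F"
        by (rule dominant_root_points[OF F dominant_root])
  have L: "real L = nd F * (1 + real s)" using dominant_root by (simp add: dominant_root_def)
  have *: "0 \<le> (v - real s * u) * (real k - nd F)" if "F $ j $ k \<noteq> 0" "j + s * k = L" for j k
  proof -
    have "real j + real s * real k = real L" using that(2) by (metis of_nat_add of_nat_mult)
    then have j: "real j = nd F * (1 + real s) - real s * real k" using L by simp
    have "nd F * (u + v) \<le> u * real j + v * real k" by (rule weight_geD[OF w that(1)])
    then show ?thesis unfolding j by (simp add: algebra_simps)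
  qed
  have "0 \<le> v - real s * u" using *[OF jk(1,2)] jk(3) by (simp add: zero_le_mult_iff)
  moreover have "v - real s * u \<le> 0" using *[OF jk(4,5)] jk(6) by (simp add: zero_le_mult_iff)
  ultimately show ?thesis by simp
qed

lemma dominant_root_diag_edge:
  assumes F: "F \<noteq> 0" and dominant_root: "dominant_root F s L \<beta> n"
  shows "diag_edge F (1 / (1 + real s)) (real s / (1 + real s))"
proof -
  let ?u = "1 / (1 + real s)" and ?v = "real s / (1 + real s)"
  obtain j k j' k' where jk: "F $ j $ k \<noteq> 0" "j + s * k = L" "nd F < real k"
    "F $ j' $ k' \<noteq> 0" "j' + s * k' = L" "real k' < nd F"
        by (rule dominant_root_points[OF F dominant_root])
  have s: "1 \<le> s" and L: "real L = nd F * (1 + real s)" and w: "weight_ge 1 (real s) (real L) F"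
      using dominant_root by (auto simp: dominant_root_def)
  have *: "?u * a + ?v * b = (a + real s * b) / (1 + real s)" for a b :: real
    by (simp add: add_divide_distrib)
  have on: "?u * real j + ?v * real k = nd F \<and> real j + real s * real k = nd F * (1 + real s)"
      if "j + s * k = L" for j k
  proof -
    have "real j + real s * real k = nd F * (1 + real s)" using that L
        by (metis of_nat_add of_nat_mult)
    then show ?thesis unfolding * by simp
  qed
  have side: "(real j - nd F) = - (real s * (real k - nd F))" if "j + s * k = L" for j k
    using on[OF that] by (simp add: algebra_simps)
  have "weight_ge ?u ?v (nd F) F"
  proof (rule weight_geI)
    fix a b assume "F $ a $ b \<noteq> 0"
    then have "nd F * (1 + real s) \<le> real a + real s * real b" using weight_geD[OF w] L by fastforce
    then show "nd F \<le> ?u * real a + ?v * real b" unfolding * by (simp add: pos_le_divide_eq)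
  qed
  moreover have "?u + ?v = 1" by (simp flip: add_divide_distrib)
  moreover have "real j < real k"
  proof -
    have "0 < real s * (real k - nd F)" using jk(3) s by simp
    then show ?thesis using side[OF jk(2)] jk(3) by linarith
  qed
  moreover have "real k' < real j'"
  proof -
    have "real s * (real k' - nd F) < 0" using jk(6) s by (simp add: mult_less_0_iff)
    then show ?thesis using side[OF jk(5)] jk(6) by linarith
  qed
  ultimately show ?thesis
    unfolding diag_edge_def
    using on[OF jk(2)] on[OF jk(5)] support_in_np[OF jk(1)] support_in_np[OF jk(4)]
    by (intro conjI bexI[of _ "(real j, real k)"] bexI[of _ "(real j', real k')"]) simp_all
qed

text \<open>The degree on the line is at most \<open>2 d\<close>, too small for two roots of multiplicity above \<open>d\<close>.\<close>

lemma dominant_root_unique: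
  assumes F: "F \<noteq> 0" and dominant_root: "dominant_root F s L \<beta> n"
      and dominant_root': "dominant_root F s' L' \<beta>' n'"
  shows "s' = s" "n' = n"
proof -
  have "weight_ge 1 (real s') (nd F * (1 + real s')) F" "1 \<le> s'" using dominant_root'
      by (auto simp: dominant_root_def)
  then show s': "s' = s" using dominant_root_unique_weights[OF F dominant_root, of 1 "real s'"]
      by simp
  have L': "real L = nd F * (1 + real s)" "real L' = nd F * (1 + real s)"
      using dominant_root dominant_root' s' by (auto simp: dominant_root_def)
  then have LL: "L' = L" by linarith
  have s: "1 \<le> s" and p: "linepoly F s L \<noteq> 0" using dominant_root by (auto simp: dominant_root_def)
  have n: "order \<beta> (linepoly F s L) = n" "order \<beta>' (linepoly F s L) = n'" "nd F < real n" "nd F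
      < real n'"
    using dominant_root dominant_root' s' LL by (auto simp: dominant_root_def)
  have "\<beta>' = \<beta>"
  proof (rule ccontr)
    assume "\<beta>' \<noteq> \<beta>"
    then have "n + n' \<le> degree (linepoly F s L)" using order_add_le_degree[OF p] n by metis
    then have "real s * (real n + real n') \<le> real s * real (degree (linepoly F s L))"
        by (intro mult_left_mono) simp_all
    also have "\<dots> \<le> nd F * (1 + real s)" using linepoly_top(1)[OF s p] L'(1)
        by (metis of_nat_le_iff of_nat_mult)
    also have "\<dots> \<le> nd F * (real s + real s)" using s distance_ge_0[OF F]
        by (intro mult_left_mono) auto
    also have "\<dots> = real s * (2 * nd F)" by simp
    finally have "real n + real n' \<le> 2 * nd F" using s by simp
    then show False using n by linarith
  qed
  then show "n' = n" using n by simp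
qed

text \<open>The distance, the line and the polynomial on it are the same for \<open>F\<close> and its principal part. For
  the converse, the two points of \<open>dominant_root_points\<close> force the principal face to be the edge
  on that line.\<close>

lemma dominant_root_pp:
  assumes F: "F \<noteq> 0"
  shows "dominant_root (pp F) s L \<beta> n \<longleftrightarrow> dominant_root F s L \<beta> n"
proof -
  have lp: "linepoly (pp F) s L = linepoly F s L"
    if E: "diag_edge F u v" and v: "v = real s * u" and L: "real L = nd F * (1 + real s)"
        and s: "1 \<le> s" for u v
  proof (rule poly_eqI)
    fix k
    have "u * real (L - s * k) + v * real k = nd F" if "s * k \<le> L"
    proof -
      have "u * real (L - s * k) + v * real k = u * real L" using that v
          by (simp add: of_nat_diff algebra_simps)
      also have "\<dots> = nd F * (u + v)" using L v by (simp add: algebra_simps)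
      finally show ?thesis using E by (simp add: diag_edge_def)
    qed
    then show "coeff (linepoly (pp F) s L) k = coeff (linepoly F s L) k"
      by (simp add: coeff_linepoly[OF s] pp_edge_nth[OF F E])
  qed
  show ?thesis
  proof
    assume b: "dominant_root F s L \<beta> n"
    have E: "diag_edge F (1 / (1 + real s)) (real s / (1 + real s))"
        by (rule dominant_root_diag_edge[OF F b])
    have "linepoly (pp F) s L = linepoly F s L" using lp[OF E] b by (simp add: dominant_root_def)
    then show "dominant_root (pp F) s L \<beta> n" using b pp_weight_ge
        by (auto simp: dominant_root_def distance_pp[OF F])
  next
    assume b: "dominant_root (pp F) s L \<beta> n"
    then have s: "1 \<le> s" and L: "real L = nd F * (1 + real s)"
        by (simp_all add: dominant_root_def distance_pp[OF F])
    obtain j k j' k' where jk: "pp F $ j $ k \<noteq> 0" "j + s * k = L" "nd F < real k"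
      "pp F $ j' $ k' \<noteq> 0" "j' + s * k' = L" "real k' < nd F"
      using dominant_root_points[OF distance_pp(1)[OF F] b] by (metis distance_pp(2)[OF F])
    have "\<exists>u v. diag_edge F u v"
    proof (rule ccontr)
      assume "\<nexists>u v. diag_edge F u v"
      then obtain D where "principal_face F = {(real D, real D)}" using principal_face_vertex[OF F]
          by metis
      then have "k = k'" using jk(1,4) by (auto simp: pp_nth split: if_splits)
      then show False using jk by simp
    qed
    then obtain u v where E: "diag_edge F u v" by blast
    then have uv: "0 \<le> u" "0 \<le> v" "u + v = 1" "weight_ge u v (nd F) F"
        by (simp_all add: diag_edge_def)
    have "u * real j + v * real k = nd F" using jk(1)
        by (simp add: pp_edge_nth[OF F E] split: if_splits)
    moreover have "real j + real s * real k = nd F * (1 + real s)" using jk(2) L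
        by (metis of_nat_add of_nat_mult)
    then have "real j = nd F * (1 + real s) - real s * real k" by simp
    ultimately have "u * (nd F * (1 + real s) - real s * real k) + v * real k = nd F" by simp
    then have "u * (nd F * (1 + real s) - real s * real k) + v * real k = nd F * (u + v)"
        using uv(3) by simp
    then have "(v - real s * u) * (real k - nd F) = 0" by (simp add: algebra_simps)
    then have v: "v = real s * u" using jk(3) by simp
    have u: "0 < u" using uv v by (cases "u = 0") auto
    have "weight_ge 1 (real s) (real L) F"
    proof (rule weight_geI)
      fix a b assume "F $ a $ b \<noteq> 0"
      then have "nd F * (u + v) \<le> u * real a + v * real b" using weight_geD[OF uv(4)] uv(3) by simp
      then have "u * (nd F * (1 + real s)) \<le> u * (1 * real a + real s * real b)"
          by (simp add: v algebra_simps)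
      then show "real L \<le> 1 * real a + real s * real b" using u L by simp
    qed
    then show "dominant_root F s L \<beta> n" using b lp[OF E v L s]
        by (auto simp: dominant_root_def distance_pp[OF F])
  qed
qed

subsection \<open>Bounding weighted orders after a shear\<close>

text \<open>If the line missed \<open>(d, d)\<close>, a comparison with a supporting line would put all its support on
  one side of the bisectrix, where exponents of \<open>x\<^sub>2\<close> differ by at most \<open>d\<close>.\<close>

lemma line_root_bound:
  assumes F: "F \<noteq> 0" and s: "1 \<le> s" and b: "\<beta> \<noteq> 0" and w: "weight_ge 1 (real s) (real L) F"
    and p: "linepoly F s L \<noteq> 0" and n: "nd F < real (order \<beta> (linepoly F s L))"
  shows "dominant_root F s L \<beta> (order \<beta> (linepoly F s L))"
proof -
  let ?d = "nd F" and ?k = "degree (linepoly F s L)"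
  have Ld: "real L \<le> ?d * (1 + real s)" using weight_ge_le_distance[OF F _ _ w]
      by (simp add: mult.commute)
  obtain k' where k': "coeff (linepoly F s L) k' \<noteq> 0" "order \<beta> (linepoly F s L) + k' \<le> ?k"
    using nonzero_root_order_bound[OF p b] by blast
  then have low: "s * k' \<le> L" "F $ (L - s * k') $ k' \<noteq> 0"
      by (auto simp: coeff_linepoly[OF s] split: if_splits)
  note top = linepoly_top[OF s p]
  have "\<not> real L < ?d * (1 + real s)"
  proof
    assume less: "real L < ?d * (1 + real s)"
    obtain u v where uv: "0 \<le> u" "0 \<le> v" "u + v = 1" "weight_ge u v ?d F"
        using supporting_weights[OF F] by blast
    define e where "e = v - u * real s"
    have v: "v = e + u * real s" by (simp add: e_def)
    have uL: "u * real L \<le> u * (?d * (1 + real s))" using uv less by (intro mult_left_mono) auto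
    have *: "?d \<le> u * real L + e * real k" if "s * k \<le> L" "F $ (L - s * k) $ k \<noteq> 0" for k
    proof -
      have "?d \<le> u * real (L - s * k) + v * real k" by (rule weight_geD[OF uv(4) that(2)])
      also have "\<dots> = u * real L + e * real k" using that(1)
          by (simp add: of_nat_diff v algebra_simps)
      finally show ?thesis .
    qed
    have dd: "?d = u * (?d * (1 + real s)) + e * ?d"
    proof -
      have "u * (?d * (1 + real s)) + e * ?d = ?d * (u + v)" by (simp add: v algebra_simps)
      then show ?thesis using uv(3) by simp
    qed
    have side: "0 \<le> e * (real k - ?d)" if "s * k \<le> L" "F $ (L - s * k) $ k \<noteq> 0" for k
      using *[OF that] uL dd by (simp add: right_diff_distrib)
    consider "e = 0" | "0 < e" | "e < 0" by linarith
    then show False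
    proof cases
      case 1
      then have "u \<noteq> 0" using uv(3) v by auto
      then have "u * real L < u * (?d * (1 + real s))" using uv(1) less by simp
      moreover have "u * (?d * (1 + real s)) = ?d" using dd unfolding 1 by linarith
      moreover have "?d \<le> u * real L" using *[OF top] unfolding 1 by simp
      ultimately show False by linarith
    next
      case 2
      then have "?d \<le> real k'" using side[OF low] by (simp add: zero_le_mult_iff)
      then have "real s * ?d \<le> real s * real k'" by (intro mult_left_mono) simp_all
      moreover have "real s * (real (order \<beta> (linepoly F s L)) + real k') \<le> real s * real ?k"
        using k'(2) by (intro mult_left_mono) simp_all
      moreover have "real s * real ?k \<le> real L" using top(1) by (metis of_nat_le_iff of_nat_mult)
      ultimately have "real s * real (order \<beta> (linepoly F s L)) < ?d" using less
          by (simp add: algebra_simps)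
      moreover have "1 * real (order \<beta> (linepoly F s L)) \<le> real s * real (order \<beta> (linepoly F s L))"
        using s by (intro mult_right_mono) simp_all
      ultimately show False using n by simp
    next
      case 3
      then have "real ?k \<le> ?d" using side[OF top] by (simp add: zero_le_mult_iff)
      then show False using n k' by linarith
    qed
  qed
  then show ?thesis using assms Ld by (simp add: dominant_root_def)
qed

lemma exists_line_order:
  assumes F: "F \<noteq> 0" and s: "1 \<le> s"
  obtains L where "weight_ge 1 (real s) (real L) F" "linepoly F s L \<noteq> 0"
proof -
  define P where "P L \<longleftrightarrow> (\<exists>j k. F $ j $ k \<noteq> 0 \<and> j + s * k = L)" for L
  have "\<exists>L. P L" using F by (auto simp: P_def fps_nonzero_nth)
  then have P: "P (LEAST L. P L)" by (rule LeastI_ex)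
  define L where "L = (LEAST L. P L)"
  obtain j k where jk: "F $ j $ k \<noteq> 0" "j + s * k = L" using P by (auto simp: P_def L_def)
  have "weight_ge 1 (real s) (real L) F"
  proof (rule weight_geI)
    fix a b assume "F $ a $ b \<noteq> 0"
    then have "L \<le> a + s * b" unfolding L_def by (intro Least_le) (auto simp: P_def)
    then show "real L \<le> 1 * real a + real s * real b"
        by (metis mult_1 of_nat_add of_nat_le_iff of_nat_mult)
  qed
  moreover have "coeff (linepoly F s L) k \<noteq> 0" using jk by (auto simp: coeff_linepoly[OF s])
  ultimately show ?thesis using that[of L] by force
qed

text \<open>If every term of \<open>g\<close> has weight at least \<open>v\<close>, the shear preserves the order. Otherwise \<open>v > u s\<close>
  for the order \<open>s\<close> of \<open>g\<close>, and the lowest monomial on the line of slope \<open>s\<close> is cheap enough to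
  give the bound.\<close>

lemma shear_weight_bound:
  assumes F: "F \<noteq> 0" and g0: "g $ 0 = 0" and uv: "0 \<le> u" "u \<le> v"
    and w: "weight_ge u v c (fshear F g)" and M: "nd F \<le> M"
    and dominant_root: "\<And>s L n. (\<And>i. i < s \<Longrightarrow> g $ i = 0) \<Longrightarrow> dominant_root F s L (g $ s) n \<Longrightarrow> real n
        \<le> M"
  shows "c \<le> M * (u + v)"
proof (cases "\<forall>i. g $ i \<noteq> 0 \<longrightarrow> v \<le> u * real i")
  case True
  have "weight_ge u v c (fshear (fshear F g) (- g))"
    by (rule weight_ge_fshear[OF uv(1) _ w]) (use True in auto)
  then have "weight_ge u v c F" by (simp add: fshear_inverse[OF g0])
  then have "c \<le> (u + v) * nd F" using uv by (intro weight_ge_le_distance[OF F]) auto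
  also have "\<dots> \<le> (u + v) * M" using uv M by (intro mult_left_mono) auto
  finally show ?thesis by (simp add: mult.commute)
next
  case False
  then obtain i where i: "g $ i \<noteq> 0" "u * real i < v" by (auto simp: not_le)
  define s where "s = (LEAST i. g $ i \<noteq> 0)"
  have gs: "g $ s \<noteq> 0" unfolding s_def using i(1) by (rule LeastI)
  have low: "g $ i = 0" if "i < s" for i using not_less_Least that unfolding s_def by blast
  have "s \<le> i" unfolding s_def using i(1) by (rule Least_le)
  then have "u * real s \<le> u * real i" using uv by (intro mult_left_mono) auto
  then have su: "u * real s < v" using i(2) by linarith
  have s: "1 \<le> s" using gs g0 by (cases s) auto
  obtain L where L: "weight_ge 1 (real s) (real L) F" "linepoly F s L \<noteq> 0"
      by (rule exists_line_order[OF F s])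
  define n where "n = order (g $ s) (linepoly F s L)"
  note ln = fshear_line_nonzero[OF s low L, folded n_def]
  have Ld: "real L \<le> nd F * (1 + real s)" using weight_ge_le_distance[OF F _ _ L(1)]
      by (simp add: mult.commute)
  also have "\<dots> \<le> M * (1 + real s)" using M by (intro mult_right_mono) auto
  finally have LM: "real L \<le> M * (1 + real s)" .
  have nM: "real n \<le> M"
  proof (rule ccontr)
    assume "\<not> real n \<le> M"
    then have "nd F < real n" using M by linarith
    then have "dominant_root F s L (g $ s) n" unfolding n_def by (rule line_root_bound[OF F s gs L])
    then show False using dominant_root[of s L n] low \<open>\<not> real n \<le> M\<close> by blast
  qed
  have "c \<le> u * real (L - s * n) + v * real n" by (rule weight_geD[OF w ln(2)])
  also have "\<dots> = u * real L + (v - u * real s) * real n" using ln(1)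
      by (simp add: of_nat_diff algebra_simps)
  also have "\<dots> \<le> u * (M * (1 + real s)) + (v - u * real s) * M"
    using uv su LM nM by (intro add_mono mult_left_mono) auto
  also have "\<dots> = M * (u + v)" by (simp add: algebra_simps)
  finally show ?thesis .
qed

subsection \<open>Reduction of coordinate changes to shears\<close>

text \<open>A formal coordinate change together with its inverse.\<close>

definition formal_diffeo :: "real fps fps \<Rightarrow> real fps fps \<Rightarrow> real fps fps \<Rightarrow> real fps fps \<Rightarrow> bool" where
  "formal_diffeo P1 P2 R1 R2 \<longleftrightarrow> P1 $ 0 $ 0 = 0 \<and> P2 $ 0 $ 0 = 0 \<and> R1 $ 0 $ 0 = 0 \<and> R2 $ 0 $ 0 = 0 \<and>
     fps2_compose P1 R1 R2 = X1 \<and> fps2_compose P2 R1 R2 = X2 \<and>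
     fps2_compose R1 P1 P2 = X1 \<and> fps2_compose R2 P1 P2 = X2"

lemma formal_diffeo_swap: "formal_diffeo P1 P2 R1 R2 \<Longrightarrow>
    formal_diffeo P2 P1 (swap_vars R1) (swap_vars R2)"
  unfolding formal_diffeo_def comp_swap_vars comp_swap_vars_arg
      by (metis swap_vars_X2 swap_vars_nth swap_vars_swap_vars)

lemma formal_diffeo_swap_vars: "formal_diffeo P1 P2 R1 R2 \<Longrightarrow>
    formal_diffeo (swap_vars P1) (swap_vars P2) R2 R1"
  unfolding formal_diffeo_def comp_swap_vars comp_swap_vars_arg
      by (metis swap_vars_X2 swap_vars_nth swap_vars_swap_vars)

text \<open>By the chain rule, the first row of the Jacobian matrix of the inverse times the first column of
  that of \<open>P\<close> is \<open>1\<close>.\<close>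

lemma formal_diffeo_tangent:
  assumes "formal_diffeo P1 P2 R1 R2"
  shows "P1 $ 1 $ 0 \<noteq> 0 \<or> P2 $ 1 $ 0 \<noteq> 0"
proof -
  have P: "P1 $ 0 $ 0 = 0" "P2 $ 0 $ 0 = 0" and R: "fps2_compose R1 P1 P2 = X1" using assms
      by (auto simp: formal_diffeo_def)
  have "D1 X1 $ 0 $ 0 = (fps2_compose (D1 R1) P1 P2 * D1 P1 + fps2_compose (D2 R1) P1 P2 * D1 P2) $
      0 $ 0"
    using comp_chain[OF derivation_D1 P, of R1] R by simp
  then have "1 = D1 R1 $ 0 $ 0 * P1 $ 1 $ 0 + D2 R1 $ 0 $ 0 * P2 $ 1 $ 0"
    by (simp only: fps_add_nth mult_0_0 comp_0_0 D1_nth X1_nth) simp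
  then show ?thesis by force
qed

text \<open>The curve \<open>y\<^sub>2 = 0\<close> is the graph of \<open>g = P\<^sub>2(\<cdot>, 0) \<circ> P\<^sub>1(\<cdot>, 0)\<^sup>-\<^sup>1\<close>. In the coordinates of the
  shear along this graph, \<open>y\<^sub>2\<close> is divisible by the second coordinate and \<open>y\<^sub>1\<close> has no constant
  term; for \<open>u \<le> v\<close> neither loses weight.\<close>

lemma reduce_to_shear:
  assumes d: "formal_diffeo P1 P2 R1 R2" and t: "P1 $ 1 $ 0 \<noteq> 0"
    and uv: "0 \<le> u" "u \<le> v" and w: "weight_ge u v c (fps2_compose F P1 P2)"
  obtains g where "g $ 0 = 0" "weight_ge u v c (fshear F g)" "P2 $ 1 $ 0 = 0 \<Longrightarrow> g $ 1 = 0"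
proof -
  note D = d[unfolded formal_diffeo_def]
  define a where "a = Abs_fps (\<lambda>j. P1 $ j $ 0)"
  define h where "h = Abs_fps (\<lambda>j. P2 $ j $ 0)"
  have a: "a $ 0 = 0" "a $ 1 \<noteq> 0" and h: "h $ 0 = 0" using D t by (simp_all add: a_def h_def)
  \<comment> \<open>reparametrise the curve by its first coordinate\<close>
  define i where "i = fps_inv a"
  have i0: "i $ 0 = 0" by (simp add: i_def fps_inv_def)
  have ai: "a oo i = fps_X" unfolding i_def using a by (intro fps_inv_right)
  define g where "g = h oo i"
  have g0: "g $ 0 = 0" using h i0 by (simp add: g_def)
  have ei: "emb i $ 0 $ 0 = 0" using i0 by (simp add: emb_nth)
  have z: "(0 :: real fps fps) $ 0 $ 0 = 0" by simp
  have P1i: "fps2_compose P1 (emb i) 0 = X1" using comp_emb_0[OF i0, of P1] ai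
      by (simp add: a_def emb_X)
  have P2i: "fps2_compose P2 (emb i) 0 = emb g" using comp_emb_0[OF i0, of P2]
      by (simp add: g_def h_def)
  have "fps2_compose R2 X1 (emb g) = fps2_compose (fps2_compose R2 P1 P2) (emb i) 0"
    using comp_assoc[of P1 P2 "emb i" 0 R2] D ei by (simp add: P1i P2i)
  also have "\<dots> = 0" using D comp_X2[OF ei z] by simp
  finally have R2g: "fps2_compose R2 X1 (emb g) = 0" .
  \<comment> \<open>the coordinates \<open>y\<close> as functions of the coordinates of the shear\<close>
  define C1 where "C1 = fps2_compose R1 X1 (X2 + emb g)"
  define C2 where "C2 = fps2_compose R2 X1 (X2 + emb g)"
  have s0: "(X2 + emb g) $ 0 $ 0 = 0" using g0 by (rule shear_0_0)
  have C0: "C1 $ 0 $ 0 = 0" "C2 $ 0 $ 0 = 0" using D by (simp_all add: C1_def C2_def comp_0_0)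
  have "fps2_compose C2 X1 0 = fps2_compose R2 X1 (emb g)"
  proof -
    have "fps2_compose (X2 + emb g) X1 0 = emb g"
      by (simp add: comp_add comp_X2 X1_0_0 comp_emb_X1)
    then show ?thesis unfolding C2_def using comp_assoc[OF X1_0_0 s0 X1_0_0 z, of R2]
      by (simp add: comp_X1 X1_0_0)
  qed
  then have C2z: "emb (Abs_fps (\<lambda>j. C2 $ j $ 0) oo fps_X) = 0"
    using comp_emb_0[of fps_X C2] R2g by (simp add: emb_X)
  have C2': "C2 $ j $ 0 = 0" for j
  proof -
    have "emb (Abs_fps (\<lambda>j. C2 $ j $ 0)) $ j $ 0 = 0" using C2z by simp
    then show ?thesis by (simp add: emb_nth)
  qed
  have "weight_ge u v u C1"
  proof (rule weight_geI)
    fix j k assume "C1 $ j $ k \<noteq> 0"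
    then have jk: "1 \<le> j + k" using C0 by (cases "j + k") auto
    have "u * 1 \<le> u * real (j + k)" using uv jk by (intro mult_left_mono) auto
    also have "\<dots> \<le> u * real j + v * real k" using uv by (simp add: distrib_left mult_right_mono)
    finally show "u \<le> u * real j + v * real k" by simp
  qed
  moreover have "weight_ge u v v C2"
  proof (rule weight_geI)
    fix j k assume "C2 $ j $ k \<noteq> 0"
    then have k: "1 \<le> k" using C2' by (cases k) auto
    have "v * 1 \<le> v * real k" using uv k by (intro mult_left_mono) auto
    then show "v \<le> u * real j + v * real k" using uv by (simp add: add_increasing)
  qed
  ultimately have "weight_ge u v c (fps2_compose (fps2_compose F P1 P2) C1 C2)" using w
      by (rule comp_weight_ge)
  also have "fps2_compose (fps2_compose F P1 P2) C1 C2
      = fps2_compose F (fps2_compose P1 C1 C2) (fps2_compose P2 C1 C2)"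
    using D C0 by (intro comp_assoc) auto
  also have "fps2_compose P1 C1 C2 = X1"
    unfolding C1_def C2_def using D s0 comp_assoc[of R1 R2 X1 "X2 + emb g" P1]
        by (simp add: X1_0_0 comp_X1)
  also have "fps2_compose P2 C1 C2 = X2 + emb g"
    unfolding C1_def C2_def using D s0 comp_assoc[of R1 R2 X1 "X2 + emb g" P2]
        by (simp add: X1_0_0 comp_X2)
  finally have "weight_ge u v c (fshear F g)" by (simp add: fshear_def)
  moreover have "g $ 1 = 0" if "P2 $ 1 $ 0 = 0"
    using that h by (simp add: g_def fps_compose_nth h_def)
  ultimately show ?thesis using that g0 by blast
qed

lemma comp_eq_0_imp:
  assumes "formal_diffeo P1 P2 R1 R2" "F \<noteq> 0"
  shows "fps2_compose F P1 P2 \<noteq> 0"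
proof
  assume z: "fps2_compose F P1 P2 = 0"
  have "fps2_compose (fps2_compose F P1 P2) R1 R2 = F"
    using assms(1) comp_assoc[of P1 P2 R1 R2 F] by (simp add: formal_diffeo_def comp_id)
  moreover have "fps2_compose 0 R1 R2 = 0" by (intro fps2_eqI) (simp add: fps2_compose_def)
  ultimately show False using z assms(2) by simp
qed

text \<open>A curve \<open>y\<^sub>2 = 0\<close> tangent to the \<open>x\<^sub>2\<close>-axis is a graph over that axis with vanishing derivative;
  this is why only \<open>s \<ge> 2\<close> matters after the interchange.\<close>

lemma weight_bound_diffeo:
  assumes F: "F \<noteq> 0" and d: "formal_diffeo P1 P2 R1 R2" and M: "nd F \<le> M"
    and dominant_root: "\<And>s L \<beta> n. dominant_root F s L \<beta> n \<Longrightarrow> real n \<le> M"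
    and dominant_root': "\<And>s L \<beta> n. dominant_root (swap_vars F) s L \<beta> n \<Longrightarrow> 2 \<le> s \<Longrightarrow> real n \<le> M"
    and uv: "0 \<le> u" "u \<le> v" and w: "weight_ge u v c (fps2_compose F P1 P2)"
  shows "c \<le> M * (u + v)"
proof (cases "P1 $ 1 $ 0 = 0")
  case False
  then obtain g where g: "g $ 0 = 0" "weight_ge u v c (fshear F g)"
      by (rule reduce_to_shear[OF d _ uv w])
  then show ?thesis by (rule shear_weight_bound[OF F _ uv _ M]) (rule dominant_root)
next
  case True
  then have t: "P2 $ 1 $ 0 \<noteq> 0" using formal_diffeo_tangent[OF d] by blast
  have w': "weight_ge u v c (fps2_compose (swap_vars F) P2 P1)" using w
      by (simp add: comp_swap_vars_arg)
  obtain g where g: "g $ 0 = 0" "weight_ge u v c (fshear (swap_vars F) g)" "g $ 1 = 0"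
    using reduce_to_shear[OF formal_diffeo_swap[OF d] t uv w'] True by metis
  show ?thesis
  proof (rule shear_weight_bound[OF _ g(1) uv g(2)])
    fix s L n assume b: "dominant_root (swap_vars F) s L (g $ s) n"
    then have "g $ s \<noteq> 0" "1 \<le> s" by (auto simp: dominant_root_def)
    then have "s \<noteq> 1" using g(3) by metis
    then have "2 \<le> s" using \<open>1 \<le> s\<close> by linarith
    with b show "real n \<le> M" by (rule dominant_root')
  qed (use F M in \<open>simp_all add: swap_vars_eq_0 distance_swap_vars\<close>)
qed

lemma distance_bound_diffeo:
  assumes F: "F \<noteq> 0" and d: "formal_diffeo P1 P2 R1 R2" and M: "nd F \<le> M"
    and dominant_root: "\<And>s L \<beta> n. dominant_root F s L \<beta> n \<Longrightarrow> real n \<le> M"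
    and dominant_root': "\<And>s L \<beta> n. dominant_root (swap_vars F) s L \<beta> n \<Longrightarrow> 2 \<le> s \<Longrightarrow> real n \<le> M"
  shows "nd (fps2_compose F P1 P2) \<le> M"
proof -
  let ?G = "fps2_compose F P1 P2"
  obtain u v where uv: "0 \<le> u" "0 \<le> v" "u + v = 1" "weight_ge u v (nd ?G) ?G"
    using supporting_weights[OF comp_eq_0_imp[OF d F]] by blast
  show ?thesis
  proof (cases "u \<le> v")
    case True
    have "nd ?G \<le> M * (u + v)" by (rule weight_bound_diffeo[OF F d M dominant_root dominant_root'
        uv(1) True uv(4)])
    then show ?thesis using uv by simp
  next
    case False
    then have vu: "v \<le> u" by simp
    have w: "weight_ge v u (nd ?G) (fps2_compose F (swap_vars P1) (swap_vars P2))" using uv(4)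
        by (simp add: comp_swap_vars swap_vars_weight_ge)
    have "nd ?G \<le> M * (v + u)"
      by (rule weight_bound_diffeo[OF F formal_diffeo_swap_vars[OF d] M dominant_root dominant_root'
          uv(2) vu w])
    then show ?thesis using uv by (simp add: add.commute)
  qed
qed

subsection \<open>The effect of removing a dominant root\<close>

text \<open>The line still supports the sheared series, but meets its support only above the bisectrix.
  Tilting the line a little separates it from \<open>(d, d)\<close>.\<close>

lemma dominant_root_shear:
  assumes F: "F \<noteq> 0" and b: "dominant_root F s L \<beta> n" and low: "\<And>i. i < s \<Longrightarrow> g $ i = 0"
      and gs: "g $ s = \<beta>"
  shows "s * n \<le> L" "fshear F g $ (L - s * n) $ n \<noteq> 0" "real (L - s * n) < nd F"
    "weight_ge 1 (real s) (real L) (fshear F g)" "nd F < nd (fshear F g)" "nd (fshear F g) \<le> real n"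
proof -
  have B: "1 \<le> s" "real L = nd F * (1 + real s)" "weight_ge 1 (real s) (real L) F" "linepoly F s L \<noteq>
      0"
    "order \<beta> (linepoly F s L) = n" "nd F < real n" using b unfolding dominant_root_def by blast+
  note ln = fshear_line_nonzero[OF B(1) low B(3,4), unfolded gs B(5)]
  show "s * n \<le> L" "fshear F g $ (L - s * n) $ n \<noteq> 0" "weight_ge 1 (real s) (real L) (fshear F g)"
    using ln by blast+
  have "real (L - s * n) = nd F * (1 + real s) - real s * real n" using ln(1) B(2)
      by (simp add: of_nat_diff)
  moreover have "real s * nd F < real s * real n" using B(1,6) by simp
  ultimately show less: "real (L - s * n) < nd F" by (simp add: algebra_simps)
  have G0: "fshear F g \<noteq> 0" using ln(2) by auto
  show "nd (fshear F g) \<le> real n" using less B(6) by (intro distance_leI[OF ln(2)]) auto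
  have d0: "0 \<le> nd F" by (rule distance_ge_0[OF F])
  \<comment> \<open>The tilt must gain less on \<open>(d, d)\<close> than \<open>1\<close>, the least gap between the line and the lattice points above it.\<close>
  define \<epsilon> where "\<epsilon> = 1 / (2 * (nd F + 1))"
  have e: "0 < \<epsilon>" using d0 by (simp add: \<epsilon>_def)
  have "\<epsilon> * nd F = (1 / 2) * (nd F / (nd F + 1))" by (simp add: \<epsilon>_def)
  also have "\<dots> < 1" using d0 by (simp add: divide_simps)
  finally have e2: "\<epsilon> * nd F < 1" .
  define m where "m = min (real L + \<epsilon> * real n) (real L + 1)"
  have "weight_ge 1 (real s + \<epsilon>) m (fshear F g)"
  proof (rule weight_geI)
    fix j k assume jk: "fshear F g $ j $ k \<noteq> 0"
    have "real L \<le> real (j + s * k)" using weight_geD[OF ln(4) jk] by simp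
    then have "L \<le> j + s * k" by (simp only: of_nat_le_iff)
    then consider "j + s * k = L" | "L + 1 \<le> j + s * k" by linarith
    then show "m \<le> 1 * real j + (real s + \<epsilon>) * real k"
    proof cases
      case 1
      then have "n \<le> k" using ln(3)[OF _ 1 jk] by blast
      then have "\<epsilon> * real n \<le> \<epsilon> * real k" using e by simp
      moreover have "real j + real s * real k = real L" using 1 by (metis of_nat_add of_nat_mult)
      ultimately show ?thesis by (simp add: m_def algebra_simps)
    next
      case 2
      then have "real L + 1 \<le> real j + real s * real k"
          by (metis of_nat_1 of_nat_add of_nat_le_iff of_nat_mult)
      moreover have "0 \<le> \<epsilon> * real k" using e by simp
      ultimately show ?thesis by (simp add: m_def algebra_simps)
    qed
  qed
  then have "m \<le> (1 + (real s + \<epsilon>)) * nd (fshear F g)"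
    using e by (intro weight_ge_le_distance[OF G0]) auto
  moreover have "(1 + (real s + \<epsilon>)) * nd F < m"
  proof -
    have "(1 + (real s + \<epsilon>)) * nd F = real L + \<epsilon> * nd F" using B(2) by (simp add: algebra_simps)
    then show ?thesis using e e2 B(6) by (simp add: m_def)
  qed
  ultimately have "(1 + (real s + \<epsilon>)) * nd F < (1 + (real s + \<epsilon>)) * nd (fshear F g)" by linarith
  then show "nd F < nd (fshear F g)" using e by (simp add: mult_less_cancel_left_pos)
qed

text \<open>The principal part stays on its line under the shear, so all its monomials end up with \<open>k \<ge> n\<close>.\<close>

lemma dominant_root_pp_shear:
  assumes F: "F \<noteq> 0" and b: "dominant_root F s L \<beta> n"
    and low: "\<And>i. i < s \<Longrightarrow> g $ i = 0" and gs: "g $ s = \<beta>" and high: "\<And>i. s < i \<Longrightarrow> g $ i = 0"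
  shows "real n \<le> nd (fshear (pp F) g)"
proof -
  have B: "1 \<le> s" "real L = nd F * (1 + real s)" "weight_ge 1 (real s) (real L) (pp F)" "linepoly
      (pp F) s L \<noteq> 0"
    "order \<beta> (linepoly (pp F) s L) = n" using b dominant_root_pp[OF F, of s L \<beta> n]
        by (auto simp: dominant_root_def distance_pp[OF F])
  note E = dominant_root_diag_edge[OF F b]
  note ln = fshear_line_nonzero[OF B(1) low B(3,4), unfolded gs B(5)]
  have on: "a + s * b = L" if "pp F $ a $ b \<noteq> 0" for a b
  proof -
    have "1 / (1 + real s) * real a + real s / (1 + real s) * real b = nd F"
      using that by (simp add: pp_edge_nth[OF F E] split: if_splits)
    then have "(real a + real s * real b) / (1 + real s) = nd F" by (simp add: add_divide_distrib)
    then have "real (a + s * b) = real L" using B(2) by (simp add: field_simps)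
    then show ?thesis by (simp only: of_nat_eq_iff)
  qed
  have "j + s * k = L" if nz: "fshear (pp F) g $ j $ k \<noteq> 0" for j k
  proof -
    obtain a b where ab: "a \<le> j" "k \<le> b" "pp F $ a $ b \<noteq> 0" "(g ^ (b - k)) $ (j - a) \<noteq> 0"
    proof -
      obtain a where "(\<Sum>b\<le>j + k. if a \<le> j \<and> k \<le> b then pp F $ a $ b * real (b choose k) * (g ^ (b -
          k)) $ (j - a) else 0) \<noteq> 0"
        using nz unfolding fshear_nth by (rule sum.not_neutral_contains_not_neutral)
      then obtain b where "(if a \<le> j \<and> k \<le> b then pp F $ a $ b * real (b choose k) * (g ^ (b - k)) $
          (j - a) else 0) \<noteq> 0"
        by (rule sum.not_neutral_contains_not_neutral)
      then show ?thesis using that by (auto split: if_splits)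
    qed
    have "g = fps_const \<beta> * fps_X ^ s"
    proof (rule fps_ext)
      fix i
      consider "i < s" | "i = s" | "s < i" by linarith
      then show "g $ i = (fps_const \<beta> * fps_X ^ s) $ i"
          by cases (simp_all add: low high gs fps_X_power_nth)
    qed
    then have "g ^ (b - k) = fps_const (\<beta> ^ (b - k)) * fps_X ^ (s * (b - k))"
      by (simp add: power_mult_distrib fps_const_power power_mult)
    then have "j - a = s * (b - k)" using ab(4) by (auto simp: fps_X_power_nth split: if_splits)
    moreover have "s * b = s * (b - k) + s * k" using ab(2) by (simp flip: distrib_left)
    ultimately show ?thesis using on[OF ab(3)] ab(1) by linarith
  qed
  then have "weight_ge 0 1 (real n * (0 + 1)) (fshear (pp F) g)" using ln(3)
      by (intro weight_geI) force
  then show ?thesis using ln(2) by (intro distance_geI[of _ 0 1]) auto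
qed

section \<open>Smooth functions\<close>

lemma C_upto_cong:
  assumes "open U" "\<And>x. x \<in> U \<Longrightarrow> f x = g x" "C_upto n U f"
  shows "C_upto n U g"
  using assms(2,3)
proof (induction n arbitrary: f g)
  case 0
  then show ?case using continuous_on_cong[of U U f g] by simp
next
  case (Suc n)
  have fr: "frechet_derivative f (at x) = frechet_derivative g (at x)" if "x \<in> U" for x
    by (rule frechet_derivative_transform_within_open[OF _ assms(1) that])
      (use Suc.prems that in auto)
  have "g differentiable (at x)" if "x \<in> U" for x
  proof -
    have "(f has_derivative frechet_derivative f (at x)) (at x)"
      using Suc.prems(2) that frechet_derivative_works by auto
    from has_derivative_transform_within_open[OF this assms(1) that] show ?thesis
      using Suc.prems(1) differentiableI by blast
  qed
  moreover have "C_upto n U (\<lambda>x. frechet_derivative g (at x) v)" for v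
    by (rule Suc.IH[of "\<lambda>x. frechet_derivative f (at x) v"]) (use Suc.prems fr in auto)
  ultimately show ?case by simp
qed

lemma C_upto_SucI:
  assumes "open U" "\<And>x. x \<in> U \<Longrightarrow> (f has_derivative f' x) (at x)" "\<And>v. C_upto n U (\<lambda>x. f' x v)"
  shows "C_upto (Suc n) U f"
proof -
  have "f' x = frechet_derivative f (at x)" if "x \<in> U" for x
    using assms(2)[OF that] by (rule frechet_derivative_at)
  then have "C_upto n U (\<lambda>x. frechet_derivative f (at x) v)" for v
    using C_upto_cong[OF assms(1) _ assms(3)[of v]] by simp
  moreover have "\<forall>x\<in>U. f differentiable (at x)" using assms(2) differentiableI by blast
  ultimately show ?thesis by simp
qed

lemma C_upto_SucD:
  assumes "C_upto (Suc n) U f" "x \<in> U"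
  shows "(f has_derivative frechet_derivative f (at x)) (at x)"
  using assms frechet_derivative_works by auto

lemma C_upto_Suc_imp: "C_upto (Suc n) U f \<Longrightarrow> C_upto n U f"
proof (induction n arbitrary: f)
  case 0
  then have "\<forall>x\<in>U. f differentiable (at x)" by simp
  then show ?case by (simp add: continuous_at_imp_continuous_on
      differentiable_imp_continuous_within)
next
  case (Suc n)
  then show ?case by auto
qed

lemma C_upto_subset: "V \<subseteq> U \<Longrightarrow> C_upto n U f \<Longrightarrow> C_upto n V f"
proof (induction n arbitrary: f)
  case (Suc n)
  then show ?case by (simp add: subset_iff)
qed (auto intro: continuous_on_subset)

lemma C_upto_const: "C_upto n U (\<lambda>x. c)"
  by (induction n arbitrary: c) (simp_all add: frechet_derivative_const)

lemma C_upto_linear: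
  assumes "open U" "bounded_linear T" "C_upto n U f"
  shows "C_upto n U (\<lambda>x. T (f x))"
  using assms(3)
proof (induction n arbitrary: f)
  case 0
  then show ?case using bounded_linear.continuous_on[OF assms(2)] by simp
next
  case (Suc n)
  show ?case
    by (rule C_upto_SucI[OF assms(1) bounded_linear.has_derivative[OF assms(2) C_upto_SucD[OF
        Suc.prems]]])
      (use Suc in auto)
qed

lemma C_upto_add:
  assumes "open U" "C_upto n U f" "C_upto n U g"
  shows "C_upto n U (\<lambda>x. f x + g x)"
  using assms(2,3)
proof (induction n arbitrary: f g)
  case 0
  then show ?case by (simp add: continuous_on_add)
next
  case (Suc n)
  show ?case
    by (rule C_upto_SucI[OF assms(1) has_derivative_add[OF C_upto_SucD[OF Suc.prems(1)]
        C_upto_SucD[OF Suc.prems(2)]]])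
      (use Suc in auto)
qed

lemma C_upto_mult:
  fixes f g :: "'a::real_normed_vector \<Rightarrow> real"
  assumes "open U" "C_upto n U f" "C_upto n U g"
  shows "C_upto n U (\<lambda>x. f x * g x)"
  using assms(2,3)
proof (induction n arbitrary: f g)
  case 0
  then show ?case by (simp add: continuous_on_mult)
next
  case (Suc n)
  have "C_upto n U (\<lambda>x. f x * frechet_derivative g (at x) v + frechet_derivative f (at x) v * g x)"
      for v
    using Suc by (intro C_upto_add assms Suc.IH C_upto_Suc_imp[OF Suc.prems(1)] C_upto_Suc_imp[OF
        Suc.prems(2)]) auto
  then show ?case
    using C_upto_SucI[OF assms(1) has_derivative_mult[OF C_upto_SucD[OF Suc.prems(1)] C_upto_SucD[OF
        Suc.prems(2)]]]
    by blast
qed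

lemma C_upto_Pair:
  assumes "open U" "C_upto n U f" "C_upto n U g"
  shows "C_upto n U (\<lambda>x. (f x :: real, g x :: real))"
proof -
  have "C_upto n U (\<lambda>x. (f x, 0 :: real) + (0 :: real, g x))"
    using assms by (intro C_upto_add C_upto_linear[of U "\<lambda>t. (t, 0)"] C_upto_linear[of U "\<lambda>t. (0,
        t)"])
      (auto intro!: bounded_linear_intros)
  then show ?thesis by simp
qed

lemma C_upto_fst_snd:
  assumes "open U" "C_upto n U f"
  shows "C_upto n U (\<lambda>x. fst (f x :: real \<times> real))" "C_upto n U (\<lambda>x. snd (f x))"
  using assms by (auto intro: C_upto_linear bounded_linear_fst bounded_linear_snd)

lemma frechet_partials:
  assumes "f differentiable (at p)"
  shows "frechet_derivative f (at p) v = fst v * partial1 f p + snd v * partial2 f p"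
proof -
  interpret l: linear "frechet_derivative f (at p)" using assms by (rule linear_frechet_derivative)
  have "v = fst v *\<^sub>R (1, 0) + snd v *\<^sub>R (0, 1)" by (simp add: prod_eq_iff)
  then have "frechet_derivative f (at p) v = frechet_derivative f (at p) (fst v *\<^sub>R (1, 0) + snd v
      *\<^sub>R (0, 1))" by simp
  then show ?thesis by (simp only: l.add l.scaleR partial1_def partial2_def real_scaleR_def)
qed

text \<open>The derivative of the composition is a sum of products of functions of the same kind, with one
  order of smoothness less.\<close>

lemma C_upto_compose:
  fixes f :: "real \<times> real \<Rightarrow> real" and \<phi> :: "'a::real_normed_vector \<Rightarrow> real \<times> real"
  assumes "open U" "open W" "\<phi> ` U \<subseteq> W" "C_upto n W f" "C_upto n U \<phi>"
  shows "C_upto n U (\<lambda>x. f (\<phi> x))"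
  using assms(4,5)
proof (induction n arbitrary: f)
  case 0
  then show ?case using assms(3) continuous_on_compose2[of W f U \<phi>] by simp
next
  case (Suc n)
  let ?D = "\<lambda>x v. fst (frechet_derivative \<phi> (at x) v) * partial1 f (\<phi> x) + snd (frechet_derivative \<phi>
      (at x) v) * partial2 f (\<phi> x)"
  have der: "((\<lambda>x. f (\<phi> x)) has_derivative ?D x) (at x)" if x: "x \<in> U" for x
  proof -
    have "\<phi> x \<in> W" using x assms(3) by blast
    then have df: "f differentiable (at (\<phi> x))" using Suc.prems(1) by simp
    have "(f \<circ> \<phi> has_derivative (frechet_derivative f (at (\<phi> x)) \<circ> frechet_derivative \<phi> (at x))) (at
        x)"
      using C_upto_SucD[OF Suc.prems(2) x] C_upto_SucD[OF Suc.prems(1) \<open>\<phi> x \<in> W\<close>]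
          by (rule diff_chain_at)
    moreover have "frechet_derivative f (at (\<phi> x)) \<circ> frechet_derivative \<phi> (at x) = ?D x"
      by (rule ext) (simp add: frechet_partials[OF df])
    ultimately show ?thesis by (simp add: o_def)
  qed
  have "C_upto n U (\<lambda>x. ?D x v)" for v
  proof -
    have p: "C_upto n W (partial1 f)" "C_upto n W (partial2 f)" using Suc.prems(1)
        by (simp_all add: partial1_def partial2_def)
    have "C_upto n U (\<lambda>x. frechet_derivative \<phi> (at x) v)" using Suc.prems(2) by simp
    then show ?thesis
      using Suc.IH[OF p(1) C_upto_Suc_imp[OF Suc.prems(2)]] Suc.IH[OF p(2) C_upto_Suc_imp[OF
          Suc.prems(2)]]
      by (intro C_upto_add C_upto_mult assms(1) C_upto_fst_snd)
  qed
  then show ?case using C_upto_SucI[of U "\<lambda>x. f (\<phi> x)" ?D] assms(1) der by blast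
qed

subsection \<open>Partial derivatives\<close>

lemma smooth_on_differentiable: "smooth_on U f \<Longrightarrow> x \<in> U \<Longrightarrow> f differentiable (at x)"
  unfolding smooth_on_def by (metis C_upto.simps(2))

lemma smooth_on_partial: "smooth_on U f \<Longrightarrow> smooth_on U (partial1 f)" "smooth_on U f
    \<Longrightarrow> smooth_on U (partial2 f)"
  unfolding smooth_on_def partial1_def partial2_def by (metis C_upto.simps(2))+

lemma smooth_on_continuous: "smooth_on U f \<Longrightarrow> continuous_on U f"
  unfolding smooth_on_def by (metis C_upto.simps(1))

lemma DERIV_partial1:
  assumes "g differentiable (at (s, y))"
  shows "((\<lambda>s. g (s, y)) has_real_derivative partial1 g (s, y)) (at s)"
proof -
  have "((\<lambda>s. (s, y)) has_derivative (\<lambda>h. (h, 0))) (at s)" by (auto intro!: derivative_eq_intros)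
  from diff_chain_at[OF this frechet_derivative_works[THEN iffD1, OF assms]]
  show ?thesis by (simp add: o_def has_field_derivative_def frechet_partials[OF assms]
      mult_commute_abs)
qed

lemma DERIV_partial2:
  assumes "g differentiable (at (s, y))"
  shows "((\<lambda>y. g (s, y)) has_real_derivative partial2 g (s, y)) (at y)"
proof -
  have "((\<lambda>y. (s, y)) has_derivative (\<lambda>h. (0, h))) (at y)" by (auto intro!: derivative_eq_intros)
  from diff_chain_at[OF this frechet_derivative_works[THEN iffD1, OF assms]]
  show ?thesis by (simp add: o_def has_field_derivative_def frechet_partials[OF assms]
      mult_commute_abs)
qed

text \<open>The mean value theorem, once in each variable.\<close>

lemma second_difference:
  fixes G :: "real \<Rightarrow> real \<Rightarrow> real"
  assumes t: "0 < t"
    and 1: "\<And>s y. s \<in> {a..a+t} \<Longrightarrow> y \<in> {b..b+t} \<Longrightarrow> ((\<lambda>s. G s y) has_real_derivative G1 s y) (at s)"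
    and 2: "\<And>s y. s \<in> {a..a+t} \<Longrightarrow> y \<in> {b..b+t} \<Longrightarrow> ((\<lambda>y. G1 s y) has_real_derivative G2 s y) (at y)"
  obtains \<xi> \<eta> where "\<xi> \<in> {a..a+t}" "\<eta> \<in> {b..b+t}"
    "G (a+t) (b+t) - G (a+t) b - G a (b+t) + G a b = t * t * G2 \<xi> \<eta>"
proof -
  have "\<exists>z>a. z < a + t \<and> (G (a+t) (b+t) - G (a+t) b) - (G a (b+t) - G a b)
      = (a + t - a) * (G1 z (b+t) - G1 z b)"
    by (rule MVT2) (use t in \<open>auto intro!: derivative_intros 1\<close>)
  then obtain \<xi> where \<xi>: "a < \<xi>" "\<xi> < a + t"
    "(G (a+t) (b+t) - G (a+t) b) - (G a (b+t) - G a b) = t * (G1 \<xi> (b+t) - G1 \<xi> b)" by auto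
  have "\<exists>z>b. z < b + t \<and> G1 \<xi> (b+t) - G1 \<xi> b = (b + t - b) * G2 \<xi> z"
    by (rule MVT2) (use t \<xi> in \<open>auto intro!: 2\<close>)
  then obtain \<eta> where "b < \<eta>" "\<eta> < b + t" "G1 \<xi> (b+t) - G1 \<xi> b = t * G2 \<xi> \<eta>" by auto
  then show ?thesis using that[of \<xi> \<eta>] \<xi> by simp
qed

text \<open>Both mixed derivatives occur as values of the same second difference quotient on arbitrarily
  small squares.\<close>

lemma partials_commute:
  assumes "open U" "smooth_on U g" "p \<in> U"
  shows "partial1 (partial2 g) p = partial2 (partial1 g) p"
proof (rule ccontr)
  let ?h = "partial1 (partial2 g)" and ?k = "partial2 (partial1 g)"
  assume ne: "?h p \<noteq> ?k p"
  define e where "e = \<bar>?h p - ?k p\<bar> / 2"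
  have e: "0 < e" using ne by (simp add: e_def)
  have c: "continuous_on U ?h" "continuous_on U ?k"
    using assms(2) by (intro smooth_on_continuous smooth_on_partial; assumption)+
  obtain d1 where d1: "0 < d1" "\<And>q. q \<in> U \<Longrightarrow> dist q p < d1 \<Longrightarrow> dist (?h q) (?h p) < e"
    using c(1) assms(3) e unfolding continuous_on_iff by metis
  obtain d2 where d2: "0 < d2" "\<And>q. q \<in> U \<Longrightarrow> dist q p < d2 \<Longrightarrow> dist (?k q) (?k p) < e"
    using c(2) assms(3) e unfolding continuous_on_iff by metis
  obtain d3 where d3: "0 < d3" "ball p d3 \<subseteq> U" using assms(1,3) by (meson open_contains_ball)
  define t where "t = min d1 (min d2 d3) / 3"
  have t: "0 < t" "3 * t \<le> d1" "3 * t \<le> d2" "3 * t \<le> d3" using d1(1) d2(1) d3(1)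
      by (auto simp: t_def)
  obtain a b where p: "p = (a, b)" by (cases p)
  have near: "dist (s, y) p < 3 * t \<and> (s, y) \<in> U" if "s \<in> {a..a+t}" "y \<in> {b..b+t}" for s y
  proof -
    have "dist (s, y) p \<le> \<bar>s - a\<bar> + \<bar>y - b\<bar>"
      using sqrt_sum_squares_le_sum_abs[of "s - a" "y - b"]
          by (simp add: p dist_prod_def dist_real_def)
    also have "\<dots> < 3 * t" using that t(1) by auto
    finally have "dist (s, y) p < 3 * t" .
    then show ?thesis using d3(2) t(4) by (auto simp: dist_commute subset_iff)
  qed
  have diff: "g differentiable (at q)" "partial1 g differentiable (at q)" "partial2 g differentiable
      (at q)" if "q \<in> U" for q
    using that assms(2) smooth_on_partial smooth_on_differentiable by blast+
  obtain \<xi> \<eta> where 1: "\<xi> \<in> {a..a+t}" "\<eta> \<in> {b..b+t}"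
    "g (a+t, b+t) - g (a+t, b) - g (a, b+t) + g (a, b) = t * t * ?k (\<xi>, \<eta>)"
    by (rule second_difference[OF t(1), of a b "\<lambda>s y. g (s, y)" "\<lambda>s y. partial1 g (s, y)" "\<lambda>s y. ?k
        (s, y)"])
      (use near diff in \<open>auto intro: DERIV_partial1 DERIV_partial2\<close>)
  obtain \<eta>' \<xi>' where 2: "\<eta>' \<in> {b..b+t}" "\<xi>' \<in> {a..a+t}"
    "g (a+t, b+t) - g (a, b+t) - g (a+t, b) + g (a, b) = t * t * ?h (\<xi>', \<eta>')"
    by (rule second_difference[OF t(1), of b a "\<lambda>y s. g (s, y)" "\<lambda>y s. partial2 g (s, y)" "\<lambda>y s. ?h
        (s, y)"])
      (use near diff in \<open>auto intro: DERIV_partial1 DERIV_partial2\<close>)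
  have "t * t * ?h (\<xi>', \<eta>') = t * t * ?k (\<xi>, \<eta>)" using 1(3) 2(3) by linarith
  then have eq: "?h (\<xi>', \<eta>') = ?k (\<xi>, \<eta>)" using t(1) by simp
  have "dist (?h (\<xi>', \<eta>')) (?h p) < e" using near[OF 2(2,1)] t by (intro d1(2)) auto
  moreover have "dist (?k (\<xi>, \<eta>)) (?k p) < e" using near[OF 1(1,2)] t by (intro d2(2)) auto
  ultimately have "\<bar>?h p - ?k p\<bar> < 2 * e" unfolding eq dist_real_def by linarith
  then show False by (simp add: e_def)
qed

lemma partial_cong:
  assumes "open U" "\<And>x. x \<in> U \<Longrightarrow> f x = g x" "f differentiable (at p)" "p \<in> U"
  shows "partial1 f p = partial1 g p" "partial2 f p = partial2 g p"
proof -
  have "frechet_derivative f (at p) = frechet_derivative g (at p)"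
    by (rule frechet_derivative_transform_within_open[OF assms(3,1,4)]) (rule assms(2))
  then show "partial1 f p = partial1 g p" "partial2 f p = partial2 g p"
      by (simp_all add: partial1_def partial2_def)
qed

section \<open>Taylor series\<close>

definition germ_eq :: "(real \<times> real \<Rightarrow> real) \<Rightarrow> (real \<times> real \<Rightarrow> real) \<Rightarrow> bool" where
  "germ_eq f g \<longleftrightarrow> (\<exists>U. open U \<and> 0 \<in> U \<and> (\<forall>x\<in>U. f x = g x))"

lemma germ_eqI: "open U \<Longrightarrow> 0 \<in> U \<Longrightarrow> (\<And>x. x \<in> U \<Longrightarrow> f x = g x) \<Longrightarrow> germ_eq f g"
  unfolding germ_eq_def by blast

lemma germ_eq_0: "germ_eq f g \<Longrightarrow> f 0 = g 0"
  unfolding germ_eq_def by blast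

lemma smooth_on_subset: "smooth_on U f \<Longrightarrow> V \<subseteq> U \<Longrightarrow> smooth_on V f"
  unfolding smooth_on_def using C_upto_subset by blast

lemma smooth_near_0_partial:
  "smooth_near_0 f \<Longrightarrow> smooth_near_0 (partial1 f)" "smooth_near_0 f \<Longrightarrow> smooth_near_0 (partial2 f)"
  unfolding smooth_near_0_def using smooth_on_partial by blast+

lemma smooth_near_0_common:
  assumes "smooth_near_0 f" "smooth_near_0 g"
  obtains U where "open U" "0 \<in> U" "smooth_on U f" "smooth_on U g"
proof -
  obtain U V where "open U" "0 \<in> U" "smooth_on U f" "open V" "0 \<in> V" "smooth_on V g"
    using assms unfolding smooth_near_0_def by blast
  then show ?thesis using smooth_on_subset[of U f "U \<inter> V"] smooth_on_subset[of V g "U \<inter> V"]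
    by (intro that[of "U \<inter> V"]) (simp_all add: open_Int)
qed

lemma smooth_near_0_add:
  assumes "smooth_near_0 f" "smooth_near_0 g" shows "smooth_near_0 (\<lambda>x. f x + g x)"
proof -
  obtain U where U: "open U" "0 \<in> U" "smooth_on U f" "smooth_on U g"
      by (rule smooth_near_0_common[OF assms])
  then have "smooth_on U (\<lambda>x. f x + g x)" unfolding smooth_on_def by (auto intro: C_upto_add)
  then show ?thesis using U unfolding smooth_near_0_def by blast
qed

lemma smooth_near_0_mult:
  fixes f g :: "'a::real_normed_vector \<Rightarrow> real"
  assumes "smooth_near_0 f" "smooth_near_0 g" shows "smooth_near_0 (\<lambda>x. f x * g x)"
proof -
  obtain U where U: "open U" "0 \<in> U" "smooth_on U f" "smooth_on U g"
      by (rule smooth_near_0_common[OF assms])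
  then have "smooth_on U (\<lambda>x. f x * g x)" unfolding smooth_on_def by (auto intro: C_upto_mult)
  then show ?thesis using U unfolding smooth_near_0_def by blast
qed

lemma smooth_near_0_fst_snd:
  assumes "smooth_near_0 \<phi>"
  shows "smooth_near_0 (\<lambda>x. fst (\<phi> x :: real \<times> real))" "smooth_near_0 (\<lambda>x. snd (\<phi> x))"
proof -
  obtain U where U: "open U" "0 \<in> U" "smooth_on U \<phi>" using assms unfolding smooth_near_0_def
      by blast
  have "smooth_on U (\<lambda>x. fst (\<phi> x))" "smooth_on U (\<lambda>x. snd (\<phi> x))"
    using C_upto_fst_snd[OF U(1)] U(3) unfolding smooth_on_def by simp_all
  then show "smooth_near_0 (\<lambda>x. fst (\<phi> x))" "smooth_near_0 (\<lambda>x. snd (\<phi> x))"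
    using U(1,2) unfolding smooth_near_0_def by blast+
qed

lemma smooth_near_0_compose:
  fixes f :: "real \<times> real \<Rightarrow> real" and \<phi> :: "'a::real_normed_vector \<Rightarrow> real \<times> real"
  assumes "smooth_near_0 f" "smooth_near_0 \<phi>" "\<phi> 0 = 0"
  obtains U W where "open U" "0 \<in> U" "open W" "0 \<in> W" "\<phi> ` U \<subseteq> W" "smooth_on W f" "smooth_on U \<phi>"
      "smooth_on U (\<lambda>x. f (\<phi> x))"
proof -
  obtain W where W: "open W" "0 \<in> W" "smooth_on W f" using assms(1) unfolding smooth_near_0_def
      by blast
  obtain V where V: "open V" "0 \<in> V" "smooth_on V \<phi>" using assms(2) unfolding smooth_near_0_def
      by blast
  define U where "U = V \<inter> \<phi> -` W"
  have "open U" unfolding U_def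
    using continuous_open_preimage[OF smooth_on_continuous[OF V(3)] V(1) W(1)] .
  moreover have "0 \<in> U" using V W assms(3) by (simp add: U_def)
  moreover have im: "\<phi> ` U \<subseteq> W" by (auto simp: U_def)
  moreover have s: "smooth_on U \<phi>" using V(3) by (rule smooth_on_subset) (auto simp: U_def)
  moreover have "smooth_on U (\<lambda>x. f (\<phi> x))"
    using C_upto_compose[OF \<open>open U\<close> W(1) im] W(3) s unfolding smooth_on_def by blast
  ultimately show ?thesis using that W by blast
qed

lemma germ_eq_partial:
  assumes "smooth_near_0 f" "germ_eq f g"
  shows "germ_eq (partial1 f) (partial1 g)" "germ_eq (partial2 f) (partial2 g)"
proof -
  obtain U V where U: "open U" "0 \<in> U" "smooth_on U f"
      and V: "open V" "0 \<in> V" "\<And>x. x \<in> V \<Longrightarrow> f x = g x"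
    using assms unfolding smooth_near_0_def germ_eq_def by blast
  have o: "open (U \<inter> V)" "0 \<in> U \<inter> V" using U V by (simp_all add: open_Int)
  have d: "f differentiable (at x)" if "x \<in> U \<inter> V" for x
    using smooth_on_differentiable[OF U(3)] that by blast
  show "germ_eq (partial1 f) (partial1 g)"
    by (rule germ_eqI[OF o], rule partial_cong(1)[OF V(1)]) (simp_all add: V(3) d)
  show "germ_eq (partial2 f) (partial2 g)"
    by (rule germ_eqI[OF o], rule partial_cong(2)[OF V(1)]) (simp_all add: V(3) d)
qed

lemma smooth_iterate_partial2: "smooth_near_0 f \<Longrightarrow> smooth_near_0 ((partial2 ^^ k) f)"
  by (induction k) (auto intro: smooth_near_0_partial)

lemma taylor_nth: "taylor f $ j $ k = (partial1 ^^ j) ((partial2 ^^ k) f) 0 / (fact j * fact k)"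
  by (simp add: taylor_def taylor_coeff_def)

lemma germ_eq_iterate1:
  assumes "smooth_near_0 f" "germ_eq f g"
  shows "germ_eq ((partial1 ^^ j) f) ((partial1 ^^ j) g) \<and> smooth_near_0 ((partial1 ^^ j) f)"
  by (induction j) (simp_all add: assms germ_eq_partial smooth_near_0_partial)

lemma germ_eq_iterate2:
  assumes "smooth_near_0 f" "germ_eq f g"
  shows "germ_eq ((partial2 ^^ j) f) ((partial2 ^^ j) g) \<and> smooth_near_0 ((partial2 ^^ j) f)"
  by (induction j) (simp_all add: assms germ_eq_partial smooth_near_0_partial)

lemma taylor_cong:
  assumes "smooth_near_0 f" "germ_eq f g"
  shows "taylor f = taylor g"
proof (intro fps2_eqI)
  fix j k
  have "germ_eq ((partial2 ^^ k) f) ((partial2 ^^ k) g)" "smooth_near_0 ((partial2 ^^ k) f)"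
    using germ_eq_iterate2[OF assms] by blast+
  then have "germ_eq ((partial1 ^^ j) ((partial2 ^^ k) f)) ((partial1 ^^ j) ((partial2 ^^ k) g))"
    using germ_eq_iterate1 by blast
  then show "taylor f $ j $ k = taylor g $ j $ k" by (simp add: taylor_nth germ_eq_0)
qed

lemma taylor_0_0: "taylor f $ 0 $ 0 = f 0"
  by (simp add: taylor_nth)

lemma taylor_partial2: "taylor (partial2 f) = D2 (taylor f)"
proof (intro fps2_eqI)
  fix j k
  have "(partial2 ^^ k) (partial2 f) = (partial2 ^^ Suc k) f" by (simp only: funpow_Suc_right o_def)
  then show "taylor (partial2 f) $ j $ k = D2 (taylor f) $ j $ k"
    unfolding D2_nth taylor_nth fact_Suc by (simp del: of_nat_Suc funpow.simps)
qed

lemma germ_eq_trans: "germ_eq f g \<Longrightarrow> germ_eq g h \<Longrightarrow> germ_eq f h"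
  unfolding germ_eq_def by (metis Int_iff open_Int)

lemma germ_eq_commute:
  assumes "smooth_near_0 f"
  shows "germ_eq (partial1 ((partial2 ^^ k) f)) ((partial2 ^^ k) (partial1 f))"
proof (induction k)
  case 0
  show ?case by (auto intro: germ_eqI[of UNIV])
next
  case (Suc k)
  let ?g = "(partial2 ^^ k) f"
  have s: "smooth_near_0 ?g" using assms by (rule smooth_iterate_partial2)
  then obtain U where U: "open U" "0 \<in> U" "smooth_on U ?g" unfolding smooth_near_0_def by blast
  have "germ_eq (partial1 (partial2 ?g)) (partial2 (partial1 ?g))"
    by (rule germ_eqI[OF U(1,2)]) (rule partials_commute[OF U(1,3)])
  also have "germ_eq (partial2 (partial1 ?g)) (partial2 ((partial2 ^^ k) (partial1 f)))"
    by (rule germ_eq_partial(2)[OF smooth_near_0_partial(1)[OF s] Suc])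
  finally (germ_eq_trans) show ?case by simp
qed

text \<open>The Taylor coefficients are defined with the \<open>x\<^sub>2\<close>-derivatives taken first, so this is where
  mixed derivatives must commute.\<close>

lemma taylor_partial1:
  assumes "smooth_near_0 f"
  shows "taylor (partial1 f) = D1 (taylor f)"
proof (intro fps2_eqI)
  fix j k
  have s: "smooth_near_0 (partial1 ((partial2 ^^ k) f))"
    using assms by (intro smooth_near_0_partial smooth_iterate_partial2)
  have "(partial1 ^^ Suc j) ((partial2 ^^ k) f) 0
      = (partial1 ^^ j) (partial1 ((partial2 ^^ k) f)) 0"
    by (simp only: funpow_Suc_right o_def)
  also have "\<dots> = (partial1 ^^ j) ((partial2 ^^ k) (partial1 f)) 0"
    using germ_eq_iterate1[OF s germ_eq_commute[OF assms]] germ_eq_0 by blast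
  finally show "taylor (partial1 f) $ j $ k = D1 (taylor f) $ j $ k"
    unfolding D1_nth taylor_nth fact_Suc by (simp del: of_nat_Suc funpow.simps)
qed

lemma taylor_agreeI:
  assumes "smooth_near_0 f" "f 0 = A $ 0 $ 0" "agree N (taylor (partial1 f)) (D1 A)" "agree N
      (taylor (partial2 f)) (D2 A)"
  shows "agree (Suc N) (taylor f) A"
  using assms by (intro agree_SucI) (simp_all add: taylor_0_0 taylor_partial1 taylor_partial2)

lemma partial_of_has_derivative:
  "(f has_derivative f') (at p) \<Longrightarrow> partial1 f p = f' (1, 0)"
  "(f has_derivative f') (at p) \<Longrightarrow> partial2 f p = f' (0, 1)"
  unfolding partial1_def partial2_def using frechet_derivative_at by metis+

lemma D2_add: "D2 (A + B) = D2 A + D2 B"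
  using derivation_D2 by (simp add: derivation_def)

lemma germ_partials_add:
  assumes "smooth_near_0 f" "smooth_near_0 g"
  shows "germ_eq (\<lambda>x. partial1 f x + partial1 g x) (partial1 (\<lambda>x. f x + g x))"
    "germ_eq (\<lambda>x. partial2 f x + partial2 g x) (partial2 (\<lambda>x. f x + g x))"
proof -
  obtain U where U: "open U" "0 \<in> U" "smooth_on U f" "smooth_on U g"
      by (rule smooth_near_0_common[OF assms])
  have d: "((\<lambda>x. f x + g x) has_derivative (\<lambda>v. frechet_derivative f (at x) v + frechet_derivative g
      (at x) v)) (at x)" if "x \<in> U" for x
    using smooth_on_differentiable[OF U(3) that] smooth_on_differentiable[OF U(4) that]
        unfolding frechet_derivative_works
    by (rule has_derivative_add)
  show "germ_eq (\<lambda>x. partial1 f x + partial1 g x) (partial1 (\<lambda>x. f x + g x))"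
    by (rule germ_eqI[OF U(1,2)]) (subst partial_of_has_derivative(1)[OF d], assumption, simp add:
        partial1_def)
  show "germ_eq (\<lambda>x. partial2 f x + partial2 g x) (partial2 (\<lambda>x. f x + g x))"
    by (rule germ_eqI[OF U(1,2)]) (subst partial_of_has_derivative(2)[OF d], assumption, simp add:
        partial2_def)
qed

lemma taylor_add:
  assumes "smooth_near_0 f" "smooth_near_0 g"
  shows "taylor (\<lambda>x. f x + g x) = taylor f + taylor g"
proof (rule agree_all)
  fix N
  show "agree N (taylor (\<lambda>x. f x + g x)) (taylor f + taylor g)"
    using assms
  proof (induction N arbitrary: f g)
    case 0
    then show ?case by (simp add: agree_def taylor_0_0)
  next
    case (Suc N)
    note p = smooth_near_0_partial
    show ?case
    proof (rule taylor_agreeI[OF smooth_near_0_add[OF Suc.prems]])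
      show "agree N (taylor (partial1 (\<lambda>x. f x + g x))) (D1 (taylor f + taylor g))"
        using Suc.IH[OF p(1)[OF Suc.prems(1)] p(1)[OF Suc.prems(2)]]
          taylor_cong[OF smooth_near_0_add germ_partials_add(1)[OF Suc.prems]] p Suc.prems
        by (simp add: taylor_partial1)
      show "agree N (taylor (partial2 (\<lambda>x. f x + g x))) (D2 (taylor f + taylor g))"
        using Suc.IH[OF p(2)[OF Suc.prems(1)] p(2)[OF Suc.prems(2)]]
          taylor_cong[OF smooth_near_0_add germ_partials_add(2)[OF Suc.prems]] p Suc.prems
        by (simp add: taylor_partial2 D2_add)
    qed (simp add: taylor_0_0)
  qed
qed

lemma germ_partials_mult:
  assumes "smooth_near_0 f" "smooth_near_0 g"
  shows "germ_eq (\<lambda>x. f x * partial1 g x + partial1 f x * g x) (partial1 (\<lambda>x. f x * g x))"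
    "germ_eq (\<lambda>x. f x * partial2 g x + partial2 f x * g x) (partial2 (\<lambda>x. f x * g x))"
proof -
  obtain U where U: "open U" "0 \<in> U" "smooth_on U f" "smooth_on U g"
      by (rule smooth_near_0_common[OF assms])
  have d: "((\<lambda>x. f x * g x) has_derivative (\<lambda>v. f x * frechet_derivative g (at x) v +
      frechet_derivative f (at x) v * g x)) (at x)" if "x \<in> U" for x
    using smooth_on_differentiable[OF U(3) that] smooth_on_differentiable[OF U(4) that]
        unfolding frechet_derivative_works
    by (rule has_derivative_mult)
  show "germ_eq (\<lambda>x. f x * partial1 g x + partial1 f x * g x) (partial1 (\<lambda>x. f x * g x))"
    by (rule germ_eqI[OF U(1,2)]) (subst partial_of_has_derivative(1)[OF d], assumption, simp add:
        partial1_def)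
  show "germ_eq (\<lambda>x. f x * partial2 g x + partial2 f x * g x) (partial2 (\<lambda>x. f x * g x))"
    by (rule germ_eqI[OF U(1,2)]) (subst partial_of_has_derivative(2)[OF d], assumption, simp add:
        partial2_def)
qed

lemma taylor_mult:
  assumes "smooth_near_0 f" "smooth_near_0 g"
  shows "taylor (\<lambda>x. f x * g x) = taylor f * taylor g"
proof (rule agree_all)
  fix N
  show "agree N (taylor (\<lambda>x. f x * g x)) (taylor f * taylor g)"
    using assms
  proof (induction N arbitrary: f g)
    case 0
    then show ?case by (simp add: agree_def taylor_0_0 mult_0_0)
  next
    case (Suc N)
    note p = smooth_near_0_partial
    note s = Suc.prems p[OF Suc.prems(1)] p[OF Suc.prems(2)]
    show ?case
    proof (rule taylor_agreeI[OF smooth_near_0_mult[OF Suc.prems]])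
      have "taylor (partial1 (\<lambda>x. f x * g x)) = taylor (\<lambda>x. f x * partial1 g x) + taylor (\<lambda>x.
          partial1 f x * g x)"
        using taylor_cong[OF _ germ_partials_mult(1)[OF Suc.prems]] s
        by (simp add: smooth_near_0_add smooth_near_0_mult taylor_add)
      then show "agree N (taylor (partial1 (\<lambda>x. f x * g x))) (D1 (taylor f * taylor g))"
        using agree_add[OF Suc.IH[of f "partial1 g"] Suc.IH[of "partial1 f" g]] s
        by (simp add: taylor_partial1)
      have "taylor (partial2 (\<lambda>x. f x * g x)) = taylor (\<lambda>x. f x * partial2 g x) + taylor (\<lambda>x.
          partial2 f x * g x)"
        using taylor_cong[OF _ germ_partials_mult(2)[OF Suc.prems]] s
        by (simp add: smooth_near_0_add smooth_near_0_mult taylor_add)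
      then show "agree N (taylor (partial2 (\<lambda>x. f x * g x))) (D2 (taylor f * taylor g))"
        using agree_add[OF Suc.IH[of f "partial2 g"] Suc.IH[of "partial2 f" g]] s
        by (simp add: taylor_partial2 D2_mult)
    qed (simp add: taylor_0_0 mult_0_0)
  qed
qed

lemma germ_partials_compose:
  fixes f :: "real \<times> real \<Rightarrow> real" and \<phi> :: "real \<times> real \<Rightarrow> real \<times> real"
  assumes "smooth_near_0 f" "smooth_near_0 \<phi>" "\<phi> 0 = 0"
  shows "germ_eq (\<lambda>x. partial1 f (\<phi> x) * partial1 (\<lambda>x. fst (\<phi> x)) x + partial2 f (\<phi> x) * partial1
      (\<lambda>x. snd (\<phi> x)) x)
      (partial1 (\<lambda>x. f (\<phi> x)))"
    and "germ_eq (\<lambda>x. partial1 f (\<phi> x) * partial2 (\<lambda>x. fst (\<phi> x)) x + partial2 f (\<phi> x) * partial2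
        (\<lambda>x. snd (\<phi> x)) x)
      (partial2 (\<lambda>x. f (\<phi> x)))"
proof -
  obtain U W where U: "open U" "0 \<in> U" "open W" "0 \<in> W" "\<phi> ` U \<subseteq> W" "smooth_on W f" "smooth_on U \<phi>"
    by (rule smooth_near_0_compose[OF assms])
  have *: "partial1 (\<lambda>x. f (\<phi> x)) x = partial1 f (\<phi> x) * partial1 (\<lambda>x. fst (\<phi> x)) x + partial2 f (\<phi>
      x) * partial1 (\<lambda>x. snd (\<phi> x)) x
     \<and> partial2 (\<lambda>x. f (\<phi> x)) x = partial1 f (\<phi> x) * partial2 (\<lambda>x. fst (\<phi> x)) x + partial2 f (\<phi> x) *
         partial2 (\<lambda>x. snd (\<phi> x)) x"
    if x: "x \<in> U" for x
  proof -
    let ?D = "frechet_derivative \<phi> (at x)"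
    have d\<phi>: "(\<phi> has_derivative ?D) (at x)" using smooth_on_differentiable[OF U(7) x]
        by (simp add: frechet_derivative_works)
    have "\<phi> x \<in> W" using x U(5) by blast
    then have df: "f differentiable (at (\<phi> x))" by (rule smooth_on_differentiable[OF U(6)])
    have "((\<lambda>x. f (\<phi> x)) has_derivative (\<lambda>v. frechet_derivative f (at (\<phi> x)) (?D v))) (at x)"
      using diff_chain_at[OF d\<phi> frechet_derivative_works[THEN iffD1, OF df]] by (simp add: o_def)
    note c = partial_of_has_derivative[OF this]
    have "((\<lambda>x. fst (\<phi> x)) has_derivative (\<lambda>v. fst (?D v))) (at x)" using d\<phi>
        by (rule has_derivative_fst)
    note c1 = partial_of_has_derivative[OF this]
    have "((\<lambda>x. snd (\<phi> x)) has_derivative (\<lambda>v. snd (?D v))) (at x)" using d\<phi>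
        by (rule has_derivative_snd)
    note c2 = partial_of_has_derivative[OF this]
    show ?thesis by (simp add: c c1 c2 frechet_partials[OF df] mult.commute)
  qed
  show "germ_eq (\<lambda>x. partial1 f (\<phi> x) * partial1 (\<lambda>x. fst (\<phi> x)) x + partial2 f (\<phi> x) * partial1
      (\<lambda>x. snd (\<phi> x)) x)
      (partial1 (\<lambda>x. f (\<phi> x)))"
    by (rule germ_eqI[OF U(1,2)]) (simp add: *)
  show "germ_eq (\<lambda>x. partial1 f (\<phi> x) * partial2 (\<lambda>x. fst (\<phi> x)) x + partial2 f (\<phi> x) * partial2
      (\<lambda>x. snd (\<phi> x)) x)
      (partial2 (\<lambda>x. f (\<phi> x)))"
    by (rule germ_eqI[OF U(1,2)]) (simp add: *)
qed

lemma smooth_near_0_comp: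
  fixes f :: "real \<times> real \<Rightarrow> real" and \<phi> :: "'a::real_normed_vector \<Rightarrow> real \<times> real"
  assumes "smooth_near_0 f" "smooth_near_0 \<phi>" "\<phi> 0 = 0"
  shows "smooth_near_0 (\<lambda>x. f (\<phi> x))"
  by (rule smooth_near_0_compose[OF assms]) (unfold smooth_near_0_def, blast)

text \<open>The smooth and the formal chain rule have the same shape, so the two sides have the same
  derivatives up to lower order.\<close>

theorem taylor_compose:
  fixes f :: "real \<times> real \<Rightarrow> real" and \<phi> :: "real \<times> real \<Rightarrow> real \<times> real"
  assumes f: "smooth_near_0 f" and \<phi>: "smooth_near_0 \<phi>" "\<phi> 0 = 0"
  shows "taylor (\<lambda>x. f (\<phi> x)) = fps2_compose (taylor f) (taylor (\<lambda>x. fst (\<phi> x))) (taylor (\<lambda>x. snd (\<phi>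
      x)))"
proof (rule agree_all)
  fix N
  let ?A = "taylor (\<lambda>x. fst (\<phi> x))" and ?B = "taylor (\<lambda>x. snd (\<phi> x))"
  have AB: "?A $ 0 $ 0 = 0" "?B $ 0 $ 0 = 0" using \<phi>(2) by (simp_all add: taylor_0_0)
  have s\<phi>: "smooth_near_0 (\<lambda>x. fst (\<phi> x))" "smooth_near_0 (\<lambda>x. snd (\<phi> x))"
      by (rule smooth_near_0_fst_snd[OF \<phi>(1)])+
  note p = smooth_near_0_partial
  show "agree N (taylor (\<lambda>x. f (\<phi> x))) (fps2_compose (taylor f) ?A ?B)"
    using f
  proof (induction N arbitrary: f)
    case 0
    then show ?case using \<phi>(2) by (simp add: agree_def taylor_0_0 comp_0_0)
  next
    case (Suc N)
    note c = smooth_near_0_comp[OF p(1)[OF Suc.prems] \<phi>] smooth_near_0_comp[OF p(2)[OF Suc.prems] \<phi>]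
    note ih = Suc.IH[OF p(1)[OF Suc.prems]] Suc.IH[OF p(2)[OF Suc.prems]]
    show ?case
    proof (rule taylor_agreeI[OF smooth_near_0_comp[OF Suc.prems \<phi>]])
      have "taylor (partial1 (\<lambda>x. f (\<phi> x))) = taylor (\<lambda>x. partial1 f (\<phi> x)) * D1 ?A + taylor (\<lambda>x.
          partial2 f (\<phi> x)) * D1 ?B"
        using taylor_cong[OF _ germ_partials_compose(1)[OF Suc.prems \<phi>]] s\<phi> c p
        by (simp add: smooth_near_0_add smooth_near_0_mult taylor_add taylor_mult taylor_partial1)
      then show "agree N (taylor (partial1 (\<lambda>x. f (\<phi> x)))) (D1 (fps2_compose (taylor f) ?A ?B))"
        using agree_add[OF agree_mult[OF ih(1) agree_refl[of _ "D1 ?A"]] agree_mult[OF ih(2)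
            agree_refl[of _ "D1 ?B"]]]
        by (simp add: comp_chain[OF derivation_D1 AB] taylor_partial1[OF Suc.prems] taylor_partial2)
      have "taylor (partial2 (\<lambda>x. f (\<phi> x))) = taylor (\<lambda>x. partial1 f (\<phi> x)) * D2 ?A + taylor (\<lambda>x.
          partial2 f (\<phi> x)) * D2 ?B"
        using taylor_cong[OF _ germ_partials_compose(2)[OF Suc.prems \<phi>]] s\<phi> c p
        by (simp add: smooth_near_0_add smooth_near_0_mult taylor_add taylor_mult taylor_partial2)
      then show "agree N (taylor (partial2 (\<lambda>x. f (\<phi> x)))) (D2 (fps2_compose (taylor f) ?A ?B))"
        using agree_add[OF agree_mult[OF ih(1) agree_refl[of _ "D2 ?A"]] agree_mult[OF ih(2)
            agree_refl[of _ "D2 ?B"]]]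
        by (simp add: comp_chain[OF derivation_D2 AB] taylor_partial1[OF Suc.prems] taylor_partial2)
    qed (simp add: comp_0_0 taylor_0_0 \<phi>(2))
  qed
qed

section \<open>Local coordinates and the height\<close>

text \<open>\<open>D n\<close> is the \<open>n\<close>-th derivative of \<open>D 0\<close>. Carrying all derivatives along makes smoothness and
  Taylor coefficients immediate.\<close>

definition tower :: "(nat \<Rightarrow> real \<Rightarrow> real) \<Rightarrow> bool" where
  "tower D \<longleftrightarrow> (\<forall>n x. (D n has_real_derivative D (Suc n) x) (at x))"

lemma tower_continuous: "tower D \<Longrightarrow> continuous_on UNIV (D n)"
  unfolding tower_def by (meson DERIV_continuous continuous_at_imp_continuous_on)

lemma C_upto_tower: "tower D \<Longrightarrow> C_upto n UNIV (D m)"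
proof (induction n arbitrary: m)
  case 0
  then show ?case by (simp add: tower_continuous)
next
  case (Suc n)
  have "(D m has_derivative (\<lambda>v. D (Suc m) x * v)) (at x)" for x
    using Suc.prems unfolding tower_def has_field_derivative_def by blast
  moreover have "C_upto n UNIV (\<lambda>x. D (Suc m) x * v)" for v
    using Suc by (intro C_upto_mult C_upto_const) auto
  ultimately show ?case by (intro C_upto_SucI) auto
qed

lemma tower_smooth: "tower D \<Longrightarrow> smooth_near_0 (D 0)"
  unfolding smooth_near_0_def smooth_on_def using C_upto_tower by (intro exI[of _ UNIV]) auto

lemma has_derivative_tower_fst:
  assumes "tower D"
  shows "((\<lambda>p. D m (fst p)) has_derivative (\<lambda>v. D (Suc m) (fst p) * fst v)) (at (p :: real \<times> real))"
proof -
  have "(D m has_derivative (\<lambda>v. D (Suc m) (fst p) * v)) (at (fst p))"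
    using assms unfolding tower_def has_field_derivative_def by blast
  from has_derivative_compose[OF has_derivative_fst[OF has_derivative_ident] this] show ?thesis .
qed

lemma C_upto_tower_fst: "tower D \<Longrightarrow> C_upto n UNIV (\<lambda>p :: real \<times> real. D m (fst p))"
proof (induction n arbitrary: m)
  case 0
  then have "continuous_on UNIV (\<lambda>p :: real \<times> real. D m (fst p))"
    using continuous_on_compose2[OF tower_continuous[OF 0] continuous_on_fst[OF continuous_on_id]]
        by auto
  then show ?case by simp
next
  case (Suc n)
  have "C_upto n UNIV (\<lambda>x :: real \<times> real. D (Suc m) (fst x) * fst v)" for v :: "real \<times> real"
    using Suc by (intro C_upto_mult C_upto_const) auto
  then show ?case by (rule C_upto_SucI[OF open_UNIV has_derivative_tower_fst[OF Suc.prems]])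
qed

lemma partials_tower_fst:
  assumes "tower D"
  shows "partial1 (\<lambda>p. D m (fst p)) = (\<lambda>p. D (Suc m) (fst p))" "partial2 (\<lambda>p. D m (fst p))
      = (\<lambda>p. 0)"
  using partial_of_has_derivative[OF has_derivative_tower_fst[OF assms]]
      by (simp_all add: fun_eq_iff)

lemma partials_const: "partial1 (\<lambda>p. c) = (\<lambda>p. 0)" "partial2 (\<lambda>p. c) = (\<lambda>p. 0)"
  using partial_of_has_derivative[OF has_derivative_const] by (simp_all add: fun_eq_iff)

lemma iterate_const: "(partial1 ^^ j) (\<lambda>p. c) = (\<lambda>p. if j = 0 then c else 0)"
  "(partial2 ^^ j) (\<lambda>p. c) = (\<lambda>p. if j = 0 then c else 0)"
  by (induction j) (auto simp: partials_const)

lemma taylor_tower: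
  assumes "tower D"
  shows "taylor (\<lambda>p. D 0 (fst p)) = emb (Abs_fps (\<lambda>j. D j 0 / fact j))"
proof (intro fps2_eqI)
  fix j k
  have 1: "(partial1 ^^ j) (\<lambda>p. D 0 (fst p)) = (\<lambda>p. D j (fst p))"
    by (induction j) (simp_all add: partials_tower_fst[OF assms])
  have 2: "(partial2 ^^ k) (\<lambda>p. D 0 (fst p)) = (\<lambda>p. 0)" if "k \<noteq> 0"
  proof -
    obtain k' where k: "k = Suc k'" using \<open>k \<noteq> 0\<close> not0_implies_Suc by blast
    show ?thesis unfolding k funpow_Suc_right o_def
        by (simp add: partials_tower_fst(2)[OF assms] iterate_const)
  qed
  show "taylor (\<lambda>p. D 0 (fst p)) $ j $ k = emb (Abs_fps (\<lambda>j. D j 0 / fact j)) $ j $ k"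
    using 1 2 by (cases "k = 0") (simp_all add: taylor_nth emb_nth iterate_const)
qed

lemma taylor_fst: "taylor fst = X1"
proof -
  define D where "D = (\<lambda>(n :: nat) (x :: real). if n = 0 then x else if n = 1 then 1 else 0)"
  have "(D n has_real_derivative D (Suc n) x) (at x)" for n x
  proof -
    consider "n = 0" | "n = 1" | "1 < n" by linarith
    then show ?thesis by cases (auto simp: D_def)
  qed
  then have t: "tower D" by (simp add: tower_def)
  have "Abs_fps (\<lambda>j. D j 0 / fact j) = fps_X" by (rule fps_ext) (simp add: D_def fps_X_def)
  then show ?thesis using taylor_tower[OF t] by (simp add: D_def emb_X)
qed

lemma partials_snd: "partial1 snd = (\<lambda>p. 0)" "partial2 snd = (\<lambda>p. 1)"
  using partial_of_has_derivative[OF has_derivative_snd[OF has_derivative_ident]]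
      by (simp_all add: fun_eq_iff)

lemma taylor_snd: "taylor snd = X2"
proof (intro fps2_eqI)
  fix j k
  have 1: "(partial1 ^^ j) snd = (if j = 0 then snd else (\<lambda>p. 0))"
    by (induction j) (simp_all add: partials_snd partials_const)
  have 2: "(partial2 ^^ k) snd = (if k = 0 then snd else if k = 1 then (\<lambda>p. 1) else (\<lambda>p. 0))"
    by (induction k) (simp_all add: partials_snd partials_const)
  show "taylor snd $ j $ k = X2 $ j $ k"
    unfolding taylor_nth 2 by (simp add: 1 iterate_const X2_nth)
qed

lemma smooth_on_ident: "smooth_on UNIV (\<lambda>x :: real \<times> real. x)"
  unfolding smooth_on_def
proof
  fix n show "C_upto n UNIV (\<lambda>x :: real \<times> real. x)"
  proof (cases n)
    case (Suc m)
    show ?thesis unfolding Suc by (rule C_upto_SucI[OF _ has_derivative_ident]) (simp_all add: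
        C_upto_const)
  qed simp
qed

lemma smooth_on_Pair:
  "open U \<Longrightarrow> smooth_on U f \<Longrightarrow> smooth_on U g \<Longrightarrow> smooth_on U (\<lambda>x. (f x :: real, g x :: real))"
  unfolding smooth_on_def using C_upto_Pair by blast

lemma smooth_on_fst_snd:
  "open U \<Longrightarrow> smooth_on U f \<Longrightarrow> smooth_on U (\<lambda>x. fst (f x :: real \<times> real))"
  "open U \<Longrightarrow> smooth_on U f \<Longrightarrow> smooth_on U (\<lambda>x. snd (f x))"
  unfolding smooth_on_def using C_upto_fst_snd by blast+

lemma smooth_on_comp:
  fixes \<phi> :: "real \<times> real \<Rightarrow> real \<times> real" and \<chi> :: "'a::real_normed_vector \<Rightarrow> real \<times> real"
  assumes "open U" "open W" "\<chi> ` U \<subseteq> W" "smooth_on W \<phi>" "smooth_on U \<chi>"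
  shows "smooth_on U (\<lambda>x. \<phi> (\<chi> x))"
proof -
  have "smooth_on U (\<lambda>x. f (\<chi> x))" if "smooth_on W f" for f :: "real \<times> real \<Rightarrow> real"
    using that assms C_upto_compose[OF assms(1-3)] unfolding smooth_on_def by blast
  from this[OF smooth_on_fst_snd(1)[OF assms(2,4)]] this[OF smooth_on_fst_snd(2)[OF assms(2,4)]]
  have "smooth_on U (\<lambda>x. (fst (\<phi> (\<chi> x)), snd (\<phi> (\<chi> x))))" by (rule smooth_on_Pair[OF assms(1)])
  then show ?thesis by simp
qed

lemma local_coords_global:
  assumes "\<phi> 0 = 0" "\<And>x. \<rho> (\<phi> x) = x" "\<And>x. \<phi> (\<rho> x) = x" "smooth_on UNIV \<phi>" "smooth_on UNIV \<rho>"
  shows "local_coords \<phi>"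
proof -
  have "homeomorphism UNIV UNIV \<phi> \<rho>"
    by (rule homeomorphismI) (use assms smooth_on_continuous in auto)
  then show ?thesis unfolding local_coords_def using assms
      by (intro conjI exI[of _ UNIV] exI[of _ \<rho>]) auto
qed

lemma local_coords_id: "local_coords id"
  by (rule local_coords_global[of _ id]) (simp_all add: smooth_on_ident id_def)

lemma local_coords_swap: "local_coords prod.swap"
proof -
  have "smooth_on UNIV (\<lambda>x :: real \<times> real. (snd x, fst x))"
    by (intro smooth_on_Pair smooth_on_fst_snd smooth_on_ident open_UNIV)
  then have "smooth_on UNIV (prod.swap :: real \<times> real \<Rightarrow> _)" by (simp add: prod.swap_def[abs_def])
  then show ?thesis by (intro local_coords_global[of _ prod.swap]) (simp_all add: zero_prod_def)
qed

lemma shear_eq: "shear \<psi> = (\<lambda>p. (fst p, snd p + \<psi> (fst p)))"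
  by (auto simp: shear_def)

lemma smooth_on_shear: "tower D \<Longrightarrow> smooth_on UNIV (shear (D 0))"
  unfolding shear_eq
proof (intro smooth_on_Pair open_UNIV)
  assume D: "tower D"
  show "smooth_on UNIV (fst :: real \<times> real \<Rightarrow> real)"
    using smooth_on_fst_snd(1)[OF open_UNIV smooth_on_ident] by simp
  have "smooth_on UNIV (snd :: real \<times> real \<Rightarrow> real)"
    using smooth_on_fst_snd(2)[OF open_UNIV smooth_on_ident] by simp
  then show "smooth_on UNIV (\<lambda>x :: real \<times> real. snd x + D 0 (fst x))"
    using C_upto_tower_fst[OF D] unfolding smooth_on_def by (auto intro: C_upto_add)
qed

lemma tower_minus: "tower D \<Longrightarrow> tower (\<lambda>n x. - D n x)"
  unfolding tower_def by (auto intro: DERIV_minus)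

lemma shear_shear_minus: "shear \<psi> (shear (\<lambda>x. - \<psi> x) p) = p" "shear (\<lambda>x. - \<psi> x) (shear \<psi> p) = p"
  by (auto simp: shear_eq)

lemma local_coords_shear: "tower D \<Longrightarrow> D 0 0 = 0 \<Longrightarrow> local_coords (shear (D 0))"
  by (rule local_coords_global[of _ "shear (\<lambda>x. - D 0 x)"])
    (simp_all add: shear_shear_minus smooth_on_shear smooth_on_shear[OF tower_minus] zero_prod_def,
        simp add: shear_def)

lemma local_coords_comp:
  assumes "local_coords \<phi>" "local_coords \<chi>"
  shows "local_coords (\<phi> \<circ> \<chi>)"
proof -
  obtain V1 W1 \<rho>1 where 1: "open V1" "0 \<in> V1" "open W1" "0 \<in> W1" "homeomorphism V1 W1 \<phi> \<rho>1"
      "smooth_on V1 \<phi>" "smooth_on W1 \<rho>1" "\<phi> 0 = 0"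
    using assms(1) unfolding local_coords_def by blast
  obtain V2 W2 \<rho>2 where 2: "open V2" "0 \<in> V2" "open W2" "0 \<in> W2" "homeomorphism V2 W2 \<chi> \<rho>2"
      "smooth_on V2 \<chi>" "smooth_on W2 \<rho>2" "\<chi> 0 = 0"
    using assms(2) unfolding local_coords_def by blast
  note h1 = homeomorphism_apply1[OF 1(5)] homeomorphism_apply2[OF 1(5)] homeomorphism_image1[OF
      1(5)] homeomorphism_image2[OF 1(5)]
  note h2 = homeomorphism_apply1[OF 2(5)] homeomorphism_apply2[OF 2(5)] homeomorphism_image1[OF
      2(5)] homeomorphism_image2[OF 2(5)]
  define V where "V = V2 \<inter> \<chi> -` V1"
  define W where "W = W1 \<inter> \<rho>1 -` W2"
  have oV: "open V" unfolding V_def by (rule continuous_open_preimage[OF smooth_on_continuous[OF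
      2(6)] 2(1) 1(1)])
  have oW: "open W" unfolding W_def by (rule continuous_open_preimage[OF smooth_on_continuous[OF
      1(7)] 1(3) 2(3)])
  have V0: "0 \<in> V" using 1 2 by (simp add: V_def)
  have "\<rho>1 0 = 0" using h1(1)[OF 1(2)] 1(8) by simp
  then have W0: "0 \<in> W" using 1 2 by (simp add: W_def)
  have sV: "smooth_on V (\<lambda>x. \<phi> (\<chi> x))"
    using smooth_on_subset[OF 2(6), of V]
        by (intro smooth_on_comp[OF oV 1(1) _ 1(6)]) (auto simp: V_def)
  have sW: "smooth_on W (\<lambda>x. \<rho>2 (\<rho>1 x))"
    using smooth_on_subset[OF 1(7), of W]
        by (intro smooth_on_comp[OF oW 2(3) _ 2(7)]) (auto simp: W_def)
  have m: "\<phi> (\<chi> x) \<in> W \<and> \<rho>2 (\<rho>1 (\<phi> (\<chi> x))) = x" if "x \<in> V" for x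
  proof -
    have x: "x \<in> V2" "\<chi> x \<in> V1" using that by (simp_all add: V_def)
    then have "\<phi> (\<chi> x) \<in> W1" "\<chi> x \<in> W2" using h1(3) h2(3) by blast+
    then show ?thesis using h1(1)[OF x(2)] h2(1)[OF x(1)] by (simp add: W_def)
  qed
  have m': "\<rho>2 (\<rho>1 x) \<in> V \<and> \<phi> (\<chi> (\<rho>2 (\<rho>1 x))) = x" if "x \<in> W" for x
  proof -
    have x: "x \<in> W1" "\<rho>1 x \<in> W2" using that by (simp_all add: W_def)
    then have "\<rho>1 x \<in> V1" "\<rho>2 (\<rho>1 x) \<in> V2" using h1(4) h2(4) by blast+
    then show ?thesis using h1(2)[OF x(1)] h2(2)[OF x(2)] by (simp add: V_def)
  qed
  have "homeomorphism V W (\<phi> \<circ> \<chi>) (\<lambda>x. \<rho>2 (\<rho>1 x))"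
    by (rule homeomorphismI) (use m m' smooth_on_continuous[OF sV] smooth_on_continuous[OF sW] in
        \<open>auto simp: o_def\<close>)
  then show ?thesis unfolding local_coords_def
    using oV V0 oW W0 sV sW 1(8) 2(8) by (intro conjI exI[of _ V] exI[of _ W] exI[of _ "\<lambda>x. \<rho>2 (\<rho>1
        x)"]) (simp_all add: o_def)
qed

lemma local_coords_smooth: "local_coords \<phi> \<Longrightarrow> smooth_near_0 \<phi> \<and> \<phi> 0 = 0"
  unfolding local_coords_def smooth_near_0_def by blast

text \<open>The Taylor series of the inverse germ is the formal inverse.\<close>

lemma local_coords_formal_diffeo:
  assumes "local_coords \<phi>"
  obtains R1 R2 where "formal_diffeo (taylor (fst \<circ> \<phi>)) (taylor (snd \<circ> \<phi>)) R1 R2"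
proof -
  obtain V W \<rho> where h: "open V" "0 \<in> V" "open W" "0 \<in> W" "homeomorphism V W \<phi> \<rho>" "smooth_on V \<phi>"
      "smooth_on W \<rho>" "\<phi> 0 = 0"
    using assms unfolding local_coords_def by blast
  have inv: "\<And>x. x \<in> V \<Longrightarrow> \<rho> (\<phi> x) = x" "\<And>x. x \<in> W \<Longrightarrow> \<phi> (\<rho> x) = x"
    using h(5) homeomorphism_apply1 homeomorphism_apply2 by blast+
  have r0: "\<rho> 0 = 0" using inv(1)[OF h(2)] h(8) by simp
  have s: "smooth_near_0 \<phi>" "smooth_near_0 \<rho>" using h unfolding smooth_near_0_def by blast+
  have ident: "smooth_near_0 (\<lambda>x :: real \<times> real. x)" unfolding smooth_near_0_def
      using smooth_on_ident by blast
  have sm: "smooth_near_0 (fst :: real \<times> real \<Rightarrow> real)" "smooth_near_0 (snd :: real \<times> real \<Rightarrow> real)"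
    using smooth_near_0_fst_snd[OF ident] by simp_all
  have c: "fps2_compose (taylor (\<lambda>x. p (a x))) (taylor (\<lambda>x. fst (b x))) (taylor (\<lambda>x. snd (b x)))
      = taylor p"
    if p: "smooth_near_0 p" "smooth_near_0 (\<lambda>x. p (a x))"
        and ab: "smooth_near_0 b" "b 0 = 0" "open U" "0 \<in> U" "\<And>x. x \<in> U \<Longrightarrow> a (b x) = x"
    for p :: "real \<times> real \<Rightarrow> real" and a b :: "real \<times> real \<Rightarrow> real \<times> real" and U
  proof -
    have "germ_eq p (\<lambda>x. p (a (b x)))" by (rule germ_eqI[OF ab(3,4)]) (simp add: ab(5))
    then have "taylor p = taylor (\<lambda>x. p (a (b x)))" by (rule taylor_cong[OF p(1)])
    then show ?thesis using taylor_compose[OF p(2) ab(1,2)] by simp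
  qed
  note sp = smooth_near_0_fst_snd[OF s(1)] and sr = smooth_near_0_fst_snd[OF s(2)]
  have "formal_diffeo (taylor (\<lambda>x. fst (\<phi> x))) (taylor (\<lambda>x. snd (\<phi> x))) (taylor (\<lambda>x. fst (\<rho> x)))
      (taylor (\<lambda>x. snd (\<rho> x)))"
    unfolding formal_diffeo_def
    using c[OF sm(1) sp(1) s(2) r0 h(3,4) inv(2)] c[OF sm(2) sp(2) s(2) r0 h(3,4) inv(2)]
      c[OF sm(1) sr(1) s(1) h(8) h(1,2) inv(1)] c[OF sm(2) sr(2) s(1) h(8) h(1,2) inv(1)]
    by (simp add: taylor_0_0 h(8) r0 taylor_fst taylor_snd)
  then show ?thesis using that by (simp add: o_def)
qed

subsection \<open>The height\<close>

text \<open>The set of distances whose supremum is the height.\<close>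

definition coord_values :: "real fps fps \<Rightarrow> real set" where
  "coord_values F = {nd (fps2_compose F (taylor (fst \<circ> \<phi>)) (taylor (snd \<circ> \<phi>))) | \<phi>. local_coords \<phi>}"

lemma formal_height_eq: "formal_height F = Sup (coord_values F)"
  by (simp add: formal_height_def coord_values_def)

lemma height_eq_formal:
  assumes "smooth_near_0 f"
  shows "height f = formal_height (taylor f)"
proof -
  have "taylor (f \<circ> \<phi>) = fps2_compose (taylor f) (taylor (fst \<circ> \<phi>)) (taylor (snd \<circ> \<phi>))"
      if "local_coords \<phi>" for \<phi>
    using taylor_compose[OF assms] local_coords_smooth[OF that] by (simp add: o_def)
  then show ?thesis unfolding height_def formal_height_def by (metis (no_types, lifting))
qed

text \<open>Composition with a fixed coordinate change permutes the coordinate systems.\<close>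

lemma height_comp:
  assumes "local_coords \<chi>" "local_coords \<chi>'" "\<And>x. \<chi> (\<chi>' x) = x"
  shows "height (f \<circ> \<chi>) = height f"
proof -
  have "{nd (taylor (f \<circ> \<chi> \<circ> \<phi>)) | \<phi>. local_coords \<phi>} = {nd (taylor (f \<circ> \<phi>)) | \<phi>. local_coords \<phi>}"
  proof (intro subset_antisym subsetI)
    fix x assume "x \<in> {nd (taylor (f \<circ> \<chi> \<circ> \<phi>)) | \<phi>. local_coords \<phi>}"
    then obtain \<phi> where "local_coords \<phi>" "x = nd (taylor (f \<circ> (\<chi> \<circ> \<phi>)))" by (auto simp: o_assoc)
    then show "x \<in> {nd (taylor (f \<circ> \<phi>)) | \<phi>. local_coords \<phi>}" using local_coords_comp[OF assms(1)]
        by blast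
  next
    fix x assume "x \<in> {nd (taylor (f \<circ> \<phi>)) | \<phi>. local_coords \<phi>}"
    then obtain \<phi> where \<phi>: "local_coords \<phi>" "x = nd (taylor (f \<circ> \<phi>))" by blast
    moreover have "f \<circ> \<chi> \<circ> (\<chi>' \<circ> \<phi>) = f \<circ> \<phi>" by (simp add: fun_eq_iff assms(3))
    ultimately show "x \<in> {nd (taylor (f \<circ> \<chi> \<circ> \<phi>)) | \<phi>. local_coords \<phi>}"
      using local_coords_comp[OF assms(2) \<phi>(1)] by (metis (mono_tags, lifting) mem_Collect_eq)
  qed
  then show ?thesis by (simp add: height_def)
qed

lemma id_coord_value: "nd F \<in> coord_values F"
proof -
  have "nd F = nd (fps2_compose F (taylor (fst \<circ> id)) (taylor (snd \<circ> id)))"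
    by (simp add: taylor_fst taylor_snd comp_id)
  then show ?thesis unfolding coord_values_def using local_coords_id by blast
qed

lemma taylor_shear:
  assumes "tower D" "g = Abs_fps (\<lambda>j. D j 0 / fact j)"
  shows "taylor (fst \<circ> shear (D 0)) = X1" "taylor (snd \<circ> shear (D 0)) = X2 + emb g"
proof -
  have "fst \<circ> shear (D 0) = fst" by (auto simp: shear_eq)
  then show "taylor (fst \<circ> shear (D 0)) = X1" by (simp add: taylor_fst)
  have s: "smooth_near_0 (snd :: real \<times> real \<Rightarrow> real)"
    unfolding smooth_near_0_def using smooth_on_fst_snd(2)[OF open_UNIV smooth_on_ident]
        by (intro exI[of _ UNIV]) auto
  have s': "smooth_near_0 (\<lambda>p :: real \<times> real. D 0 (fst p))"
    unfolding smooth_near_0_def smooth_on_def using C_upto_tower_fst[OF assms(1)]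
        by (intro exI[of _ UNIV]) auto
  have "snd \<circ> shear (D 0) = (\<lambda>p. snd p + D 0 (fst p))" by (auto simp: shear_eq)
  then show "taylor (snd \<circ> shear (D 0)) = X2 + emb g"
    using taylor_add[OF s s'] taylor_tower[OF assms(1)] by (simp add: taylor_snd assms(2))
qed

lemma taylor_comp_shear:
  assumes "smooth_near_0 f" "tower D" "D 0 0 = 0" "g = Abs_fps (\<lambda>j. D j 0 / fact j)"
  shows "taylor (f \<circ> shear (D 0)) = fshear (taylor f) g"
proof -
  have "local_coords (shear (D 0))" by (rule local_coords_shear[OF assms(2,3)])
  then show ?thesis
    using taylor_compose[OF assms(1)] local_coords_smooth taylor_shear[OF assms(2,4)]
    by (simp add: o_def fshear_def)
qed

lemma tower_poly: "tower (\<lambda>n. poly ((pderiv ^^ n) q))"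
  by (simp add: tower_def)

lemma higher_pderiv_0: "poly ((pderiv ^^ n) q) 0 / fact n = coeff q n"
  for q :: "real poly"
proof -
  have "poly ((pderiv ^^ n) q) 0 = fact n * coeff q n"
  proof (induction n arbitrary: q)
    case (Suc n)
    have "poly ((pderiv ^^ Suc n) q) 0 = poly ((pderiv ^^ n) (pderiv q)) 0"
        by (simp only: funpow_Suc_right o_def)
    then show ?case using Suc[of "pderiv q"] by (simp add: coeff_pderiv algebra_simps)
  qed (simp add: poly_0_coeff_0)
  then show ?thesis by simp
qed

lemma poly_shear:
  fixes q :: "real poly"
  assumes "poly q 0 = 0"
  shows "local_coords (shear (poly q))" "smooth_near_0 f \<Longrightarrow> taylor (f \<circ> shear (poly q))
      = fshear (taylor f) (fps_of_poly q)"
    "height (f \<circ> shear (poly q)) = height f" "smooth_near_0 (poly q)"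
proof -
  let ?D = "\<lambda>n. poly ((pderiv ^^ n) q)"
  have D: "tower ?D" "?D 0 = poly q" "?D 0 0 = 0" using assms by (simp_all add: tower_poly)
  show l: "local_coords (shear (poly q))" using local_coords_shear[OF D(1)] assms by simp
  have g: "fps_of_poly q = Abs_fps (\<lambda>j. ?D j 0 / fact j)"
      by (rule fps_ext) (simp add: higher_pderiv_0)
  show "taylor (f \<circ> shear (poly q)) = fshear (taylor f) (fps_of_poly q)" if "smooth_near_0 f"
    using taylor_comp_shear[OF that D(1) D(3) g] by simp
  have "local_coords (shear (\<lambda>x. - poly q x))"
      using local_coords_shear[OF tower_minus[OF D(1)]] assms by simp
  from height_comp[OF l this shear_shear_minus(1)] show "height (f \<circ> shear (poly q)) = height f" .
  show "smooth_near_0 (poly q)" using tower_smooth[OF D(1)] by simp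
qed

lemma shear_coord_value:
  fixes q :: "real poly"
  assumes "poly q 0 = 0"
  shows "nd (fshear F (fps_of_poly q)) \<in> coord_values F"
proof -
  let ?D = "\<lambda>n. poly ((pderiv ^^ n) q)"
  have g: "fps_of_poly q = Abs_fps (\<lambda>j. ?D j 0 / fact j)"
      by (rule fps_ext) (simp add: higher_pderiv_0)
  have "nd (fshear F (fps_of_poly q)) = nd (fps2_compose F (taylor (fst \<circ> shear (poly q))) (taylor
      (snd \<circ> shear (poly q))))"
    using taylor_shear[OF tower_poly g] by (simp add: fshear_def)
  then show ?thesis unfolding coord_values_def using poly_shear(1)[OF assms] by blast
qed

text \<open>The interchange of coordinates permutes the coordinate systems.\<close>

lemma formal_height_swap_vars: "formal_height (swap_vars F) = formal_height F"
proof -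
  have *: "coord_values (swap_vars F) \<subseteq> coord_values F" for F
  proof
    fix x assume "x \<in> coord_values (swap_vars F)"
    then obtain \<phi> where \<phi>: "local_coords \<phi>" "x
        = nd (fps2_compose (swap_vars F) (taylor (fst \<circ> \<phi>)) (taylor (snd \<circ> \<phi>)))"
      unfolding coord_values_def by blast
    have "fst \<circ> (prod.swap \<circ> \<phi>) = snd \<circ> \<phi>" "snd \<circ> (prod.swap \<circ> \<phi>) = fst \<circ> \<phi>"
        by (simp_all add: fun_eq_iff)
    then have "x = nd (fps2_compose F (taylor (fst \<circ> (prod.swap \<circ> \<phi>))) (taylor (snd \<circ> (prod.swap \<circ>
        \<phi>))))"
      using \<phi>(2) comp_swap_vars_arg[of F "taylor (fst \<circ> \<phi>)" "taylor (snd \<circ> \<phi>)"] by (simp only:)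
    then show "x \<in> coord_values F" unfolding coord_values_def
        using local_coords_comp[OF local_coords_swap \<phi>(1)] by blast
  qed
  have "coord_values (swap_vars F) = coord_values F" using *[of F] *[of "swap_vars F"]
      by (simp add: swap_vars_swap_vars)
  then show ?thesis by (simp add: formal_height_eq)
qed

lemma coord_values_bound:
  assumes "F \<noteq> 0" "nd F \<le> M" "\<And>s L \<beta> n. dominant_root F s L \<beta> n \<Longrightarrow> real n \<le> M"
    "\<And>s L \<beta> n. dominant_root (swap_vars F) s L \<beta> n \<Longrightarrow> 2 \<le> s \<Longrightarrow> real n \<le> M" "x \<in> coord_values F"
  shows "x \<le> M"
proof -
  obtain \<phi> where \<phi>: "local_coords \<phi>" "x = nd (fps2_compose F (taylor (fst \<circ> \<phi>)) (taylor (snd \<circ> \<phi>)))"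
    using assms(5) unfolding coord_values_def by blast
  obtain R1 R2 where "formal_diffeo (taylor (fst \<circ> \<phi>)) (taylor (snd \<circ> \<phi>)) R1 R2"
    using local_coords_formal_diffeo[OF \<phi>(1)] by blast
  from distance_bound_diffeo[OF assms(1) this assms(2-4)] show ?thesis using \<phi>(2) by simp
qed

lemma height_no_dominant_root:
  assumes "F \<noteq> 0" "\<And>s L \<beta> n. \<not> dominant_root F s L \<beta> n" "\<And>s L \<beta> n. dominant_root (swap_vars F) s L \<beta>
      n \<Longrightarrow> \<not> 2 \<le> s"
  shows "formal_height F = nd F"
  unfolding formal_height_eq
  using coord_values_bound[OF assms(1), of "nd F"] assms(2,3) id_coord_value[of F]
      by (intro cSup_eq_maximum) blast+

text \<open>The two lines through \<open>(d, d)\<close> would coincide, which forces \<open>s s' = 1\<close>.\<close>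

lemma dominant_root_swap_vars_exclusive:
  assumes F: "F \<noteq> 0" and b: "dominant_root F s L \<beta> n"
      and b': "dominant_root (swap_vars F) s' L' \<beta>' n'"
  shows "s' = 1"
proof -
  have "weight_ge 1 (real s') (nd F * (1 + real s')) (swap_vars F)" using b'
      by (auto simp: dominant_root_def distance_swap_vars)
  then have "1 = real s * real s'" using dominant_root_unique_weights[OF F b, of "real s'" 1]
      by (simp add: swap_vars_weight_ge add.commute)
  then have "s * s' = 1" by (metis of_nat_1 of_nat_eq_iff of_nat_mult)
  then show ?thesis by simp
qed

lemma dominant_root_coord_values:
  assumes F: "F \<noteq> 0" and b: "dominant_root F s L \<beta> n" and x: "x \<in> coord_values F"
  shows "x \<le> real n"
proof (rule coord_values_bound[OF F _ _ _ x])
  show "nd F \<le> real n" using b by (simp add: dominant_root_def)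
  show "real n' \<le> real n" if "dominant_root F s' L' \<beta>' n'" for s' L' \<beta>' n'
      using dominant_root_unique(2)[OF F b that] by simp
  show "real n' \<le> real n" if "dominant_root (swap_vars F) s' L' \<beta>' n'" "2 \<le> s'" for s' L' \<beta>' n'
    using dominant_root_swap_vars_exclusive[OF F b that(1)] that(2) by simp
qed

lemma coord_values_bdd: "F \<noteq> 0 \<Longrightarrow> bdd_above (coord_values F)"
proof (cases "\<exists>s L \<beta> n. dominant_root F s L \<beta> n")
  case True
  moreover assume "F \<noteq> 0"
  ultimately show ?thesis using dominant_root_coord_values by (meson bdd_aboveI)
next
  case no: False
  assume F: "F \<noteq> 0"
  show ?thesis
  proof (cases "\<exists>s L \<beta> n. dominant_root (swap_vars F) s L \<beta> n")
    case True
    then obtain s L \<beta> n where b: "dominant_root (swap_vars F) s L \<beta> n" by blast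
    have F': "swap_vars F \<noteq> 0" using F by (simp add: swap_vars_eq_0)
    show ?thesis
    proof (rule bdd_aboveI[of _ "real n"], rule coord_values_bound[OF F])
      show "nd F \<le> real n" using b by (simp add: dominant_root_def distance_swap_vars)
      show "real n' \<le> real n" if "dominant_root (swap_vars F) s' L' \<beta>' n'" for s' L' \<beta>' n'
          using dominant_root_unique(2)[OF F' b that] by simp
    qed (use no in auto)
  qed (use no coord_values_bound[OF F, of "nd F"] in \<open>auto intro: bdd_aboveI[of _ "nd F"]\<close>)
qed

lemma coord_value_le_height: "F \<noteq> 0 \<Longrightarrow> x \<in> coord_values F \<Longrightarrow> x \<le> formal_height F"
  unfolding formal_height_eq by (intro cSup_upper coord_values_bdd)

text \<open>The lower bounds come from the explicit shear by \<open>\<beta> x\<^sub>1\<^sup>s\<close>.\<close>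

lemma dominant_root_height:
  assumes F: "F \<noteq> 0" and b: "dominant_root F s L \<beta> n"
  shows "nd F < formal_height F" "formal_height F \<le> real n" "formal_height (pp F) = real n"
proof -
  have s: "1 \<le> s" using b by (simp add: dominant_root_def)
  let ?q = "monom \<beta> s"
  have q0: "poly ?q 0 = 0" using s by (simp add: poly_monom)
  have low: "fps_of_poly ?q $ i = 0" if "i < s" for i using that
      by (simp add: fps_of_poly_nth coeff_monom)
  have high: "fps_of_poly ?q $ i = 0" if "s < i" for i using that
      by (simp add: fps_of_poly_nth coeff_monom)
  have at: "fps_of_poly ?q $ s = \<beta>" by (simp add: fps_of_poly_nth)
  have "nd F < nd (fshear F (fps_of_poly ?q))" by (rule dominant_root_shear(5)[OF F b low at])
  also have "\<dots> \<le> formal_height F" by (rule coord_value_le_height[OF F shear_coord_value[OF q0]])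
  finally show "nd F < formal_height F" .
  have ub: "formal_height G \<le> real n" if "G \<noteq> 0" "dominant_root G s L \<beta> n" for G
    unfolding formal_height_eq using id_coord_value[of G] dominant_root_coord_values[OF that]
        by (intro cSup_least) auto
  show "formal_height F \<le> real n" by (rule ub[OF F b])
  have P: "pp F \<noteq> 0" by (rule distance_pp[OF F])
  have "real n \<le> nd (fshear (pp F) (fps_of_poly ?q))"
      by (rule dominant_root_pp_shear[OF F b low at high])
  also have "\<dots> \<le> formal_height (pp F)" by (rule coord_value_le_height[OF P shear_coord_value[OF
      q0]])
  finally show "formal_height (pp F) = real n" using ub[OF P] dominant_root_pp[OF F] b
      by (intro antisym) auto
qed

theorem formal_adapted_iff:
  assumes F: "F \<noteq> 0"
  shows "formal_adapted F \<longleftrightarrow> \<not> (\<exists>s L \<beta> n. dominant_root F s L \<beta> n)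
      \<and> \<not> (\<exists>s L \<beta> n. dominant_root (swap_vars F) s L \<beta> n)"
proof -
  have F': "swap_vars F \<noteq> 0" using F by (simp add: swap_vars_eq_0)
  show ?thesis
    unfolding formal_adapted_def
    using dominant_root_height(1)[OF F] dominant_root_height(1)[OF F'] height_no_dominant_root[OF F]
    by (metis distance_swap_vars formal_height_swap_vars less_irrefl)
qed

lemma formal_adapted_pp:
  assumes F: "F \<noteq> 0"
  shows "formal_adapted (pp F) \<longleftrightarrow> formal_adapted F"
proof -
  have F': "swap_vars F \<noteq> 0" using F by (simp add: swap_vars_eq_0)
  show ?thesis
    unfolding formal_adapted_iff[OF F] formal_adapted_iff[OF distance_pp(1)[OF F]]
    by (simp add: dominant_root_pp[OF F] dominant_root_pp[OF F'] flip: pp_swap_vars)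
qed

lemma height_le_pp:
  assumes F: "F \<noteq> 0"
  shows "formal_height F \<le> formal_height (pp F)"
proof -
  have F': "swap_vars F \<noteq> 0" using F by (simp add: swap_vars_eq_0)
  consider s L \<beta> n where "dominant_root F s L \<beta> n" | s L \<beta> n
      where "dominant_root (swap_vars F) s L \<beta> n"
    | "formal_adapted F" using formal_adapted_iff[OF F] by blast
  then show ?thesis
  proof cases
    case 1
    then show ?thesis using dominant_root_height(2,3)[OF F 1] by simp
  next
    case 2
    then show ?thesis using dominant_root_height(2,3)[OF F' 2]
        by (simp add: pp_swap_vars formal_height_swap_vars)
  next
    case 3
    then have "formal_height F = nd (pp F)" by (simp add: formal_adapted_def distance_pp[OF F])
    then show ?thesis using coord_value_le_height[OF distance_pp(1)[OF F] id_coord_value] by simp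
  qed
qed

section \<open>Smooth functions with prescribed Taylor series\<close>

text \<open>The \<open>n\<close>-th derivative of the product of \<open>E l\<close> and \<open>F m\<close>; the recursion replaces the binomial sum
  of Leibniz' rule.\<close>

primrec leibniz :: "(nat \<Rightarrow> real \<Rightarrow> real) \<Rightarrow> (nat \<Rightarrow> real \<Rightarrow> real) \<Rightarrow> nat \<Rightarrow> nat \<Rightarrow> nat \<Rightarrow> real \<Rightarrow> real" where
  "leibniz E F 0 l m x = E l x * F m x"
| "leibniz E F (Suc n) l m x = leibniz E F n (Suc l) m x + leibniz E F n l (Suc m) x"

lemma tower_leibniz:
  assumes "tower E" "tower F"
  shows "tower (\<lambda>n. leibniz E F n 0 0)"
proof -
  have "(leibniz E F n l m has_real_derivative leibniz E F (Suc n) l m x) (at x)" for n l m x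
  proof (induction n arbitrary: l m)
    case 0
    have "((\<lambda>x. E l x * F m x) has_real_derivative E (Suc l) x * F m x + F (Suc m) x * E l x) (at
        x)"
      using assms unfolding tower_def by (intro DERIV_mult) auto
    then show ?case by (simp add: mult.commute)
  next
    case (Suc n)
    show ?case using DERIV_add[OF Suc[of "Suc l" m] Suc[of l "Suc m"]] by simp
  qed
  then show ?thesis by (simp only: tower_def) blast
qed

lemma leibniz_bounded:
  assumes "\<And>j. \<exists>B. \<forall>x. \<bar>E j x\<bar> \<le> B" "\<And>j. \<exists>B. \<forall>x. \<bar>F j x\<bar> \<le> B"
  shows "\<exists>B. \<forall>x. \<bar>leibniz E F n l m x\<bar> \<le> B"
proof (induction n arbitrary: l m)
  case 0
  obtain B B' where B: "\<And>x. \<bar>E l x\<bar> \<le> B" "\<And>x. \<bar>F m x\<bar> \<le> B'" using assms by metis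
  have "\<bar>E l x * F m x\<bar> \<le> B * B'" for x
    unfolding abs_mult using B[of x] by (intro mult_mono) auto
  then show ?case by auto
next
  case (Suc n)
  obtain B B' where B: "\<And>x. \<bar>leibniz E F n (Suc l) m x\<bar> \<le> B" "\<And>x. \<bar>leibniz E F n l (Suc m) x\<bar> \<le> B'"
    using Suc by metis
  have "\<bar>leibniz E F (Suc n) l m x\<bar> \<le> B + B'" for x using B[of x] by (simp add: abs_le_iff)
  then show ?case by blast
qed

lemma leibniz_vanish:
  assumes "\<And>i. i < p \<Longrightarrow> E i 0 = 0" "\<And>i. i < q \<Longrightarrow> F i 0 = 0" "n + l + m < p + q"
  shows "leibniz E F n l m 0 = 0"
  using assms(3)
proof (induction n arbitrary: l m)
  case 0
  then have "l < p \<or> m < q" by linarith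
  then show ?case using assms(1,2) by auto
qed auto

lemma leibniz_leading:
  assumes E: "\<And>i. i < p \<Longrightarrow> E i 0 = 0" "0 < E p 0" and F: "F 0 0 = 0" "0 < F (Suc 0) 0"
    and n: "n + l + m = Suc p"
  shows "0 \<le> leibniz E F n l m 0" "l \<le> p \<Longrightarrow> m \<le> 1 \<Longrightarrow> 0 < leibniz E F n l m 0"
proof -
  have nonneg: "0 \<le> leibniz E F n l m 0" if "n + l + m = Suc p" for n l m
    using that
  proof (induction n arbitrary: l m)
    case 0
    then consider "l < p" | "l = p" "m = Suc 0" | "m = 0" by (cases m) fastforce+
    then show ?case using E F by cases auto
  next
    case (Suc n)
    then show ?case by simp
  qed
  then show "0 \<le> leibniz E F n l m 0" using n .
  have "0 < leibniz E F n l m 0" if "n + l + m = Suc p" "l \<le> p" "m \<le> 1" for n l m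
    using that
  proof (induction n arbitrary: l m)
    case 0
    then have "l = p" "m = Suc 0" by linarith+
    then show ?case using E F by simp
  next
    case (Suc n)
    show ?case
    proof (cases "l < p")
      case True
      then have "0 < leibniz E F n (Suc l) m 0" using Suc by auto
      moreover have "0 \<le> leibniz E F n l (Suc m) 0" using Suc.prems by (intro nonneg) auto
      ultimately show ?thesis by simp
    next
      case False
      then have "l = p" "n = 0" "m = 0" using Suc.prems by linarith+
      then show ?thesis using E F by simp
    qed
  qed
  then show "l \<le> p \<Longrightarrow> m \<le> 1 \<Longrightarrow> 0 < leibniz E F n l m 0" using n by blast
qed

text \<open>Powers of the sine: all derivatives are bounded, and \<open>sin\<^sup>n\<close> vanishes at the origin to order
  exactly \<open>n\<close>.\<close>

lemma exists_bounded_monomial: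
  "\<exists>E. tower E \<and> (\<forall>j. \<exists>B. \<forall>x. \<bar>E j x\<bar> \<le> B) \<and> (\<forall>j<n. E j 0 = 0) \<and> 0 < E n 0"
proof (induction n)
  case 0
  show ?case by (rule exI[of _ "\<lambda>j x. if j = 0 then 1 else 0"]) (auto simp: tower_def)
next
  case (Suc n)
  then obtain E where E: "tower E" "\<And>j. \<exists>B. \<forall>x. \<bar>E j x\<bar> \<le> B" "\<And>j. j < n \<Longrightarrow> E j 0 = 0" "0 < E n 0"
      by blast
  define S where "S = (\<lambda>(j :: nat) (x :: real). sin (x + real j * (pi / 2)))"
  have "(S j has_real_derivative S (Suc j) x) (at x)" for j x
  proof -
    have "((\<lambda>x. sin (x + real j * (pi / 2))) has_real_derivative cos (x + real j * (pi / 2))) (at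
        x)"
      by (auto intro!: derivative_eq_intros)
    moreover have "cos (x + real j * (pi / 2)) = S (Suc j) x"
    proof -
      have "sin (y + pi / 2) = cos y" for y :: real by (simp add: sin_add)
      moreover have "x + real (Suc j) * (pi / 2) = (x + real j * (pi / 2)) + pi / 2"
          by (simp add: field_simps)
      ultimately show ?thesis by (simp only: S_def)
    qed
    ultimately show ?thesis by (simp add: S_def)
  qed
  then have S: "tower S" by (simp add: tower_def)
  have Sb: "\<exists>B. \<forall>x. \<bar>S j x\<bar> \<le> B" for j by (intro exI[of _ 1]) (simp add: S_def)
  have S0: "S 0 0 = 0" "0 < S (Suc 0) 0" by (simp_all add: S_def)
  have v: "leibniz E S j 0 0 0 = 0" if "j < Suc n" for j
    using leibniz_vanish[of n E 1 S j 0 0] E(3) S0 that by auto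
  have p: "0 < leibniz E S (Suc n) 0 0 0"
    using leibniz_leading(2)[of n E S "Suc n" 0 0] E(3,4) S0 by simp
  show ?case
  proof (rule exI[of _ "\<lambda>j. leibniz E S j 0 0"], intro conjI allI impI)
    show "tower (\<lambda>j. leibniz E S j 0 0)" by (rule tower_leibniz[OF E(1) S])
    show "\<exists>B. \<forall>x. \<bar>leibniz E S j 0 0 x\<bar> \<le> B" for j by (rule leibniz_bounded) (rule E(2), rule Sb)
  qed (use v p in auto)
qed

text \<open>Squeezing the \<open>x\<close>-axis by a factor \<open>r\<close> and dividing by \<open>r\<^sup>n\<close> keeps the \<open>n\<close>-th derivative at the
  origin and makes the derivatives of lower order small.\<close>

lemma exists_small_monomial:
  "\<exists>T. tower T \<and> (\<forall>j<n. \<forall>x. \<bar>T j x\<bar> \<le> (1/2) ^ n) \<and> (\<forall>j<n. T j 0 = 0) \<and> T n 0 = c"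
proof -
  obtain E where E: "tower E" "\<And>j. \<exists>B. \<forall>x. \<bar>E j x\<bar> \<le> B" "\<And>j. j < n \<Longrightarrow> E j 0 = 0" "0 < E n 0"
    using exists_bounded_monomial[of n] by blast
  obtain B where B: "\<And>j x. \<bar>E j x\<bar> \<le> B j" using E(2) by metis
  have B0: "0 \<le> B j" for j using B[of j 0] by linarith
  define k where "k = \<bar>c\<bar> / E n 0"
  have k: "0 \<le> k" using E(4) by (simp add: k_def)
  \<comment> \<open>large enough to beat the factor \<open>k\<close> and all the bounds at once, using \<open>r\<^sup>j / r\<^sup>n \<le> 1 / r\<close>\<close>
  define r where "r = 1 + k * (\<Sum>j<n. B j) * 2 ^ n"
  have l1: "1 \<le> r" using k B0 by (simp add: r_def sum_nonneg)
  define T where "T = (\<lambda>j x. c / E n 0 * (r ^ j / r ^ n) * E j (r * x))"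
  have "(T j has_real_derivative T (Suc j) x) (at x)" for j x
  proof -
    have "(E j has_real_derivative E (Suc j) (r * x)) (at (r * x))" using E(1)
        by (simp add: tower_def)
    moreover have "((\<lambda>x. r * x) has_real_derivative r) (at x)"
        by (auto intro!: derivative_eq_intros)
    ultimately have "((\<lambda>x. E j (r * x)) has_real_derivative E (Suc j) (r * x) * r) (at x)"
        by (rule DERIV_chain2)
    from DERIV_cmult[OF this, of "c / E n 0 * (r ^ j / r ^ n)"] show ?thesis
        by (simp add: T_def mult_ac)
  qed
  then have "tower T" by (simp add: tower_def)
  moreover have "\<bar>T j x\<bar> \<le> (1/2) ^ n" if j: "j < n" for j x
  proof -
    have "r ^ Suc j \<le> r ^ n" using l1 j by (intro power_increasing) auto
    then have "r ^ j / r ^ n \<le> 1 / r" using l1 by (simp add: field_simps)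
    then have "\<bar>T j x\<bar> \<le> k * (1 / r) * B j"
      unfolding T_def abs_mult k_def using l1 E(4) B[of j "r * x"]
      by (intro mult_mono) auto
    also have "\<dots> \<le> k * (1 / r) * (\<Sum>j<n. B j)"
      using j B0 k l1 by (intro mult_left_mono member_le_sum) auto
    also have "\<dots> \<le> (1/2) ^ n"
    proof -
      have "k * (\<Sum>j<n. B j) * 2 ^ n \<le> r" by (simp add: r_def)
      then show ?thesis using l1 by (simp add: field_simps power_divide)
    qed
    finally show ?thesis .
  qed
  moreover have "T j 0 = 0" if "j < n" for j using E(3) that by (simp add: T_def)
  moreover have "T n 0 = c" using E(4) l1 by (simp add: T_def)
  ultimately show ?thesis by blast
qed

text \<open>Borel's lemma. For each order of differentiation all but finitely many terms of the series are
  bounded by a geometric series, so it may be differentiated term by term.\<close>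

theorem borel_tower: "\<exists>D. tower D \<and> (\<forall>n. D n 0 = a n)"
proof -
  obtain T where T: "\<And>n c. tower (T n c)" "\<And>n c j x. j < n \<Longrightarrow> \<bar>T n c j x\<bar> \<le> (1/2) ^ n"
    "\<And>n c j. j < n \<Longrightarrow> T n c j 0 = 0" "\<And>n c. T n c n 0 = c"
    using exists_small_monomial by metis
  \<comment> \<open>each new coefficient corrects the contribution of the earlier terms\<close>
  define f where "f = rec_nat (\<lambda>_. 0) (\<lambda>n g. g(n := a n - (\<Sum>m<n. T m (g m) n 0)))"
  define c where "c = (\<lambda>n. f (Suc n) n)"
  have f: "f k m = c m" if "m < k" for k m
    using that
  proof (induction k)
    case (Suc k)
    show ?case
    proof (cases "m = k")
      case False
      then have "f (Suc k) m = f k m" by (simp add: f_def)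
      then show ?thesis using Suc False by simp
    qed (simp add: c_def)
  qed simp
  have c: "c n = a n - (\<Sum>m<n. T m (c m) n 0)" for n
  proof -
    have "c n = a n - (\<Sum>m<n. T m (f n m) n 0)" by (simp add: c_def f_def)
    then show ?thesis by (simp add: f)
  qed
  define D where "D = (\<lambda>j x. \<Sum>n. T n (c n) j x)"
  have fin: "summable (\<lambda>n. T n (c n) j 0)" for j
    by (rule summable_finite[of "{..j}"]) (auto simp: T(3))
  have "(D j has_real_derivative D (Suc j) x) (at x)" for j x
    unfolding D_def
  proof (rule has_field_derivative_series'(2)[of UNIV _ _ 0])
    show "(T n (c n) j has_real_derivative T n (c n) (Suc j) x) (at x within UNIV)" for n x
      using T(1) unfolding tower_def by simp
    show "uniformly_convergent_on UNIV (\<lambda>n x. \<Sum>i<n. T i (c i) (Suc j) x)"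
    proof (rule Weierstrass_m_test'_ev)
      show "\<forall>\<^sub>F n in sequentially. \<forall>x\<in>UNIV. norm (T n (c n) (Suc j) x) \<le> (1/2) ^ n"
        using T(2) by (intro eventually_sequentiallyI[of "Suc (Suc j)"]) auto
      show "summable (\<lambda>n. (1/2 :: real) ^ n)" by (rule summable_geometric) simp
    qed
  qed (use fin in auto)
  then have "tower D" by (simp add: tower_def)
  moreover have "D n 0 = a n" for n
  proof -
    have "D n 0 = (\<Sum>m\<le>n. T m (c m) n 0)"
      unfolding D_def by (rule suminf_finite) (auto simp: T(3))
    also have "\<dots> = (\<Sum>m<n. T m (c m) n 0) + c n" by (simp add: lessThan_Suc_atMost[symmetric] T(4))
    finally show ?thesis using c[of n] by simp
  qed
  ultimately show ?thesis by blast
qed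

section \<open>Vanishing orders on the unit circle\<close>

text \<open>A common square for the supports of a polynomial and its derivatives, so that evaluations are
  double sums over a fixed range.\<close>

definition in_box :: "nat \<Rightarrow> real fps fps \<Rightarrow> bool" where
  "in_box N F \<longleftrightarrow> (\<forall>j k. F $ j $ k \<noteq> 0 \<longrightarrow> j \<le> N \<and> k \<le> N)"

lemma fps2_eval_in_box:
  assumes "in_box N F"
  shows "fps2_eval F (x, y) = (\<Sum>j\<le>N. \<Sum>k\<le>N. F $ j $ k * x ^ j * y ^ k)"
proof -
  have "fps2_eval F (x, y) = (\<Sum>(j, k)\<in>{..N} \<times> {..N}. F $ j $ k * x ^ j * y ^ k)"
    unfolding fps2_eval_def using assms
    by (simp, intro sum.mono_neutral_left) (auto simp: in_box_def taylor_support_def)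
  then show ?thesis by (simp add: sum.cartesian_product)
qed

lemma in_box_D: "in_box N F \<Longrightarrow> in_box N (D1 F)" "in_box N F \<Longrightarrow> in_box N (D2 F)"
proof -
  assume b: "in_box N F"
  have "Suc j \<le> N \<and> k \<le> N" if "D1 F $ j $ k \<noteq> 0" for j k
    using b that unfolding D1_nth in_box_def by (metis mult_zero_right)
  then show "in_box N (D1 F)" unfolding in_box_def using Suc_leD by blast
  have "j \<le> N \<and> Suc k \<le> N" if "D2 F $ j $ k \<noteq> 0" for j k
    using b that unfolding D2_nth in_box_def by (metis mult_zero_right)
  then show "in_box N (D2 F)" unfolding in_box_def using Suc_leD by blast
qed

lemma has_derivative_fps2_eval:
  assumes b: "in_box N F"
  shows "(fps2_eval F has_derivative (\<lambda>v. fst v * fps2_eval (D1 F) p + snd v * fps2_eval (D2 F) p))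
      (at p)"
proof -
  obtain x y where p: "p = (x, y)" by (cases p)
  have top: "F $ Suc N $ k = 0" "F $ k $ Suc N = 0" for k
    using b unfolding in_box_def by (metis Suc_n_not_le_n)+
  have 1: "(\<Sum>j\<le>N. \<Sum>k\<le>N. F $ j $ k * (real j * x ^ (j - 1)) * y ^ k) = fps2_eval (D1 F) (x, y)"
  proof -
    have "(\<Sum>j\<le>N. \<Sum>k\<le>N. F $ j $ k * (real j * x ^ (j - 1)) * y ^ k)
        = (\<Sum>j\<le>Suc N. \<Sum>k\<le>N. F $ j $ k * (real j * x ^ (j - 1)) * y ^ k)"
      by (simp add: top)
    also have "\<dots> = (\<Sum>j\<le>N. \<Sum>k\<le>N. F $ Suc j $ k * (real (Suc j) * x ^ j) * y ^ k)"
      by (subst sum.atMost_Suc_shift) (simp del: of_nat_Suc)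
    finally show ?thesis by (simp add: fps2_eval_in_box[OF in_box_D(1)[OF b]] D1_nth mult_ac del:
        of_nat_Suc fps_deriv_nth)
  qed
  have 2: "(\<Sum>j\<le>N. \<Sum>k\<le>N. F $ j $ k * x ^ j * (real k * y ^ (k - 1))) = fps2_eval (D2 F) (x, y)"
  proof -
    have "(\<Sum>k\<le>N. F $ j $ k * x ^ j * (real k * y ^ (k - 1)))
        = (\<Sum>k\<le>N. F $ j $ Suc k * x ^ j * (real (Suc k) * y ^ k))" for j
    proof -
      have "(\<Sum>k\<le>N. F $ j $ k * x ^ j * (real k * y ^ (k - 1)))
          = (\<Sum>k\<le>Suc N. F $ j $ k * x ^ j * (real k * y ^ (k - 1)))"
        by (simp add: top)
      also have "\<dots> = (\<Sum>k\<le>N. F $ j $ Suc k * x ^ j * (real (Suc k) * y ^ k))"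
        by (subst sum.atMost_Suc_shift) (simp del: of_nat_Suc)
      finally show ?thesis .
    qed
    then show ?thesis by (simp add: fps2_eval_in_box[OF in_box_D(2)[OF b]] D2_nth mult_ac del:
        of_nat_Suc)
  qed
  have eval: "fps2_eval F = (\<lambda>p. \<Sum>j\<le>N. \<Sum>k\<le>N. F $ j $ k * fst p ^ j * snd p ^ k)"
    by (rule ext) (metis fps2_eval_in_box[OF b] prod.collapse)
  have "(fps2_eval F has_derivative (\<lambda>v. \<Sum>j\<le>N. \<Sum>k\<le>N. fst v * (F $ j $ k * (real j * x ^ (j - 1)) * y
      ^ k)
      + snd v * (F $ j $ k * x ^ j * (real k * y ^ (k - 1))))) (at p)"
    unfolding eval p
    by (intro has_derivative_sum) (auto intro!: derivative_eq_intros simp: algebra_simps)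
  then show ?thesis by (simp only: sum.distrib p 1 2 flip: sum_distrib_left)
qed

lemma partial_fps2_eval:
  assumes "in_box N F"
  shows "partial1 (fps2_eval F) = fps2_eval (D1 F)" "partial2 (fps2_eval F) = fps2_eval (D2 F)"
  using partial_of_has_derivative[OF has_derivative_fps2_eval[OF assms]]
      by (simp_all add: fun_eq_iff)

definition Dpow :: "nat \<Rightarrow> nat \<Rightarrow> real fps fps \<Rightarrow> real fps fps" where
  "Dpow i l F = (D1 ^^ i) ((D2 ^^ l) F)"

lemma D1_D2: "D1 (D2 F) = D2 (D1 F)"
  by (intro fps2_eqI) (simp only: D1_nth D2_nth mult.left_commute)

lemma Dpow_D: "D1 (Dpow i l F) = Dpow (Suc i) l F" "D2 (Dpow i l F) = Dpow i (Suc l) F"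
proof -
  show "D1 (Dpow i l F) = Dpow (Suc i) l F" by (simp add: Dpow_def)
  have "D2 ((D1 ^^ i) A) = (D1 ^^ i) (D2 A)" for A by (induction i) (simp_all flip: D1_D2)
  then show "D2 (Dpow i l F) = Dpow i (Suc l) F" by (simp add: Dpow_def)
qed

lemma in_box_D2pow: "in_box N F \<Longrightarrow> in_box N ((D2 ^^ l) F)"
  by (induction l) (simp_all add: in_box_D)

lemma in_box_Dpow: "in_box N F \<Longrightarrow> in_box N (Dpow i l F)"
  unfolding Dpow_def by (induction i) (simp_all add: in_box_D in_box_D2pow)

lemma taylor_coeff_eval:
  assumes "in_box N F"
  shows "taylor_coeff (fps2_eval F) p i l = fps2_eval (Dpow i l F) p / (fact i * fact l)"
proof -
  have 2: "(partial2 ^^ l) (fps2_eval F) = fps2_eval ((D2 ^^ l) F)"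
    by (induction l) (simp_all add: partial_fps2_eval(2)[OF in_box_D2pow[OF assms]])
  have "(partial1 ^^ i) (fps2_eval ((D2 ^^ l) F)) = fps2_eval (Dpow i l F)"
  proof (induction i)
    case (Suc i)
    then show ?case using partial_fps2_eval(1)[OF in_box_Dpow[OF assms]] Dpow_D(1) by simp
  qed (simp add: Dpow_def)
  then show ?thesis by (simp add: taylor_coeff_def 2)
qed

lemma D2pow_nth: "(D2 ^^ l) F $ j $ k = fact l * real ((k + l) choose l) * F $ j $ (k + l)"
proof (induction l arbitrary: k)
  case (Suc l)
  have "(D2 ^^ Suc l) F $ j $ k = real (Suc k) * (fact l * real ((Suc k + l) choose l) * F $ j $
      (Suc k + l))"
    by (simp add: D2_nth Suc del: of_nat_Suc)
  moreover have "real (Suc k) * (fact l * real ((Suc k + l) choose l))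
      = fact (Suc l) * real ((k + Suc l) choose Suc l)"
  proof -
    have "Suc k * ((Suc k + l) choose l) = (Suc k + l) * ((k + l) choose l)"
      using binomial_absorb_comp[of "Suc k + l" l] by simp
    also have "\<dots> = Suc l * ((k + Suc l) choose Suc l)"
      using binomial_absorption[of l "Suc k + l"] by simp
    finally have "real (Suc k) * real ((Suc k + l) choose l)
        = real (Suc l) * real ((k + Suc l) choose Suc l)"
      by (metis of_nat_mult)
    then show ?thesis unfolding fact_Suc by (metis mult.assoc mult.left_commute of_nat_fact
        of_nat_mult)
  qed
  ultimately show ?case by (metis add_Suc_right add_Suc mult.assoc)
qed simp

lemma D1pow_nth_0: "(D1 ^^ i) F $ 0 $ k = fact i * F $ i $ k"
proof -
  have "(D1 ^^ i) F $ j $ k = fact (i + j) / fact j * F $ (i + j) $ k" for j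
  proof (induction i arbitrary: j)
    case (Suc i)
    have "(D1 ^^ Suc i) F $ j $ k = real (Suc j) * (D1 ^^ i) F $ Suc j $ k"
      by (simp only: funpow.simps o_def D1_nth)
    also have "\<dots> = real (Suc j) * (fact (i + Suc j) / fact (Suc j) * F $ (i + Suc j) $ k)"
        by (simp only: Suc)
    also have "\<dots> = fact (Suc i + j) / fact j * F $ (Suc i + j) $ k" by simp
    finally show ?case .
  qed simp
  from this[of 0] show ?thesis by simp
qed

subsection \<open>Quasi-homogeneous polynomials\<close>

text \<open>Nonzero polynomials that are quasi-homogeneous for the weights \<open>(1, s)\<close>.\<close>

locale line_polynomial =
  fixes P :: "real fps fps" and s L :: nat
  assumes s: "1 \<le> s" and P0: "P \<noteq> 0" and on_line: "\<And>j k. P $ j $ k \<noteq> 0 \<Longrightarrow> j + s * k = L"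
begin

abbreviation "p \<equiv> linepoly P s L"

lemma in_box: "in_box L P"
  unfolding in_box_def
proof (intro allI impI)
  fix j k assume "P $ j $ k \<noteq> 0"
  then have "j + s * k = L" by (rule on_line)
  moreover have "k \<le> s * k" using s by simp
  ultimately show "j \<le> L \<and> k \<le> L" by linarith
qed

lemma coeff_p: "P $ j $ k \<noteq> 0 \<Longrightarrow> coeff p k = P $ j $ k"
  using on_line[of j k] by (auto simp: coeff_linepoly[OF s])

lemma p_nonzero: "p \<noteq> 0"
proof -
  obtain j k where "P $ j $ k \<noteq> 0" using P0 by (auto simp: fps_nonzero_nth)
  then show ?thesis using coeff_p by (metis coeff_0)
qed

lemma eval_Dpow_0:
  assumes x: "x \<noteq> 0"
  shows "s * l \<le> L \<Longrightarrow> fps2_eval (Dpow 0 l P) (x, b * x ^ s)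
      = fact l * x ^ (L - s * l) * coeff (pcompose p [:b, 1:]) l"
    and "L < s * l \<Longrightarrow> fps2_eval (Dpow 0 l P) (x, b * x ^ s) = 0"
proof -
  have "fps2_eval (Dpow 0 l P) (x, b * x ^ s) = (\<Sum>k\<le>L. \<Sum>j\<le>L. (D2 ^^ l) P $ j $ k * x ^ j * (b * x ^
      s) ^ k)"
    unfolding fps2_eval_in_box[OF in_box_Dpow[OF in_box]] by (subst sum.swap) (simp add: Dpow_def)
  also have "\<dots> = (\<Sum>k\<le>L. if s * (k + l) \<le> L then fact l * real ((k + l) choose l) * P $ (L - s * (k +
      l)) $ (k + l) * x ^ (L - s * (k + l)) * (b * x ^ s) ^ k else 0)"
  proof (intro sum.cong refl)
    fix k
    have "(D2 ^^ l) P $ j $ k * x ^ j * (b * x ^ s) ^ k = (if j = L - s * (k + l) then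
        if s * (k + l) \<le> L then
       fact l * real ((k + l) choose l) * P $ (L - s * (k + l)) $ (k + l) * x ^ (L - s * (k + l)) *
           (b * x ^ s) ^ k else 0 else 0)" for j
    proof (cases "P $ j $ (k + l) = 0")
      case True
      then show ?thesis by (auto simp: D2pow_nth)
    next
      case False
      then have "j + s * (k + l) = L" by (rule on_line)
      then have "j = L - s * (k + l)" "s * (k + l) \<le> L" by linarith+
      then show ?thesis by (simp add: D2pow_nth)
    qed
    then show "(\<Sum>j\<le>L. (D2 ^^ l) P $ j $ k * x ^ j * (b * x ^ s) ^ k) = (if s * (k + l) \<le> L then
       fact l * real ((k + l) choose l) * P $ (L - s * (k + l)) $ (k + l) * x ^ (L - s * (k + l)) *
           (b * x ^ s) ^ k else 0)"
      by (simp only: sum.delta finite_atMost) auto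
  qed
  finally have e: "fps2_eval (Dpow 0 l P) (x, b * x ^ s) = \<dots>" .
  show "fps2_eval (Dpow 0 l P) (x, b * x ^ s) = 0" if "L < s * l"
    unfolding e using that by (intro sum.neutral) (auto simp: distrib_left)
  assume sl: "s * l \<le> L"
  define h where "h = (\<lambda>c. if l \<le> c then if s * c
      \<le> L then fact l * x ^ (L - s * l) * (P $ (L - s * c) $ c * (real (c choose l) * b ^ (c - l)))
      else 0 else 0)"
  have "(if s * (k + l) \<le> L then fact l * real ((k + l) choose l) * P $ (L - s * (k + l)) $ (k + l)
      * x ^ (L - s * (k + l)) * (b * x ^ s) ^ k else 0) = h (k + l)" for k
  proof (cases "s * (k + l) \<le> L")
    case True
    then have "L - s * l = (L - s * (k + l)) + s * k" by (simp add: distrib_left)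
    then have "x ^ (L - s * l) = x ^ (L - s * (k + l)) * (x ^ s) ^ k"
        by (simp only: power_add power_mult)
    then show ?thesis using True by (simp add: h_def power_mult_distrib mult_ac)
  qed (simp add: h_def)
  then have "fps2_eval (Dpow 0 l P) (x, b * x ^ s) = (\<Sum>k\<le>L. h (k + l))" unfolding e by (simp only:)
  also have "\<dots> = (\<Sum>c\<in>{l..L + l}. h c)"
    by (rule sum.reindex_bij_witness[of _ "\<lambda>c. c - l" "\<lambda>k. k + l"]) auto
  also have "\<dots> = (\<Sum>c\<le>L + l. h c)" by (intro sum.mono_neutral_left) (auto simp: h_def)
  also have "\<dots> = (\<Sum>c\<le>L. h c)"
  proof (intro sum.mono_neutral_right ballI)
    fix c assume "c \<in> {..L + l} - {..L}"
    then have "L < c" by simp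
    also have "c \<le> s * c" using s by simp
    finally show "h c = 0" by (simp add: h_def)
  qed auto
  also have "\<dots> = fact l * x ^ (L - s * l) * coeff (pcompose p [:b, 1:]) l"
    unfolding coeff_pcompose_linepoly sum_distrib_left by (intro sum.cong refl) (simp add: h_def)
  finally show "fps2_eval (Dpow 0 l P) (x, b * x ^ s)
      = fact l * x ^ (L - s * l) * coeff (pcompose p [:b, 1:]) l" .
qed

text \<open>Along the curve \<open>x\<^sub>2 = b x\<^sub>1\<^sup>s\<close> the pure \<open>x\<^sub>2\<close>-derivatives below the multiplicity vanish.
  Differentiating along the curve trades an \<open>x\<^sub>2\<close>-derivative for an \<open>x\<^sub>1\<close>-derivative.\<close>

lemma eval_Dpow_low:
  assumes "i + l < order b p" "x \<noteq> 0"
  shows "fps2_eval (Dpow i l P) (x, b * x ^ s) = 0"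
  using assms
proof (induction i arbitrary: l x)
  case 0
  then have "coeff (pcompose p [:b, 1:]) l = 0"
      by (intro order_as_lowest_coeff(2)[OF p_nonzero]) simp
  then show ?case using eval_Dpow_0[OF 0(2), of l b] by (cases "s * l \<le> L") auto
next
  case (Suc i)
  let ?Q = "Dpow i l P"
  have "((\<lambda>t. (t, b * t ^ s)) has_derivative (\<lambda>h. (h, b * (real s * h * x ^ (s - 1))))) (at x)"
    by (auto intro!: derivative_eq_intros)
  from has_derivative_compose[OF this has_derivative_fps2_eval[OF in_box_Dpow[OF in_box]]]
  have d: "((\<lambda>t. fps2_eval ?Q (t, b * t ^ s)) has_derivative (\<lambda>h. h * fps2_eval (D1 ?Q) (x, b * x ^
      s)
      + b * (real s * h * x ^ (s - 1)) * fps2_eval (D2 ?Q) (x, b * x ^ s))) (at x)" by simp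
  have "((\<lambda>t :: real. 0 :: real) has_derivative (\<lambda>h. h * fps2_eval (D1 ?Q) (x, b * x ^ s)
      + b * (real s * h * x ^ (s - 1)) * fps2_eval (D2 ?Q) (x, b * x ^ s))) (at x)"
  proof (rule has_derivative_transform_within_open[OF d])
    show "open (- {0 :: real})" by (simp add: open_Compl)
    show "fps2_eval ?Q (t, b * t ^ s) = 0" if "t \<in> - {0}" for t
      using that Suc.prems by (intro Suc.IH) auto
  qed (use Suc.prems in simp)
  then have "(\<lambda>h. h * fps2_eval (D1 ?Q) (x, b * x ^ s) + b * (real s * h * x ^ (s - 1)) * fps2_eval
      (D2 ?Q) (x, b * x ^ s)) = (\<lambda>h. 0)"
    using has_derivative_unique has_derivative_const by blast
  from fun_cong[OF this, of 1] have "fps2_eval (D1 ?Q) (x, b * x ^ s) + b * (real s * x ^ (s - 1)) *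
      fps2_eval (D2 ?Q) (x, b * x ^ s) = 0" by simp
  moreover have "fps2_eval (D2 ?Q) (x, b * x ^ s) = 0" using Suc.prems unfolding Dpow_D
      by (intro Suc.IH) auto
  ultimately show ?case by (simp add: Dpow_D)
qed

lemma vanishing_order_off_axis:
  assumes "x \<noteq> 0"
  shows "vanishing_order (fps2_eval P) (x, b * x ^ s) = order b p"
  unfolding vanishing_order_def
proof (rule Least_equality)
  let ?n = "order b p"
  have nz: "coeff (pcompose p [:b, 1:]) ?n \<noteq> 0" by (rule order_as_lowest_coeff(1)[OF p_nonzero])
  have "?n \<le> degree p" by (rule order_degree[OF p_nonzero])
  then have "s * ?n \<le> L" using linepoly_top(1)[OF s p_nonzero] by (meson le_trans mult_le_mono2)
  then have "taylor_coeff (fps2_eval P) (x, b * x ^ s) 0 ?n \<noteq> 0"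
    using eval_Dpow_0(1)[OF assms] nz assms by (simp add: taylor_coeff_eval[OF in_box])
  then show "\<exists>j k. j + k = ?n \<and> taylor_coeff (fps2_eval P) (x, b * x ^ s) j k \<noteq> 0"
    by (intro exI[of _ 0] exI[of _ ?n]) simp
next
  fix m assume "\<exists>j k. j + k = m \<and> taylor_coeff (fps2_eval P) (x, b * x ^ s) j k \<noteq> 0"
  then obtain j k where "j + k = m" "fps2_eval (Dpow j k P) (x, b * x ^ s) \<noteq> 0"
    by (auto simp: taylor_coeff_eval[OF in_box])
  then show "order b p \<le> m" using eval_Dpow_low[of j k b x] assms by (meson not_le)
qed

text \<open>On the \<open>x\<^sub>2\<close>-axis the \<open>j\<close>-th derivative in \<open>x\<^sub>1\<close> sees only the monomials with first exponent
  \<open>j\<close>, and the line carries just one of them.\<close>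

lemma vanishing_order_axis:
  assumes jk: "P $ j $ k \<noteq> 0" and y: "y \<noteq> 0"
  shows "vanishing_order (fps2_eval P) (0, y) \<le> j"
  unfolding vanishing_order_def
proof (rule Least_le, intro exI conjI)
  show "j + 0 = j" by simp
  have "fps2_eval (Dpow j 0 P) (0, y) = (\<Sum>i\<le>L. if i
      = 0 then \<Sum>k\<le>L. Dpow j 0 P $ 0 $ k * y ^ k else 0)"
    unfolding fps2_eval_in_box[OF in_box_Dpow[OF in_box]]
        by (intro sum.cong refl) (auto simp: power_0_left intro!: sum.neutral)
  also have "\<dots> = (\<Sum>k\<le>L. fact j * P $ j $ k * y ^ k)" by (simp add: Dpow_def D1pow_nth_0)
  also have "\<dots> = (\<Sum>k'\<le>L. if k' = k then fact j * P $ j $ k * y ^ k else 0)"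
  proof (intro sum.cong refl)
    fix k'
    have "P $ j $ k' = 0" if "k' \<noteq> k"
    proof (rule ccontr)
      assume "P $ j $ k' \<noteq> 0"
      then have "s * k' = s * k" using on_line jk by (metis add_left_cancel)
      then show False using that s by simp
    qed
    then show "fact j * P $ j $ k' * y ^ k' = (if k' = k then fact j * P $ j $ k * y ^ k else 0)"
        by simp
  qed
  also have "\<dots> = fact j * P $ j $ k * y ^ k" using in_box jk by (simp add: in_box_def)
  finally show "taylor_coeff (fps2_eval P) (0, y) j 0 \<noteq> 0"
    using jk y by (simp add: taylor_coeff_eval[OF in_box])
qed

lemma vanishing_order_cases:
  assumes "z \<in> sphere 0 1" "P $ j $ k \<noteq> 0"
  shows "fst z \<noteq> 0 \<Longrightarrow> vanishing_order (fps2_eval P) z = order (snd z / fst z ^ s) p"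
    and "fst z = 0 \<Longrightarrow> vanishing_order (fps2_eval P) z \<le> j"
proof -
  show "vanishing_order (fps2_eval P) z = order (snd z / fst z ^ s) p" if "fst z \<noteq> 0"
    using vanishing_order_off_axis[OF that, of "snd z / fst z ^ s"] that by (cases z) simp
  show "vanishing_order (fps2_eval P) z \<le> j" if "fst z = 0"
  proof -
    have "snd z \<noteq> 0" using assms(1) that by (cases z) (auto simp: norm_prod_def)
    then show ?thesis using vanishing_order_axis[OF assms(2), of "snd z"] that by (cases z) simp
  qed
qed

lemma finite_vanishing_orders: "finite (vanishing_order (fps2_eval P) ` sphere 0 1)"
proof -
  obtain j k where jk: "P $ j $ k \<noteq> 0" using P0 by (auto simp: fps_nonzero_nth)
  have "vanishing_order (fps2_eval P) ` sphere 0 1 \<subseteq> {..max (degree p) j}"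
  proof
    fix m assume "m \<in> vanishing_order (fps2_eval P) ` sphere 0 1"
    then obtain z where z: "z \<in> sphere 0 1" "m = vanishing_order (fps2_eval P) z" by blast
    show "m \<in> {..max (degree p) j}"
      using vanishing_order_cases[OF z(1) jk] order_degree[OF p_nonzero] z(2)
      by (cases "fst z = 0") (auto simp: le_max_iff_disj)
  qed
  then show ?thesis by (rule finite_subset) simp
qed

lemma circle_order_ge: "z \<in> sphere 0 1 \<Longrightarrow> vanishing_order (fps2_eval P) z \<le> circle_order P"
  unfolding circle_order_def by (intro Max_ge finite_vanishing_orders) auto

lemma circle_order_attained:
  obtains z where "z \<in> sphere 0 1" "vanishing_order (fps2_eval P) z = circle_order P"
proof -
  have "(1, 0) \<in> sphere (0 :: real \<times> real) 1" by (simp add: norm_prod_def)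
  then have "vanishing_order (fps2_eval P) ` sphere 0 1 \<noteq> {}" by blast
  then have "circle_order P \<in> vanishing_order (fps2_eval P) ` sphere 0 1"
    unfolding circle_order_def by (intro Max_in finite_vanishing_orders)
  then show ?thesis using that by auto
qed

lemma curve_meets_circle:
  obtains x where "x \<noteq> 0" "(x, b * x ^ s) \<in> sphere (0 :: real \<times> real) 1"
proof -
  let ?h = "\<lambda>x. x\<^sup>2 + (b * x ^ s)\<^sup>2"
  have "\<exists>x\<ge>0. x \<le> 1 \<and> ?h x = 1"
    by (rule IVT') (use s in \<open>auto intro!: continuous_intros simp: power_0_left\<close>)
  then obtain x where x: "?h x = 1" by blast
  have "x \<noteq> 0"
  proof
    assume "x = 0"
    then show False using x s by (simp add: power_0_left)
  qed
  then show ?thesis using that[of x] x by (simp add: norm_prod_def)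
qed

text \<open>Off the \<open>x\<^sub>2\<close>-axis the orders of vanishing are the multiplicities of the roots
  \<open>b = x\<^sub>2 / x\<^sub>1\<^sup>s\<close>. On the axes the order is at most the corresponding smallest exponent, which
  is below \<open>d\<close>.\<close>

theorem circle_order_criterion:
  assumes jk: "P $ j $ k \<noteq> 0" "real j < d" and jk': "P $ j' $ k' \<noteq> 0" "real k' < d"
  shows "((\<forall>z\<in>sphere 0 1. vanishing_order (fps2_eval P) z = circle_order P \<longrightarrow> fst z \<noteq> 0 \<and> snd z \<noteq> 0)
      \<and>
      d < real (circle_order P)) \<longleftrightarrow> (\<exists>b. b \<noteq> 0 \<and> d < real (order b p))"
proof (intro iffI conjI)
  assume a: "(\<forall>z\<in>sphere 0 1. vanishing_order (fps2_eval P) z = circle_order P \<longrightarrow> fst z \<noteq> 0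
      \<and> snd z \<noteq> 0) \<and>
      d < real (circle_order P)"
  obtain z where z: "z \<in> sphere 0 1" "vanishing_order (fps2_eval P) z = circle_order P"
      by (rule circle_order_attained)
  then have nz: "fst z \<noteq> 0" "snd z \<noteq> 0" using a by blast+
  have "vanishing_order (fps2_eval P) z = order (snd z / fst z ^ s) p"
    by (rule vanishing_order_cases(1)[OF z(1) jk(1) nz(1)])
  then show "\<exists>b. b \<noteq> 0 \<and> d < real (order b p)" using a z(2) nz
      by (intro exI[of _ "snd z / fst z ^ s"]) simp
next
  assume "\<exists>b. b \<noteq> 0 \<and> d < real (order b p)"
  then obtain b where b: "b \<noteq> 0" "d < real (order b p)" by blast
  obtain x where x: "x \<noteq> 0" "(x, b * x ^ s) \<in> sphere (0 :: real \<times> real) 1"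
      by (rule curve_meets_circle)
  have "order b p \<le> circle_order P" using circle_order_ge[OF x(2)] vanishing_order_off_axis[OF x(1)]
      by simp
  then show d: "d < real (circle_order P)" using b(2) by linarith
  show "\<forall>z\<in>sphere 0 1. vanishing_order (fps2_eval P) z = circle_order P \<longrightarrow> fst z \<noteq> 0 \<and> snd z \<noteq> 0"
  proof (intro ballI impI)
    fix z :: "real \<times> real" assume z: "z \<in> sphere 0 1" "vanishing_order (fps2_eval P) z
        = circle_order P"
    have f: "fst z \<noteq> 0" using vanishing_order_cases(2)[OF z(1) jk(1)] z(2) d jk(2) by fastforce
    have "snd z \<noteq> 0"
    proof
      assume "snd z = 0"
      then have "circle_order P = order 0 p" using vanishing_order_cases(1)[OF z(1) jk(1) f] z(2)
          by simp
      moreover have "order 0 p \<le> k'"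
        using order_as_lowest_coeff(2)[OF p_nonzero, of k' 0] coeff_p[OF jk'(1)] jk'(1)
            by (simp add: not_less[symmetric]) blast
      ultimately show False using d jk'(2) by linarith
    qed
    with f show "fst z \<noteq> 0 \<and> snd z \<noteq> 0" by blast
  qed
qed

end

section \<open>Construction of adapted coordinates\<close>

text \<open>The invariant of the construction: all supporting lines at the new \<open>(d, d)\<close> have ratio \<open>v / u\<close>
  above the degree of \<open>q\<close>. It forces the next exponent to exceed the degree, it excludes dominant
  roots with \<open>s \<ge> 2\<close> after an interchange of the coordinates, and it is the degree bound wanted in the
  end.\<close>

definition steep_shear :: "real fps fps \<Rightarrow> real poly \<Rightarrow> bool" where
  "steep_shear F q \<longleftrightarrow> poly q 0 = 0 \<and>
     (\<forall>u v. 0 \<le> u \<and> 0 \<le> v \<and> 0 < u + v \<and>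
        weight_ge u v (nd (fshear F (fps_of_poly q)) * (u + v)) (fshear F (fps_of_poly q)) \<longrightarrow>
        u \<le> v \<and> (0 < u \<longrightarrow> real (degree q) * u < v))"

lemma steep_shear_0:
  assumes F: "F \<noteq> 0" and b: "dominant_root F s L \<beta> n"
  shows "steep_shear F 0"
  unfolding steep_shear_def
proof (intro conjI allI impI)
  fix u v assume a: "0 \<le> u \<and> 0 \<le> v \<and> 0 < u + v \<and>
    weight_ge u v (nd (fshear F (fps_of_poly 0)) * (u + v)) (fshear F (fps_of_poly 0))"
  then have v: "v = real s * u" using dominant_root_unique_weights[OF F b, of u v]
      by (simp add: fshear_0)
  have s: "1 \<le> s" using b by (simp add: dominant_root_def)
  have "1 * u \<le> real s * u" using s a by (intro mult_right_mono) auto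
  then show "u \<le> v" using v by simp
  show "real (degree (0 :: real poly)) * u < v" if "0 < u" using that s v by simp
qed simp

lemma fshear_nonzero: "F \<noteq> 0 \<Longrightarrow> g $ 0 = 0 \<Longrightarrow> fshear F g \<noteq> 0"
  using fshear_eq_0 by blast

lemma fps_of_poly_0_nth: "poly q 0 = 0 \<Longrightarrow> fps_of_poly q $ 0 = 0"
  by (simp add: poly_0_coeff_0)

text \<open>The point \<open>(L - s n, n)\<close> of the new support lies above the bisectrix, and the new \<open>(d, d)\<close> lies
  strictly beyond the line of slope ratio \<open>s\<close> through that point. So a supporting line at \<open>(d, d)\<close>
  has a larger ratio.\<close>

lemma steep_shear_step:
  assumes F: "F \<noteq> 0" and g: "steep_shear F q"
      and b: "dominant_root (fshear F (fps_of_poly q)) s L \<beta> n"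
  shows "degree q < s" "steep_shear F (q + monom \<beta> s)" "degree (q + monom \<beta> s) = s"
proof -
  let ?G = "fshear F (fps_of_poly q)" and ?m = "monom \<beta> s"
  have q0: "poly q 0 = 0" using g by (simp add: steep_shear_def)
  have G: "?G \<noteq> 0" by (rule fshear_nonzero[OF F fps_of_poly_0_nth[OF q0]])
  have B: "1 \<le> s" "\<beta> \<noteq> 0" "real L = nd ?G * (1 + real s)" "weight_ge 1 (real s) (real L) ?G" using b
      unfolding dominant_root_def by blast+
  have "0 \<le> (1 :: real) \<and> 0 \<le> real s \<and> 0 < 1 + real s
      \<and> weight_ge 1 (real s) (nd ?G * (1 + real s)) ?G" using B by auto
  then have "real (degree q) * 1 < real s" using g unfolding steep_shear_def
      by (metis zero_less_one)
  then show deg: "degree q < s" by simp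
  have "degree ?m = s" using B(2) by (simp add: degree_monom_eq)
  then show dq: "degree (q + ?m) = s" using deg by (simp add: degree_add_eq_right)
  have m0: "poly ?m 0 = 0" using B(1) by (simp add: poly_monom)
  have low: "fps_of_poly ?m $ i = 0" if "i < s" for i using that by (simp add: coeff_monom)
  have at: "fps_of_poly ?m $ s = \<beta>" by simp
  have G': "fshear F (fps_of_poly (q + ?m)) = fshear ?G (fps_of_poly ?m)"
    using fshear_fshear[OF fps_of_poly_0_nth[OF q0] fps_of_poly_0_nth[OF m0]]
        by (simp add: fps_of_poly_add)
  note bs = dominant_root_shear[OF G b low at]
  show "steep_shear F (q + ?m)"
    unfolding steep_shear_def dq G'
  proof (intro conjI allI impI)
    show "poly (q + ?m) 0 = 0" using q0 m0 by simp
    let ?d = "nd ?G" and ?d' = "nd (fshear ?G (fps_of_poly ?m))"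
    fix u v assume a: "0 \<le> u \<and> 0 \<le> v \<and> 0 < u + v
        \<and> weight_ge u v (?d' * (u + v)) (fshear ?G (fps_of_poly ?m))"
    have key: "real s * u < v" if u: "0 < u"
    proof (rule ccontr)
      assume "\<not> real s * u < v"
      then have e: "0 \<le> real s * u - v" by simp
      have "?d' * (u + v) \<le> u * real (L - s * n) + v * real n" using a weight_geD[OF _ bs(2)]
          by blast
      also have "\<dots> = u * (?d * (1 + real s)) - (real s * u - v) * real n"
        using bs(1) B(3) by (simp add: of_nat_diff algebra_simps)
      also have "\<dots> \<le> u * (?d * (1 + real s)) - (real s * u - v) * ?d'"
        using e bs(6) by (simp add: mult_left_mono)
      finally have "u * (1 + real s) * ?d' \<le> u * (1 + real s) * ?d" by (simp add: algebra_simps)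
      moreover have "0 < u * (1 + real s)" using u by (simp add: add_pos_nonneg)
      ultimately have "?d' \<le> ?d" by (simp only: mult_le_cancel_left_pos)
      then show False using bs(5) by simp
    qed
    then show "real s * u < v" if "0 < u" using that .
    show "u \<le> v"
    proof (cases "0 < u")
      case True
      have "1 * u \<le> real s * u" using B(1) True by (intro mult_right_mono) auto
      then show ?thesis using key[OF True] by simp
    qed (use a in simp)
  qed
qed

lemma steep_shear_terminal_height:
  assumes F: "F \<noteq> 0" and g: "steep_shear F q"
      and nb: "\<And>s L \<beta> n. \<not> dominant_root (fshear F (fps_of_poly q)) s L \<beta> n"
  shows "formal_height (fshear F (fps_of_poly q)) = nd (fshear F (fps_of_poly q))"
proof (rule height_no_dominant_root[OF _ nb])
  let ?G = "fshear F (fps_of_poly q)"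
  have "poly q 0 = 0" using g by (simp add: steep_shear_def)
  then show "?G \<noteq> 0" by (intro fshear_nonzero[OF F fps_of_poly_0_nth])
  fix s L \<beta> n assume "dominant_root (swap_vars ?G) s L \<beta> n"
  then have "weight_ge 1 (real s) (nd ?G * (1 + real s)) (swap_vars ?G)"
      unfolding dominant_root_def distance_swap_vars by metis
  then have "weight_ge (real s) 1 (nd ?G * (real s + 1)) ?G"
      by (simp add: swap_vars_weight_ge add.commute)
  then have "0 \<le> real s \<and> 0 \<le> (1 :: real) \<and> 0 < real s + 1
      \<and> weight_ge (real s) 1 (nd ?G * (real s + 1)) ?G" by simp
  then have "real s \<le> 1" using g unfolding steep_shear_def by blast
  then show "\<not> 2 \<le> s" by simp
qed

text \<open>The exponents \<open>s\<^sub>l\<close> increase, so the removed terms form a series \<open>g\<close>, and the shear by \<open>g\<close> has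
  the same supporting lines \<open>j + s\<^sub>l k = L\<^sub>l\<close> as all finite stages. With the smallest multiplicity
  \<open>n\<close>, the inequality \<open>s\<^sub>l n \<le> L\<^sub>l \<le> j + s\<^sub>l k\<close> leaves only monomials with \<open>k \<ge> n\<close> as \<open>s\<^sub>l\<close> grows.
  A monomial with \<open>k = n\<close> to the left of the bisectrix survives, so the principal face is
  horizontal.\<close>

lemma infinite_chain:
  assumes F: "F \<noteq> 0" and g0: "steep_shear F 0"
    and all: "\<And>q. steep_shear F q \<Longrightarrow> \<exists>s L \<beta> n. dominant_root (fshear F (fps_of_poly q)) s L \<beta> n"
  obtains g q n s L \<beta> where "g $ 0 = 0" "poly q 0
      = 0" "dominant_root (fshear F (fps_of_poly q)) s L \<beta> n"
    "nd (fshear F g) = real n" "\<not> compact (principal_face (fshear F g))"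
proof -
  let ?F = "\<lambda>q. fshear F (fps_of_poly q)"
  obtain S Lf B N where dominant_root: "\<And>q. steep_shear F q
      \<Longrightarrow> dominant_root (?F q) (S q) (Lf q) (B q) (N q)" using all by metis
  define Q where "Q = rec_nat (0 :: real poly) (\<lambda>_ q. q + monom (B q) (S q))"
  have Q0: "Q 0 = 0" and QS: "Q (Suc l) = Q l + monom (B (Q l)) (S (Q l))" for l
      by (simp_all add: Q_def)
  have gQ: "steep_shear F (Q l)" for l by (induction l) (simp_all add: Q0 QS g0
      steep_shear_step(2)[OF F _ dominant_root])
  define s where "s l = S (Q l)" for l
  note bQ = dominant_root[OF gQ, folded s_def]
  have deg: "degree (Q l) < s l" "degree (Q (Suc l)) = s l" for l
    using steep_shear_step(1,3)[OF F gQ dominant_root[OF gQ], of l] by (simp_all add: QS s_def)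
  have smono: "s l < s (Suc l)" for l using deg(1)[of "Suc l"] deg(2)[of l] by simp
  have mono: "strict_mono s" using smono by (simp add: strict_mono_Suc_iff)
  have sl: "l < s l" for l
  proof (induction l)
    case 0
    show ?case using deg(1)[of 0] by simp
  next
    case (Suc l)
    then show ?case using smono[of l] by simp
  qed
  have stab: "coeff (Q (l + m)) i = coeff (Q l) i" if "i < s l" for i l m
  proof (induction m)
    case (Suc m)
    have "s l \<le> s (l + m)" using mono by (simp add: strict_mono_less_eq)
    then have "i \<noteq> S (Q (l + m))" using that by (simp add: s_def)
    then show ?case using Suc by (simp add: QS coeff_monom)
  qed simp
  define g where "g = Abs_fps (\<lambda>i. coeff (Q i) i)"
  have gl: "g $ i = coeff (Q l) i" if "i < s l" for i l
  proof (cases "i \<le> l")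
    case True
    then show ?thesis using stab[of i i "l - i"] sl by (simp add: g_def)
  next
    case False
    then show ?thesis using stab[of i l "i - l"] that by (simp add: g_def)
  qed
  have g0': "g $ 0 = 0" by (simp add: g_def Q0)
  have q0: "poly (Q l) 0 = 0" for l using gQ[of l] by (simp add: steep_shear_def)
  have tail: "(g - fps_of_poly (Q l)) $ i = 0" if "i < s l" for i l using gl[OF that] by simp
  have lead: "(g - fps_of_poly (Q l)) $ s l = B (Q l)" for l
  proof -
    have "g $ s l = coeff (Q (Suc l)) (s l)" by (rule gl[OF smono])
    then show ?thesis using deg(1)[of l] by (simp add: QS s_def coeff_eq_0)
  qed
  have split: "fshear F g = fshear (?F (Q l)) (g - fps_of_poly (Q l))" for l
    using fshear_fshear[OF fps_of_poly_0_nth[OF q0], of "g - fps_of_poly (Q l)" F l] g0' q0[of l]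
    by (simp add: poly_0_coeff_0)
  have nz: "?F (Q l) \<noteq> 0" for l by (rule fshear_nonzero[OF F fps_of_poly_0_nth[OF q0]])
  note bs = dominant_root_shear[OF nz bQ tail lead, folded split]
  let ?G = "fshear F g"
  have G: "?G \<noteq> 0" by (rule fshear_nonzero[OF F g0'])
  obtain l0 where l0: "\<And>l. N (Q l0) \<le> N (Q l)"
    using ex_has_least_nat[of "\<lambda>_. True" 0 "\<lambda>l. N (Q l)"] by auto
  define n where "n = N (Q l0)"
  have kn: "n \<le> k" if nzc: "?G $ j $ k \<noteq> 0" for j k
  proof -
    \<comment> \<open>any stage with \<open>s\<^sub>l > j\<close> will do\<close>
    let ?l = j
    have "s ?l * n \<le> s ?l * N (Q ?l)" using l0 by (simp add: n_def)
    also have "\<dots> \<le> Lf (Q ?l)" using bs(1) .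
    also have "\<dots> \<le> j + s ?l * k"
    proof -
      have "real (Lf (Q ?l)) \<le> real (j + s ?l * k)" using weight_geD[OF bs(4) nzc] by simp
      then show ?thesis by (simp only: of_nat_le_iff)
    qed
    also have "\<dots> < s ?l * Suc k" using sl[of ?l] by simp
    finally have "n < Suc k" by (simp only: mult_less_cancel1)
    then show ?thesis by simp
  qed
  have "weight_ge 0 1 (real n * (0 + 1)) ?G" using kn by (intro weight_geI) force
  then have "real n \<le> nd ?G" by (intro distance_geI[OF G, of 0 1]) auto
  moreover have "nd ?G \<le> real n" using bs(6)[of l0] by (simp add: n_def)
  ultimately have dn: "nd ?G = real n" by simp
  let ?a = "Lf (Q l0) - s l0 * n"
  have A: "?G $ ?a $ n \<noteq> 0" using bs(2)[of l0] by (simp add: n_def)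
  have "real ?a < nd (?F (Q l0))" using bs(3)[of l0] by (simp add: n_def)
  also have "\<dots> < real n" using bQ[of l0] by (simp add: dominant_root_def n_def)
  finally have an: "real ?a < real n" .
  have A': "(real ?a, real n) \<in> np ?G" by (rule support_in_np[OF A])
  have "(real ?a, real n) + (real n + 1 - real ?a, 0) \<in> np ?G"
    by (rule np_up[OF A']) (use an in simp)
  then have B': "(real n + 1, real n) \<in> np ?G" by simp
  have "diag_edge ?G 0 1"
    unfolding diag_edge_def dn
    using A' B' an \<open>weight_ge 0 1 (real n * (0 + 1)) ?G\<close>
    by (intro conjI bexI[of _ "(real ?a, real n)"] bexI[of _ "(real n + 1, real n)"]) auto
  then have "\<not> compact (principal_face ?G)" using principal_edge_compact[OF G] by simp
  then show ?thesis using that[OF g0' q0[of l0] _ dn] bQ[of l0] by (simp add: n_def)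
qed

subsection \<open>Supporting lines and rationality\<close>

lemma diagonal_in_principal_face:
  assumes F: "F \<noteq> 0"
  shows "(nd F, nd F) \<in> principal_face F"
proof (cases "\<exists>u v. diag_edge F u v")
  case True
  then obtain u v where E: "diag_edge F u v" by blast
  then have uv: "u + v = 1" by (simp add: diag_edge_def)
  have "u * nd F + v * nd F = nd F" by (metis uv distrib_right mult_1)
  then show ?thesis using diagonal_in_np[OF F] by (simp add: principal_face_edge(1)[OF F E])
next
  case False
  then show ?thesis using principal_face_vertex[OF F] by (metis singletonI)
qed

lemma diag_edge_integral:
  assumes "diag_edge F u v" "u = 0 \<or> v = 0"
  shows "nd F \<in> \<int>"
proof -
  have "u + v = 1" using assms(1) by (simp add: diag_edge_def)
  with assms(2) consider "u = 0" "v = 1" | "u = 1" "v = 0" by force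
  then show ?thesis
  proof cases
    case 1
    then obtain j k where "u * real j + v * real k = nd F" using diag_edge_support(1)[OF assms(1)]
        by auto
    then have "nd F = real k" using 1 by simp
    then show ?thesis by simp
  next
    case 2
    then obtain j k where "u * real j + v * real k = nd F" using diag_edge_support(2)[OF assms(1)]
        by auto
    then have "nd F = real j" using 2 by simp
    then show ?thesis by simp
  qed
qed

text \<open>Cramer's rule for the intersection of the bisectrix with the line through two lattice points.\<close>

lemma distance_rational:
  assumes F: "F \<noteq> 0"
  shows "nd F \<in> \<rat>"
proof (cases "\<exists>u v. diag_edge F u v")
  case False
  then obtain D where "nd F = real D" using principal_face_vertex[OF F] by metis
  then show ?thesis by simp
next
  case True
  then obtain u v where E: "diag_edge F u v" by blast
  show ?thesis
  proof (cases "u = 0 \<or> v = 0")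
    case True
    then show ?thesis using diag_edge_integral[OF E] Ints_subset_Rats by blast
  next
    case False
    have uv: "0 < u" "0 < v" "u + v = 1" using E False by (auto simp: diag_edge_def)
    obtain j k where 1: "u * real j + v * real k = nd F" "real j < nd F"
        using diag_edge_support(1)[OF E uv(2)] by blast
    obtain j' k' where 2: "u * real j' + v * real k' = nd F" "real k' < nd F"
        using diag_edge_support(2)[OF E uv(1)] by blast
    let ?d = "nd F"
    have du: "?d = u * ?d + v * ?d" by (metis uv(3) distrib_right mult_1)
    have e1: "u * (real j - ?d) = - (v * (real k - ?d))" using 1(1) du
        by (simp add: right_diff_distrib)
    have e2: "u * (real j' - ?d) = - (v * (real k' - ?d))" using 2(1) du
        by (simp add: right_diff_distrib)
    have "u * (real j - ?d) < 0" using uv(1) 1(2) by (simp add: mult_pos_neg)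
    then have "0 < v * (real k - ?d)" using e1 by simp
    then have k: "?d < real k" using uv(2) by (simp add: zero_less_mult_iff)
    have "v * (real k' - ?d) < 0" using uv(2) 2(2) by (simp add: mult_pos_neg)
    then have "0 < u * (real j' - ?d)" using e2 by simp
    then have j': "?d < real j'" using uv(1) by (simp add: zero_less_mult_iff)
    have "u * v * ((real j - ?d) * (real k' - ?d)) = u * v * ((real j' - ?d) * (real k - ?d))"
    proof -
      have "u * v * ((real j - ?d) * (real k' - ?d)) = (u * (real j - ?d)) * (v * (real k' - ?d))"
          by (simp only: mult_ac)
      also have "\<dots> = - ((v * (real k - ?d)) * (v * (real k' - ?d)))"
          by (simp only: e1 mult_minus_left)
      also have "\<dots> = - ((v * (real k' - ?d)) * (v * (real k - ?d)))" by (simp only: mult.commute)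
      also have "\<dots> = (u * (real j' - ?d)) * (v * (real k - ?d))" by (simp only: e2 mult_minus_left)
      finally show ?thesis by (simp only: mult_ac)
    qed
    then have "(real j - ?d) * (real k' - ?d) = (real j' - ?d) * (real k - ?d)" using uv by simp
    then have "?d * (real j + real k' - real j' - real k) = real j * real k' - real j' * real k"
        by (simp add: algebra_simps)
    moreover have "real j + real k' - real j' - real k \<noteq> 0" using 1(2) 2(2) k j' by linarith
    ultimately have "?d = (real j * real k' - real j' * real k) / (real j + real k' - real j' - real
        k)"
      by (simp add: eq_divide_eq)
    then show ?thesis by simp
  qed
qed

lemma supporting_line_weight_ge:
  assumes F: "F \<noteq> 0" and sl: "supporting_line \<mu>1 \<mu>2 F" "principal_face F \<subseteq> weight_line \<mu>1 \<mu>2"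
  shows "weight_ge \<mu>1 \<mu>2 (nd F * (\<mu>1 + \<mu>2)) F" "\<mu>1 + \<mu>2 \<noteq> 0"
proof -
  have "(nd F, nd F) \<in> weight_line \<mu>1 \<mu>2" using diagonal_in_principal_face[OF F] sl(2) by blast
  then have 1: "nd F * (\<mu>1 + \<mu>2) = 1" by (simp add: weight_line_def algebra_simps)
  then show "\<mu>1 + \<mu>2 \<noteq> 0" by auto
  show "weight_ge \<mu>1 \<mu>2 (nd F * (\<mu>1 + \<mu>2)) F"
    unfolding 1
  proof (rule weight_geI)
    fix j k assume "F $ j $ k \<noteq> 0"
    then have "(real j, real k) \<in> np F" by (rule support_in_np)
    then show "1 \<le> \<mu>1 * real j + \<mu>2 * real k" using sl(1) by (auto simp: supporting_line_def)
  qed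
qed

text \<open>A vertex on the bisectrix and an unbounded face both have integral distance.\<close>

lemma non_integral_distance:
  assumes F: "F \<noteq> 0" and n: "nd F \<notin> \<int>"
  obtains u v where "0 < u" "0 < v" "diag_edge F u v" "compact (principal_face F)"
    "supporting_line (u / nd F) (v / nd F) F" "principal_face F \<subseteq> weight_line (u / nd F) (v / nd F)"
proof -
  have "\<exists>u v. diag_edge F u v"
  proof (rule ccontr)
    assume "\<nexists>u v. diag_edge F u v"
    then obtain D where "nd F = real D" using principal_face_vertex[OF F] by metis
    then show False using n by simp
  qed
  then obtain u v where E: "diag_edge F u v" by blast
  have uv: "0 \<le> u" "0 \<le> v" "weight_ge u v (nd F) F" using E by (simp_all add: diag_edge_def)
  have "u \<noteq> 0" "v \<noteq> 0" using diag_edge_integral[OF E] n by blast+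
  then have pos: "0 < u" "0 < v" using uv by simp_all
  have "nd F \<noteq> 0" using n by auto
  then have d: "0 < nd F" using distance_ge_0[OF F] by simp
  have pf: "principal_face F \<subseteq> weight_line (u / nd F) (v / nd F)"
      by (rule edge_in_weight_line[OF F E d])
  have "supporting_line (u / nd F) (v / nd F) F"
    unfolding supporting_line_def
  proof
    show "np F \<subseteq> {(t1, t2). u / nd F * t1 + v / nd F * t2 \<ge> 1}"
    proof clarify
      fix a b assume "(a, b) \<in> np F"
      then have "nd F \<le> u * a + v * b" by (rule np_weight_ge[OF uv(3,1,2)])
      then have "1 \<le> (u * a + v * b) / nd F" using d by simp
      then show "1 \<le> u / nd F * a + v / nd F * b" by (simp add: add_divide_distrib)
    qed
    show "np F \<inter> weight_line (u / nd F) (v / nd F) \<noteq> {}"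
      using diagonal_in_principal_face[OF F] diagonal_in_np[OF F] pf by blast
  qed
  then show ?thesis using that[OF pos E _ _ pf] principal_edge_compact[OF F E] pos by blast
qed

section \<open>Adapted shears and the height of the principal part\<close>

text \<open>The conclusion of the second part.\<close>

definition adapted_shear :: "(real \<times> real \<Rightarrow> real) \<Rightarrow> bool" where
  "adapted_shear f \<longleftrightarrow> (\<exists>\<psi>. smooth_near_0 \<psi> \<and> \<psi> 0 = 0 \<and> local_coords (shear \<psi>) \<and>
         adapted_coords f (shear \<psi>) \<and>
         (let F = taylor (f \<circ> shear \<psi>) in
           (\<forall>\<mu>1 \<mu>2. compact (principal_face F) \<and> 0 \<le> \<mu>1 \<and> \<mu>1 \<le> \<mu>2 \<and>
               supporting_line \<mu>1 \<mu>2 F \<and> principal_face F \<subseteq> weight_line \<mu>1 \<mu>2 \<longrightarrow>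
               (\<exists>q :: real poly. \<psi> = poly q \<and> (\<mu>1 > 0 \<longrightarrow> real (degree q) < \<mu>2 / \<mu>1))) \<and>
           (height f \<notin> \<int> \<longrightarrow>
              compact (principal_face F) \<and>
              (\<exists>\<mu>1 \<mu>2. 0 \<le> \<mu>1 \<and> \<mu>1 \<le> \<mu>2 \<and>
                 supporting_line \<mu>1 \<mu>2 F \<and> principal_face F \<subseteq> weight_line \<mu>1 \<mu>2))))"

text \<open>The conclusion of the third part.\<close>

definition principal_shear :: "(real \<times> real \<Rightarrow> real) \<Rightarrow> bool" where
  "principal_shear f \<longleftrightarrow> (\<exists>\<eta> :: real poly. poly \<eta> 0 = 0 \<and> local_coords (shear (poly \<eta>)) \<and>
         height f = height (f \<circ> shear (poly \<eta>)) \<and>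
         height f = formal_height (principal_part (taylor (f \<circ> shear (poly \<eta>)))))"

lemma smooth_shear_poly:
  fixes f :: "real \<times> real \<Rightarrow> real"
  assumes "smooth_near_0 f" "poly q 0 = 0"
  shows "smooth_near_0 (f \<circ> shear (poly q))"
proof -
  have "smooth_near_0 (shear (poly q)) \<and> shear (poly q) 0 = 0"
    using local_coords_smooth[OF poly_shear(1)[OF assms(2)]] .
  then show ?thesis unfolding o_def using smooth_near_0_comp[OF assms(1)] by blast
qed

lemma formal_height_shear:
  assumes "smooth_near_0 f" "poly q 0 = 0"
  shows "formal_height (fshear (taylor f) (fps_of_poly q)) = height f"
  using height_eq_formal[OF smooth_shear_poly[OF assms]] poly_shear(2,3)[OF assms(2)] assms(1)
      by metis

text \<open>The hypotheses \<open>steep\<close> and \<open>flat\<close> supply the degree bound and the ordering of the weights of the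
  principal edge.\<close>

lemma polynomial_adapted_shear:
  assumes f: "smooth_near_0 f" and F: "taylor f \<noteq> 0" and q: "poly q 0 = 0"
    and ad: "formal_height (fshear (taylor f) (fps_of_poly q))
        = nd (fshear (taylor f) (fps_of_poly q))"
    and steep: "\<And>u v. 0 < u \<Longrightarrow> u \<le> v \<Longrightarrow>
      weight_ge u v (nd (fshear (taylor f) (fps_of_poly q)) * (u + v)) (fshear (taylor f)
          (fps_of_poly q)) \<Longrightarrow> real (degree q) * u < v"
    and flat: "\<And>u v. 0 < u \<Longrightarrow> 0 < v \<Longrightarrow> diag_edge (fshear (taylor f) (fps_of_poly q)) u v \<Longrightarrow> u \<le> v"
  shows "adapted_shear f" "principal_shear f" "height f \<in> \<rat>"
proof -
  let ?G = "fshear (taylor f) (fps_of_poly q)"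
  have G: "?G \<noteq> 0" by (rule fshear_nonzero[OF F fps_of_poly_0_nth[OF q]])
  note ps = poly_shear[OF q]
  have t: "taylor (f \<circ> shear (poly q)) = ?G" by (rule ps(2)[OF f])
  have h: "height f = nd ?G" using formal_height_shear[OF f q] ad by simp
  then show "height f \<in> \<rat>" using distance_rational[OF G] by simp
  show "principal_shear f"
    unfolding principal_shear_def
  proof (intro exI conjI)
    have "formal_adapted (pp ?G)" using formal_adapted_pp[OF G] ad by (simp add: formal_adapted_def)
    then show "height f = formal_height (pp (taylor (f \<circ> shear (poly q))))"
      unfolding t h by (simp add: formal_adapted_def distance_pp[OF G])
  qed (use q ps in auto)
  show "adapted_shear f"
    unfolding adapted_shear_def Let_def
  proof (intro exI[of _ "poly q"] conjI allI impI)
    show "smooth_near_0 (poly q)" "poly q 0 = 0" "local_coords (shear (poly q))" using q ps by auto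
    show "adapted_coords f (shear (poly q))" unfolding adapted_coords_def t h ..
  next
    fix \<mu>1 \<mu>2 assume a: "compact (principal_face (taylor (f \<circ> shear (poly q)))) \<and> 0 \<le> \<mu>1 \<and> \<mu>1 \<le> \<mu>2 \<and>
      supporting_line \<mu>1 \<mu>2 (taylor (f \<circ> shear (poly q)))
          \<and> principal_face (taylor (f \<circ> shear (poly q))) \<subseteq> weight_line \<mu>1 \<mu>2"
    then have "weight_ge \<mu>1 \<mu>2 (nd ?G * (\<mu>1 + \<mu>2)) ?G" unfolding t
        using supporting_line_weight_ge(1)[OF G] by blast
    then have "real (degree q) < \<mu>2 / \<mu>1" if "\<mu>1 > 0" using steep[of \<mu>1 \<mu>2] that a
        by (simp add: pos_less_divide_eq)
    then show "\<exists>qa. poly q = poly qa \<and> (0 < \<mu>1 \<longrightarrow> real (degree qa) < \<mu>2 / \<mu>1)" by blast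
  next
    assume "height f \<notin> \<int>"
    then obtain u v where uv: "0 < u" "0 < v" "diag_edge ?G u v" "compact (principal_face ?G)"
      "supporting_line (u / nd ?G) (v / nd ?G) ?G" "principal_face ?G \<subseteq> weight_line (u / nd ?G) (v /
          nd ?G)"
      unfolding h using non_integral_distance[OF G] by blast
    show "compact (principal_face (taylor (f \<circ> shear (poly q))))" unfolding t by (rule uv(4))
    have d: "0 \<le> nd ?G" by (rule distance_ge_0[OF G])
    have "0 \<le> u / nd ?G" "u / nd ?G \<le> v / nd ?G" using uv(1) d flat[OF uv(1-3)]
        by (auto intro: divide_right_mono)
    then show "\<exists>\<mu>1 \<mu>2. 0 \<le> \<mu>1 \<and> \<mu>1 \<le> \<mu>2 \<and> supporting_line \<mu>1 \<mu>2 (taylor (f \<circ> shear (poly q))) \<and>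
      principal_face (taylor (f \<circ> shear (poly q))) \<subseteq> weight_line \<mu>1 \<mu>2"
      unfolding t using uv(5,6) by blast
  qed
qed

text \<open>Either some stage of the construction has no dominant root left, or the construction gives a
  power series. In the latter case the coordinates of the third part are those of a stage with the
  smallest multiplicity: there the principal part has exactly that height.\<close>

lemma dominant_root_adapted_shear:
  assumes f: "smooth_near_0 f" and F: "taylor f \<noteq> 0" and b: "dominant_root (taylor f) s L \<beta> n"
  shows "adapted_shear f" "principal_shear f" "height f \<in> \<rat>"
proof -
  let ?F = "taylor f"
  have g0: "steep_shear ?F 0" by (rule steep_shear_0[OF F b])
  have "adapted_shear f \<and> principal_shear f \<and> height f \<in> \<rat>"
  proof (cases "\<exists>q. steep_shear ?F q \<and> \<not> (\<exists>s L \<beta> n. dominant_root (fshear ?F (fps_of_poly q)) s L \<beta>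
      n)")
    case True
    then obtain q where g: "steep_shear ?F q"
        and nb: "\<And>s L \<beta> n. \<not> dominant_root (fshear ?F (fps_of_poly q)) s L \<beta> n" by blast
    let ?G = "fshear ?F (fps_of_poly q)"
    have q0: "poly q 0 = 0" using g by (simp add: steep_shear_def)
    have 1: "real (degree q) * u < v" if "0 < u" "u \<le> v" "weight_ge u v (nd ?G * (u + v)) ?G"
        for u v
      using g that unfolding steep_shear_def by (auto simp: add_pos_nonneg)
    have 2: "u \<le> v" if "0 < u" "0 < v" "diag_edge ?G u v" for u v
    proof -
      have "0 \<le> u \<and> 0 \<le> v \<and> 0 < u + v \<and> weight_ge u v (nd ?G * (u + v)) ?G"
        using that by (simp add: diag_edge_def)
      then show ?thesis using g unfolding steep_shear_def by blast
    qed
    show ?thesis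
      using polynomial_adapted_shear[OF f F q0 steep_shear_terminal_height[OF F g nb] 1 2] by blast
  next
    case False
    then obtain g q n s L \<beta> where c: "g $ 0 = 0" "poly q 0
        = 0" "dominant_root (fshear ?F (fps_of_poly q)) s L \<beta> n"
      "nd (fshear ?F g) = real n" "\<not> compact (principal_face (fshear ?F g))"
      using infinite_chain[OF F g0] by metis
    obtain D where D: "tower D" "\<And>i. D i 0 = g $ i * fact i"
        using borel_tower[of "\<lambda>i. g $ i * fact i"] by blast
    have D0: "D 0 0 = 0" using D(2)[of 0] c(1) by simp
    have gD: "g = Abs_fps (\<lambda>j. D j 0 / fact j)" by (rule fps_ext) (simp add: D(2))
    have l: "local_coords (shear (D 0))" by (rule local_coords_shear[OF D(1) D0])
    have t: "taylor (f \<circ> shear (D 0)) = fshear ?F g" by (rule taylor_comp_shear[OF f D(1) D0 gD])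
    have G: "fshear ?F (fps_of_poly q) \<noteq> 0"
        by (rule fshear_nonzero[OF F fps_of_poly_0_nth[OF c(2)]])
    have "height f \<le> real n" using dominant_root_height(2)[OF G c(3)] formal_height_shear[OF f c(2)]
        by simp
    moreover have "real n \<le> height f"
    proof -
      have "nd (fshear ?F g) \<in> coord_values ?F"
        unfolding coord_values_def fshear_def using l taylor_shear[OF D(1) gD]
            by (metis (mono_tags, lifting) mem_Collect_eq)
      then show ?thesis using coord_value_le_height[OF F] c(4) height_eq_formal[OF f] by simp
    qed
    ultimately have h: "height f = real n" by simp
    have "adapted_shear f"
      unfolding adapted_shear_def Let_def t
      using tower_smooth[OF D(1)] D0 l c(5) h
      by (intro exI[of _ "D 0"]) (simp add: adapted_coords_def t c(4))
    moreover have "principal_shear f"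
      unfolding principal_shear_def
      using c(2) poly_shear[OF c(2)] f dominant_root_height(3)[OF G c(3)] h
          by (intro exI[of _ q]) auto
    ultimately show ?thesis using h by simp
  qed
  then show "adapted_shear f" "principal_shear f" "height f \<in> \<rat>" by blast+
qed

text \<open>The coordinates need not be changed; the ordering of the weights is that of the given ones.\<close>

lemma no_dominant_root_adapted_shear:
  assumes f: "smooth_near_0 f" and F: "taylor f \<noteq> 0" and ad: "formal_adapted (taylor f)"
    and \<kappa>: "\<kappa>1 \<le> \<kappa>2" "principal_face (taylor f) \<subseteq> weight_line \<kappa>1 \<kappa>2"
  shows "adapted_shear f" "principal_shear f"
proof -
  let ?F = "taylor f"
  have z: "fshear ?F (fps_of_poly 0) = ?F" by (simp add: fshear_0)
  have 1: "real (degree (0 :: real poly)) * u < v" if "0 < u" "u \<le> v" for u v using that by simp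
  have 2: "u \<le> v" if "diag_edge ?F u v" for u v
    using edge_weight_line[OF F that \<kappa>(2)] mult_left_mono[OF \<kappa>(1) distance_ge_0[OF F]] by simp
  show "adapted_shear f" "principal_shear f"
    using polynomial_adapted_shear[OF f F, of 0] 1 2 ad unfolding z formal_adapted_def by simp_all
qed

lemma taylor_swap:
  assumes "smooth_near_0 f"
  shows "taylor (f \<circ> prod.swap) = swap_vars (taylor f)" "height (f \<circ> prod.swap)
      = height f" "smooth_near_0 (f \<circ> prod.swap)"
proof -
  have sw: "smooth_near_0 (prod.swap :: real \<times> real \<Rightarrow> _)" "(prod.swap 0 :: real \<times> real) = 0"
    using local_coords_smooth[OF local_coords_swap] by blast+
  have "taylor (\<lambda>x. f (prod.swap x)) = fps2_compose (taylor f) (taylor (\<lambda>x. fst (prod.swap x)))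
      (taylor (\<lambda>x. snd (prod.swap x)))"
    by (rule taylor_compose[OF assms sw])
  also have "\<dots> = fps2_compose (taylor f) X2 X1" by (simp add: taylor_fst taylor_snd)
  also have "\<dots> = swap_vars (taylor f)" by (metis comp_swap_vars_arg comp_id)
  finally show "taylor (f \<circ> prod.swap) = swap_vars (taylor f)" by (simp add: o_def)
  show "height (f \<circ> prod.swap) = height f"
      by (rule height_comp[OF local_coords_swap local_coords_swap]) simp
  show "smooth_near_0 (f \<circ> prod.swap)" using smooth_near_0_comp[OF assms sw] by (simp add: o_def)
qed

lemma height_rational:
  assumes f: "smooth_near_0 f" and F: "taylor f \<noteq> 0"
  shows "height f \<in> \<rat>"
proof -
  consider s L \<beta> n where "dominant_root (taylor f) s L \<beta> n" | s L \<beta> n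
      where "dominant_root (swap_vars (taylor f)) s L \<beta> n"
    | "formal_adapted (taylor f)" using formal_adapted_iff[OF F] by blast
  then show ?thesis
  proof cases
    case 1
    then show ?thesis by (rule dominant_root_adapted_shear(3)[OF f F])
  next
    case 2
    note sw = taylor_swap[OF f]
    have "taylor (f \<circ> prod.swap) \<noteq> 0" using F sw(1) by (simp add: swap_vars_eq_0)
    then show ?thesis using dominant_root_adapted_shear(3)[OF sw(3)] 2 sw(1,2) by metis
  next
    case 3
    then show ?thesis using distance_rational[OF F] height_eq_formal[OF f]
        by (simp add: formal_adapted_def)
  qed
qed

lemma weights_exist:
  assumes F: "F \<noteq> 0" and d: "0 < nd F"
  shows "\<exists>\<kappa>1 \<kappa>2. 0 \<le> \<kappa>1 \<and> 0 \<le> \<kappa>2 \<and> principal_face F \<subseteq> weight_line \<kappa>1 \<kappa>2"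
proof (cases "\<exists>u v. diag_edge F u v")
  case True
  then obtain u v where E: "diag_edge F u v" by blast
  then have "0 \<le> u / nd F" "0 \<le> v / nd F" using d by (simp_all add: diag_edge_def)
  then show ?thesis using edge_in_weight_line[OF F E d] by blast
next
  case False
  then obtain D where D: "nd F = real D" "principal_face F = {(real D, real D)}"
      using principal_face_vertex[OF F] by metis
  then have "principal_face F \<subseteq> weight_line (1 / (2 * real D)) (1 / (2 * real D))" using d
      by (simp add: weight_line_def)
  then show ?thesis using d D by (intro exI[of _ "1 / (2 * real D)"]) auto
qed

lemma edge_imp_diag_edge:
  assumes F: "F \<noteq> 0" and e: "principal_face F edge_of np F"
  obtains u v where "diag_edge F u v"
proof -
  have "\<exists>u v. diag_edge F u v"
  proof (rule ccontr)
    assume "\<nexists>u v. diag_edge F u v"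
    then obtain D where "principal_face F = {(real D, real D)}" using principal_face_vertex[OF F]
        by metis
    then show False using e by (simp add: edge_of_def)
  qed
  then show ?thesis using that by blast
qed

text \<open>A dominant root after the interchange of the coordinates would have weight ratio \<open>1 / s\<close>, hence
  \<open>s = 1\<close> by the ordering of the weights, and this case is covered by the reduction to shears.\<close>

lemma adapted_iff_no_dominant_root:
  assumes F: "F \<noteq> 0" and \<kappa>: "\<kappa>1 \<le> \<kappa>2" "principal_face F \<subseteq> weight_line \<kappa>1 \<kappa>2"
  shows "formal_adapted F \<longleftrightarrow> \<not> (\<exists>s L \<beta> n. dominant_root F s L \<beta> n)"
proof
  assume "formal_adapted F"
  then show "\<not> (\<exists>s L \<beta> n. dominant_root F s L \<beta> n)" using formal_adapted_iff[OF F] by blast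
next
  assume nb: "\<not> (\<exists>s L \<beta> n. dominant_root F s L \<beta> n)"
  have "\<not> 2 \<le> s" if b: "dominant_root (swap_vars F) s L \<beta> n" for s L \<beta> n
  proof -
    have "diag_edge (swap_vars F) (1 / (1 + real s)) (real s / (1 + real s))"
      using F by (intro dominant_root_diag_edge[OF _ b]) (simp add: swap_vars_eq_0)
    from diag_edge_swap_vars[OF this] have "diag_edge F (real s / (1 + real s)) (1 / (1 + real s))"
        by (simp add: swap_vars_swap_vars)
    from edge_weight_line[OF F this \<kappa>(2)] mult_left_mono[OF \<kappa>(1) distance_ge_0[OF F]]
    have "real s / (1 + real s) \<le> 1 / (1 + real s)" by simp
    then have "real s \<le> 1" by (simp add: divide_le_cancel)
    then show ?thesis by simp
  qed
  then show "formal_adapted F" using height_no_dominant_root[OF F] nb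
      by (simp add: formal_adapted_def)
qed

text \<open>With \<open>s = \<kappa>\<^sub>2 / \<kappa>\<^sub>1\<close> the principal part is quasi-homogeneous for \<open>(1, s)\<close>, so the orders of
  vanishing on the circle are multiplicities of roots.\<close>

lemma dominant_root_iff_circle_order:
  assumes F: "F \<noteq> 0" and d: "0 < nd F" and \<kappa>: "0 \<le> \<kappa>1" "\<kappa>1
      \<le> \<kappa>2" "principal_face F \<subseteq> weight_line \<kappa>1 \<kappa>2"
  shows "(\<exists>s L \<beta> n. dominant_root F s L \<beta> n) \<longleftrightarrow>
      (principal_face F edge_of np F \<and> compact (principal_face F)) \<and> \<kappa>2 / \<kappa>1 \<in> \<nat> \<and>
      (\<forall>p\<in>sphere 0 1. vanishing_order (fps2_eval (pp F)) p = circle_order (pp F) \<longrightarrow> fst p \<noteq> 0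
          \<and> snd p \<noteq> 0) \<and>
      real (circle_order (pp F)) > nd F"
proof -
  have crit: "((\<forall>p\<in>sphere 0 1. vanishing_order (fps2_eval (pp F)) p = circle_order (pp F)
      \<longrightarrow> fst p \<noteq> 0 \<and> snd p \<noteq> 0) \<and>
      nd F < real (circle_order (pp F))) \<longleftrightarrow> (\<exists>b. b \<noteq> 0 \<and> nd F
          < real (order b (linepoly (pp F) s L)))"
    and lin: "weight_ge 1 (real s) (real L) (pp F)" "linepoly (pp F) s L \<noteq> 0"
    if E: "diag_edge F u v" and uv: "0 < u" "v = real s * u" and s: "1 \<le> s"
        and L: "real L = nd F * (1 + real s)" for u v s L
  proof -
    have u1: "u * (1 + real s) = 1" using E uv(2) by (simp add: diag_edge_def algebra_simps)
    have on: "j + s * k = L \<longleftrightarrow> u * real j + v * real k = nd F" for j k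
    proof -
      have "u * real j + v * real k = u * real (j + s * k)" by (simp add: uv(2) algebra_simps)
      moreover have "nd F = u * real L" using L u1 by (simp add: mult.left_commute)
      ultimately show ?thesis using uv(1) by (auto simp del: of_nat_add of_nat_mult)
    qed
    have lp: "line_polynomial (pp F) s L"
    proof
      show "j + s * k = L" if "pp F $ j $ k \<noteq> 0" for j k
        using that on by (auto simp: pp_edge_nth[OF F E] split: if_splits)
    qed (use s distance_pp(1)[OF F] in auto)
    have v0: "0 < v" using uv s by simp
    obtain j k where jk: "F $ j $ k \<noteq> 0" "u * real j + v * real k = nd F" "real j < nd F"
        using diag_edge_support(1)[OF E v0] by blast
    obtain j' k' where jk': "F $ j' $ k' \<noteq> 0" "u * real j' + v * real k' = nd F" "real k' < nd F"
        using diag_edge_support(2)[OF E uv(1)] by blast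
    show "((\<forall>p\<in>sphere 0 1. vanishing_order (fps2_eval (pp F)) p = circle_order (pp F) \<longrightarrow> fst p \<noteq> 0
        \<and> snd p \<noteq> 0) \<and>
      nd F < real (circle_order (pp F))) \<longleftrightarrow> (\<exists>b. b \<noteq> 0 \<and> nd F
          < real (order b (linepoly (pp F) s L)))"
      by (rule line_polynomial.circle_order_criterion[OF lp, of j k "nd F" j' k'])
        (use jk jk' in \<open>simp_all add: pp_edge_nth[OF F E]\<close>)
    show "weight_ge 1 (real s) (real L) (pp F)"
    proof (rule weight_geI)
      fix j k assume "pp F $ j $ k \<noteq> 0"
      then have "j + s * k = L" by (rule line_polynomial.on_line[OF lp])
      then show "real L \<le> 1 * real j + real s * real k"
          by (metis mult_1 of_nat_add of_nat_mult order_refl)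
    qed
    show "linepoly (pp F) s L \<noteq> 0" by (rule line_polynomial.p_nonzero[OF lp])
  qed
  show ?thesis
  proof
    assume "\<exists>s L \<beta> n. dominant_root F s L \<beta> n"
    then obtain s L \<beta> n where b: "dominant_root F s L \<beta> n" by blast
    then have B: "1 \<le> s" "real L = nd F * (1 + real s)" unfolding dominant_root_def by blast+
    note E = dominant_root_diag_edge[OF F b]
    have pos: "0 < 1 / (1 + real s)" "0 < real s / (1 + real s)" using B(1)
        by (auto intro: divide_pos_pos)
    have "real s / (1 + real s) = real s * (1 / (1 + real s))" by simp
    from crit[OF E pos(1) this B] have
      "(\<forall>p\<in>sphere 0 1. vanishing_order (fps2_eval (pp F)) p = circle_order (pp F) \<longrightarrow> fst p \<noteq> 0
          \<and> snd p \<noteq> 0) \<and>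
        nd F < real (circle_order (pp F))"
      using b dominant_root_pp[OF F, of s L \<beta> n] by (auto simp: dominant_root_def distance_pp[OF F])
    moreover have "\<kappa>2 / \<kappa>1 = real s"
    proof -
      note w = edge_weight_line[OF F E \<kappa>(3)]
      have "\<kappa>2 / \<kappa>1 = (nd F * \<kappa>2) / (nd F * \<kappa>1)" using d by simp
      also have "\<dots> = real s" unfolding w using B(1) by simp
      finally show ?thesis .
    qed
    moreover have "principal_face F edge_of np F" by (rule principal_face_edge(2)[OF F E])
    moreover have "compact (principal_face F)" using principal_edge_compact[OF F E] pos by simp
    ultimately show "(principal_face F edge_of np F \<and> compact (principal_face F)) \<and> \<kappa>2 / \<kappa>1 \<in> \<nat> \<and>
      (\<forall>p\<in>sphere 0 1. vanishing_order (fps2_eval (pp F)) p = circle_order (pp F) \<longrightarrow> fst p \<noteq> 0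
          \<and> snd p \<noteq> 0) \<and>
      real (circle_order (pp F)) > nd F" by simp
  next
    assume a: "(principal_face F edge_of np F \<and> compact (principal_face F)) \<and> \<kappa>2 / \<kappa>1 \<in> \<nat> \<and>
      (\<forall>p\<in>sphere 0 1. vanishing_order (fps2_eval (pp F)) p = circle_order (pp F) \<longrightarrow> fst p \<noteq> 0
          \<and> snd p \<noteq> 0) \<and>
      real (circle_order (pp F)) > nd F"
    then obtain u v where E: "diag_edge F u v" using edge_imp_diag_edge[OF F] by blast
    have uv: "0 < u" "0 < v" "u + v = 1" using principal_edge_compact[OF F E] a E
        by (auto simp: diag_edge_def)
    note w = edge_weight_line[OF F E \<kappa>(3)]
    obtain s where s: "\<kappa>2 / \<kappa>1 = real s" using a by (auto elim: Nats_cases)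
    have "\<kappa>1 \<noteq> 0" using w uv by auto
    then have "0 < \<kappa>1" using \<kappa> by simp
    then have k2: "\<kappa>2 = real s * \<kappa>1" using s by (simp add: field_simps)
    have "v = nd F * (real s * \<kappa>1)" using w(2) k2 by simp
    also have "\<dots> = real s * (nd F * \<kappa>1)" by (rule mult.left_commute)
    finally have v: "v = real s * u" using w(1) by simp
    have "1 * \<kappa>1 \<le> real s * \<kappa>1" using \<kappa>(2) k2 by simp
    then have "1 \<le> real s" using \<open>0 < \<kappa>1\<close> by (simp only: mult_le_cancel_right_pos)
    then have s1: "1 \<le> s" by simp
    obtain j k where jk: "u * real j + v * real k = nd F" using diag_edge_support(1)[OF E uv(2)]
        by blast
    define L where "L = j + s * k"
    have u1: "u * (1 + real s) = 1" using uv v by (simp add: algebra_simps)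
    have "u * real L = nd F" using jk by (simp add: L_def v algebra_simps)
    then have "u * real L = u * (nd F * (1 + real s))" using u1 by (simp add: mult.left_commute)
    then have L: "real L = nd F * (1 + real s)" using uv by simp
    note cr = crit[OF E uv(1) v s1 L] and ln = lin[OF E uv(1) v s1 L]
    obtain b where b: "b \<noteq> 0" "nd F < real (order b (linepoly (pp F) s L))" using cr a by blast
    have "dominant_root (pp F) s L b (order b (linepoly (pp F) s L))"
      by (rule line_root_bound[OF distance_pp(1)[OF F] s1 b(1) ln]) (simp add: b distance_pp(2)[OF
          F])
    then show "\<exists>s L \<beta> n. dominant_root F s L \<beta> n" using dominant_root_pp[OF F] by blast
  qed
qed

theorem corollary5p2:
  fixes f :: "real \<times> real \<Rightarrow> real"
  assumes smooth: "smooth_near_0 f"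
    and finite_type: "finite_type f"
    and f0: "f 0 = 0"
    and grad0: "(f has_derivative (\<lambda>_. 0)) (at 0)"
  shows "height f \<in> \<rat> \<and>
    (\<exists>\<kappa>1 \<kappa>2. 0 \<le> \<kappa>1 \<and> 0 \<le> \<kappa>2 \<and> principal_face (taylor f) \<subseteq> weight_line \<kappa>1 \<kappa>2) \<and>
    (adapted_coords f id \<longleftrightarrow> formal_adapted (principal_part (taylor f))) \<and>
    height f \<le> formal_height (principal_part (taylor f)) \<and>
    (\<forall>\<kappa>1 \<kappa>2. 0 \<le> \<kappa>1 \<and> \<kappa>1 \<le> \<kappa>2 \<and> principal_face (taylor f) \<subseteq> weight_line \<kappa>1 \<kappa>2 \<longrightarrow>
      (principal_face (taylor f) edge_of newton_polyhedron (taylor f) \<and>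
         compact (principal_face (taylor f)) \<longrightarrow>
         0 < \<kappa>1 \<and> 0 < \<kappa>2 \<and>
         (\<forall>\<mu>1 \<mu>2. principal_face (taylor f) \<subseteq> weight_line \<mu>1 \<mu>2 \<longrightarrow> \<mu>1 = \<kappa>1 \<and> \<mu>2 = \<kappa>2)) \<and>
      (\<not> adapted_coords f id \<longleftrightarrow>
         (principal_face (taylor f) edge_of newton_polyhedron (taylor f) \<and>
          compact (principal_face (taylor f))) \<and>
         \<kappa>2 / \<kappa>1 \<in> \<nat> \<and>
         (\<forall>p\<in>sphere 0 1.
            vanishing_order (fps2_eval (principal_part (taylor f))) p =
              circle_order (principal_part (taylor f)) \<longrightarrow>
            fst p \<noteq> 0 \<and> snd p \<noteq> 0) \<and>
         real (circle_order (principal_part (taylor f))) > newton_distance (taylor f)) \<and>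
      (\<exists>\<psi>. smooth_near_0 \<psi> \<and> \<psi> 0 = 0 \<and> local_coords (shear \<psi>) \<and>
         adapted_coords f (shear \<psi>) \<and>
         (let F = taylor (f \<circ> shear \<psi>) in
           (\<forall>\<mu>1 \<mu>2. compact (principal_face F) \<and> 0 \<le> \<mu>1 \<and> \<mu>1 \<le> \<mu>2 \<and>
               supporting_line \<mu>1 \<mu>2 F \<and> principal_face F \<subseteq> weight_line \<mu>1 \<mu>2 \<longrightarrow>
               (\<exists>q :: real poly. \<psi> = poly q \<and> (\<mu>1 > 0 \<longrightarrow> real (degree q) < \<mu>2 / \<mu>1))) \<and>
           (height f \<notin> \<int> \<longrightarrow>
              compact (principal_face F) \<and>
              (\<exists>\<mu>1 \<mu>2. 0 \<le> \<mu>1 \<and> \<mu>1 \<le> \<mu>2 \<and>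
                 supporting_line \<mu>1 \<mu>2 F \<and> principal_face F \<subseteq> weight_line \<mu>1 \<mu>2)))) \<and>
      (\<exists>\<eta> :: real poly. poly \<eta> 0 = 0 \<and> local_coords (shear (poly \<eta>)) \<and>
         height f = height (f \<circ> shear (poly \<eta>)) \<and>
         height f = formal_height (principal_part (taylor (f \<circ> shear (poly \<eta>))))))"
proof -
  let ?F = "taylor f"
  have F: "?F \<noteq> 0" using finite_type by (simp add: finite_type_def support_empty_iff)
  have d: "0 < nd ?F"
  proof -
    have "weight_ge 1 1 1 ?F"
    proof (rule weight_geI)
      fix j k assume "?F $ j $ k \<noteq> 0"
      then have "1 \<le> j + k" using f0 taylor_0_0[of f] by (cases "j + k") auto
      then show "1 \<le> 1 * real j + 1 * real k" by linarith
    qed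
    then have "1 \<le> (1 + 1) * nd ?F" by (intro weight_ge_le_distance[OF F]) auto
    then show ?thesis by simp
  qed
  have h: "height f = formal_height ?F" by (rule height_eq_formal[OF smooth])
  have ad: "adapted_coords f id \<longleftrightarrow> formal_adapted ?F"
    by (simp add: adapted_coords_def formal_adapted_def h)
  have main: "(principal_face ?F edge_of np ?F \<and> compact (principal_face ?F) \<longrightarrow>
         0 < \<kappa>1 \<and> 0 < \<kappa>2 \<and>
         (\<forall>\<mu>1 \<mu>2. principal_face ?F \<subseteq> weight_line \<mu>1 \<mu>2 \<longrightarrow> \<mu>1 = \<kappa>1 \<and> \<mu>2 = \<kappa>2)) \<and>
      (\<not> adapted_coords f id \<longleftrightarrow>
         (principal_face ?F edge_of np ?F \<and> compact (principal_face ?F)) \<and>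
         \<kappa>2 / \<kappa>1 \<in> \<nat> \<and>
         (\<forall>p\<in>sphere 0 1. vanishing_order (fps2_eval (pp ?F)) p = circle_order (pp ?F) \<longrightarrow> fst p \<noteq> 0
             \<and> snd p \<noteq> 0) \<and>
         real (circle_order (pp ?F)) > nd ?F) \<and>
      adapted_shear f \<and> principal_shear f"
    if \<kappa>: "0 \<le> \<kappa>1" "\<kappa>1 \<le> \<kappa>2" "principal_face ?F \<subseteq> weight_line \<kappa>1 \<kappa>2" for \<kappa>1 \<kappa>2
  proof (intro conjI)
    show "principal_face ?F edge_of np ?F \<and> compact (principal_face ?F) \<longrightarrow>
         0 < \<kappa>1 \<and> 0 < \<kappa>2 \<and>
         (\<forall>\<mu>1 \<mu>2. principal_face ?F \<subseteq> weight_line \<mu>1 \<mu>2 \<longrightarrow> \<mu>1 = \<kappa>1 \<and> \<mu>2 = \<kappa>2)"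
    proof
      assume a: "principal_face ?F edge_of np ?F \<and> compact (principal_face ?F)"
      then obtain u v where E: "diag_edge ?F u v" using edge_imp_diag_edge[OF F] by blast
      have uv: "0 < u" "0 < v" using principal_edge_compact[OF F E] a by blast+
      note w = edge_weight_line[OF F E]
      have "0 < \<kappa>1" "0 < \<kappa>2" using w[OF \<kappa>(3)] uv d by (metis zero_less_mult_pos)+
      moreover have "\<mu>1 = \<kappa>1 \<and> \<mu>2 = \<kappa>2" if "principal_face ?F \<subseteq> weight_line \<mu>1 \<mu>2" for \<mu>1 \<mu>2
      proof -
        have "nd ?F * \<mu>1 = nd ?F * \<kappa>1" "nd ?F * \<mu>2 = nd ?F * \<kappa>2" using w[OF that] w[OF \<kappa>(3)]
            by simp_all
        then show ?thesis using d by simp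
      qed
      ultimately show "0 < \<kappa>1 \<and> 0 < \<kappa>2 \<and>
         (\<forall>\<mu>1 \<mu>2. principal_face ?F \<subseteq> weight_line \<mu>1 \<mu>2 \<longrightarrow> \<mu>1 = \<kappa>1 \<and> \<mu>2 = \<kappa>2)" by blast
    qed
    note iff = adapted_iff_no_dominant_root[OF F \<kappa>(2,3)]
    show "\<not> adapted_coords f id \<longleftrightarrow>
         (principal_face ?F edge_of np ?F \<and> compact (principal_face ?F)) \<and>
         \<kappa>2 / \<kappa>1 \<in> \<nat> \<and>
         (\<forall>p\<in>sphere 0 1. vanishing_order (fps2_eval (pp ?F)) p = circle_order (pp ?F) \<longrightarrow> fst p \<noteq> 0
             \<and> snd p \<noteq> 0) \<and>
         real (circle_order (pp ?F)) > nd ?F"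
      unfolding ad iff not_not by (rule dominant_root_iff_circle_order[OF F d \<kappa>])
    have "adapted_shear f \<and> principal_shear f"
    proof (cases "formal_adapted ?F")
      case True
      then show ?thesis using no_dominant_root_adapted_shear[OF smooth F _ \<kappa>(2,3)] by blast
    next
      case False
      then obtain s L \<beta> n where "dominant_root ?F s L \<beta> n" using iff by blast
      then show ?thesis using dominant_root_adapted_shear[OF smooth F] by blast
    qed
    then show "adapted_shear f" "principal_shear f" by blast+
  qed
  show ?thesis
  proof (intro conjI allI impI)
    show "height f \<in> \<rat>" by (rule height_rational[OF smooth F])
    show "\<exists>\<kappa>1 \<kappa>2. 0 \<le> \<kappa>1 \<and> 0 \<le> \<kappa>2 \<and> principal_face ?F \<subseteq> weight_line \<kappa>1 \<kappa>2"
      by (rule weights_exist[OF F d])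
    show "adapted_coords f id \<longleftrightarrow> formal_adapted (principal_part ?F)"
      unfolding ad by (rule formal_adapted_pp[OF F, symmetric])
    show "height f \<le> formal_height (principal_part ?F)" unfolding h by (rule height_le_pp[OF F])
  qed (use main[unfolded adapted_shear_def principal_shear_def] in blast)+
qed

end
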